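(* Let $f:S^n\to S^m$ be an LOMSE with nonzero singular value $\lambda$ of multiplicity $p$. Then there exists an integer $k\ge2$ such that: (1) writing $f(x)=(f_1(x),\dots,f_{m+1}(x))\in\mathbb R^{m+1}$, each component $f_i$ is a spherical harmonic function of degree $k$ on $S^n$; (2) $\lambda=\sqrt{\dfrac{k(k+n-1)}{p}}$; (3) for $\theta\in(0,\pi/2)$, $M_{f,\theta}$ is a Lawson-Osserman sphere associated to $f$ (i.e. is minimal in $S^{n+m+1}$) if and only if $$\theta=\arccos\sqrt{\frac{1-\frac pn}{1-\frac{p}{k(k+n-1)}}}.$$
   Context: $S^d\subset\mathbb R^{d+1}$ is the unit sphere with its canonical metric $g_d$. For a smooth map $f:S^n\to S^m$ and $\theta\in(0,\pi/2)$ put $M_{f,\theta}=\{(\cos\theta\cdot x,\ \sin\theta\cdot f(x)):x\in S^n\}\subset S^{n+m+1}$. The map $f$ is a Lawson-Osserman map (LOM) if there is some $\theta\in(0,\pi/2)$ such that $M_{f,\theta}$ is a minimal submanifold of $S^{n+m+1}$; then $M_{f,\theta}$ is called an associated Lawson-Osserman sphere. Singular values of $(f_* )_x$ are those of the linear map $(f_* )_x:(T_xS^n,g_n)\to(T_{f(x)}S^m,g_m)$. An LOMSE is an LOM which is not a totally geodesic isometric embedding and such that for each $x\in S^n$ all nonzero singular values of $(f_* )_x$ are equal; it is a fact that then the common nonzero singular value $\lambda$ and its multiplicity $p$ (the rank of $f$) are constant on $S^n$. A spherical harmonic function of degree $k$ on $S^n$ is the restriction to $S^n$ of a homogeneous harmonic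 polynomial of degree $k$ on $\mathbb R^{n+1}$. *)

theory Defs
  imports "HOL-Analysis.Analysis"
begin

section \<open>Smooth maps on subsets of Euclidean space\<close>

primrec Ck_on :: "nat \<Rightarrow> 'a::euclidean_space set \<Rightarrow> ('a \<Rightarrow> 'b::euclidean_space) \<Rightarrow> bool" where
  "Ck_on 0 U f \<longleftrightarrow> continuous_on U f"
| "Ck_on (Suc k) U f \<longleftrightarrow>
     f differentiable_on U \<and> (\<forall>v. Ck_on k U (\<lambda>x. frechet_derivative f (at x) v))"

text \<open>Only meant for open \<open>U\<close>.\<close>

definition smooth_on_open :: "'a::euclidean_space set \<Rightarrow> ('a \<Rightarrow> 'b::euclidean_space) \<Rightarrow> bool" where
  "smooth_on_open U f \<longleftrightarrow> open U \<and> (\<forall>k. Ck_on k U f)"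

text \<open>A map on an arbitrary subset \<open>X\<close> of a Euclidean space is smooth if locally it is the
  restriction of a smooth map on an open set (Milnor). On an embedded submanifold this is
  smoothness in charts.\<close>

definition smooth_map_on :: "'a::euclidean_space set \<Rightarrow> ('a \<Rightarrow> 'b::euclidean_space) \<Rightarrow> bool" where
  "smooth_map_on X f \<longleftrightarrow>
     (\<forall>x\<in>X. \<exists>U F. x \<in> U \<and> smooth_on_open U F \<and> (\<forall>y\<in>X \<inter> U. F y = f y))"


section \<open>Submanifolds of Euclidean space\<close>

text \<open>Milnor's definition: \<open>M\<close> is locally diffeomorphic to an open subset of \<open>\<real>\<^sup>d\<close>. Since \<open>d\<close> is a
  number and not a type, an arbitrary \<open>d\<close>-dimensional linear subspace \<open>L\<close> of the ambient space
  serves as \<open>\<real>\<^sup>d\<close>.\<close>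

definition smooth_submanifold :: "nat \<Rightarrow> 'a::euclidean_space set \<Rightarrow> bool" where
  "smooth_submanifold d M \<longleftrightarrow>
     (\<forall>p\<in>M. \<exists>W L U (\<phi> :: 'a \<Rightarrow> 'a) \<psi>.
        openin (top_of_set M) W \<and> p \<in> W \<and>
        subspace L \<and> dim L = d \<and> openin (top_of_set L) U \<and>
        homeomorphism W U \<phi> \<psi> \<and> smooth_map_on W \<phi> \<and> smooth_map_on U \<psi>)"

definition tangent_space :: "'a::euclidean_space set \<Rightarrow> 'a \<Rightarrow> 'a set" where
  "tangent_space M p =
     {v. \<exists>\<gamma> \<epsilon>. \<epsilon> > 0 \<and> smooth_on_open {-\<epsilon><..<\<epsilon>} \<gamma> \<and> \<gamma> ` {-\<epsilon><..<\<epsilon>} \<subseteq> M \<and>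
        \<gamma> 0 = p \<and> (\<gamma> has_vector_derivative v) (at (0::real))}"

text \<open>The derivative within \<open>M\<close> is not unique as a linear map on the ambient space, but its values
  on \<open>tangent_space M p\<close> are. It is only ever applied to tangent vectors.\<close>

definition differential ::
  "'a::euclidean_space set \<Rightarrow> ('a \<Rightarrow> 'b::euclidean_space) \<Rightarrow> 'a \<Rightarrow> 'a \<Rightarrow> 'b" where
  "differential M f p = frechet_derivative f (at p within M)"

definition tangent_field :: "'a::euclidean_space set \<Rightarrow> ('a \<Rightarrow> 'a) \<Rightarrow> bool" where
  "tangent_field M Y \<longleftrightarrow> smooth_map_on M Y \<and> (\<forall>q\<in>M. Y q \<in> tangent_space M q)"


section \<open>Second fundamental form and minimality\<close>

text \<open>Throughout, \<open>N\<close> is a submanifold of a Euclidean space with the induced metric, and \<open>M\<close> is a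
  submanifold contained in \<open>N\<close>.\<close>

definition orth_proj :: "'a::euclidean_space set \<Rightarrow> 'a \<Rightarrow> 'a" where
  "orth_proj V x = (THE y. y \<in> V \<and> (\<forall>z\<in>V. orthogonal (x - y) z))"

definition normal_space :: "'a::euclidean_space set \<Rightarrow> 'a set \<Rightarrow> 'a \<Rightarrow> 'a set" where
  "normal_space N M p = {w \<in> tangent_space N p. \<forall>v\<in>tangent_space M p. orthogonal w v}"

text \<open>The Levi-Civita connection of \<open>N\<close> is the \<open>TN\<close>-component of the flat derivative. Hence the
  normal part of the covariant derivative of \<open>Y\<close> along \<open>u\<close> is the orthogonal projection of the
  flat derivative onto the normal space of \<open>M\<close> in \<open>N\<close>. The result does not depend on the
  tangent field \<open>Y\<close> of \<open>M\<close> chosen to extend \<open>v\<close>.\<close>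

definition second_fundamental_form ::
  "'a::euclidean_space set \<Rightarrow> 'a set \<Rightarrow> 'a \<Rightarrow> 'a \<Rightarrow> 'a \<Rightarrow> 'a" where
  "second_fundamental_form N M p u v =
     (let Y = (SOME Y. tangent_field M Y \<and> Y p = v)
      in orth_proj (normal_space N M p) (differential M Y p u))"

definition orthonormal_basis_of :: "'a::euclidean_space set \<Rightarrow> 'a set \<Rightarrow> bool" where
  "orthonormal_basis_of V E \<longleftrightarrow>
     E \<subseteq> V \<and> span E = V \<and> pairwise orthogonal E \<and> (\<forall>e\<in>E. norm e = 1)"

text \<open>Unnormalised (no factor \<open>1 / dim M\<close>).\<close>

definition mean_curvature_vector ::
  "'a::euclidean_space set \<Rightarrow> 'a set \<Rightarrow> 'a \<Rightarrow> 'a" where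
  "mean_curvature_vector N M p =
     (let E = (SOME E. orthonormal_basis_of (tangent_space M p) E)
      in \<Sum>e\<in>E. second_fundamental_form N M p e e)"

definition minimal_submanifold ::
  "nat \<Rightarrow> 'a::euclidean_space set \<Rightarrow> 'a set \<Rightarrow> bool" where
  "minimal_submanifold d N M \<longleftrightarrow>
     M \<subseteq> N \<and> smooth_submanifold d M \<and> (\<forall>p\<in>M. mean_curvature_vector N M p = 0)"

definition isometric_embedding ::
  "'a::euclidean_space set \<Rightarrow> 'b::euclidean_space set \<Rightarrow> ('a \<Rightarrow> 'b) \<Rightarrow> bool" where
  "isometric_embedding M N f \<longleftrightarrow>
     f ` M \<subseteq> N \<and> smooth_map_on M f \<and> (\<exists>g. homeomorphism M (f ` M) f g) \<and>
     (\<forall>x\<in>M. \<forall>u\<in>tangent_space M x. \<forall>v\<in>tangent_space M x.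
        differential M f x u \<bullet> differential M f x v = u \<bullet> v)"

definition totally_geodesic :: "'a::euclidean_space set \<Rightarrow> 'a set \<Rightarrow> bool" where
  "totally_geodesic N M \<longleftrightarrow>
     (\<forall>p\<in>M. \<forall>u\<in>tangent_space M p. \<forall>v\<in>tangent_space M p.
        second_fundamental_form N M p u v = 0)"

definition totally_geodesic_isometric_embedding ::
  "'a::euclidean_space set \<Rightarrow> 'b::euclidean_space set \<Rightarrow> ('a \<Rightarrow> 'b) \<Rightarrow> bool" where
  "totally_geodesic_isometric_embedding M N f \<longleftrightarrow>
     isometric_embedding M N f \<and> totally_geodesic N (f ` M)"


section \<open>Singular values\<close>

text \<open>For a linear map \<open>A\<close> on a subspace \<open>V\<close>, this is the \<open>\<sigma>\<^sup>2\<close>-eigenspace of \<open>A\<^sup>* A\<close> on \<open>V\<close>; the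
  equation \<open>A\<^sup>* A v = \<sigma>\<^sup>2 v\<close> is tested against all \<open>w \<in> V\<close>.\<close>

definition singular_space ::
  "'a::euclidean_space set \<Rightarrow> ('a \<Rightarrow> 'b::euclidean_space) \<Rightarrow> real \<Rightarrow> 'a set" where
  "singular_space V A \<sigma> = {v \<in> V. \<forall>w\<in>V. A v \<bullet> A w = \<sigma>\<^sup>2 * (v \<bullet> w)}"

definition singular_value ::
  "'a::euclidean_space set \<Rightarrow> ('a \<Rightarrow> 'b::euclidean_space) \<Rightarrow> real \<Rightarrow> bool" where
  "singular_value V A \<sigma> \<longleftrightarrow> \<sigma> \<ge> 0 \<and> (\<exists>v\<in>singular_space V A \<sigma>. v \<noteq> 0)"

definition singular_multiplicity ::
  "'a::euclidean_space set \<Rightarrow> ('a \<Rightarrow> 'b::euclidean_space) \<Rightarrow> real \<Rightarrow> nat" where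
  "singular_multiplicity V A \<sigma> = dim (singular_space V A \<sigma>)"


section \<open>Lawson-Osserman maps\<close>

text \<open>The spheres \<open>S\<^sup>n\<close> and \<open>S\<^sup>m\<close> are \<open>sphere 0 1\<close> in Euclidean spaces \<open>'a\<close>, \<open>'b\<close> of dimension \<open>n + 1\<close>,
  \<open>m + 1\<close>, and \<open>S\<^bsup>n+m+1\<^esup>\<close> is \<open>sphere 0 1\<close> in \<open>'a \<times> 'b\<close>.\<close>

definition LO_set ::
  "('a::euclidean_space \<Rightarrow> 'b::euclidean_space) \<Rightarrow> real \<Rightarrow> ('a \<times> 'b) set" where
  "LO_set f \<theta> = (\<lambda>x. (cos \<theta> *\<^sub>R x, sin \<theta> *\<^sub>R f x)) ` sphere 0 1"

definition LO_sphere :: "('a::euclidean_space \<Rightarrow> 'b::euclidean_space) \<Rightarrow> real \<Rightarrow> bool" where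
  "LO_sphere f \<theta> \<longleftrightarrow> minimal_submanifold (DIM('a) - 1) (sphere 0 1) (LO_set f \<theta>)"

definition LOM :: "('a::euclidean_space \<Rightarrow> 'b::euclidean_space) \<Rightarrow> bool" where
  "LOM f \<longleftrightarrow>
     f ` sphere 0 1 \<subseteq> sphere 0 1 \<and> smooth_map_on (sphere 0 1) f \<and>
     (\<exists>\<theta>\<in>{0<..<pi/2}. LO_sphere f \<theta>)"

definition LOMSE :: "('a::euclidean_space \<Rightarrow> 'b::euclidean_space) \<Rightarrow> bool" where
  "LOMSE f \<longleftrightarrow>
     LOM f \<and>
     \<not> totally_geodesic_isometric_embedding (sphere 0 1) (sphere 0 1) f \<and>
     (\<forall>x\<in>sphere 0 1. \<forall>\<sigma> \<tau>.
        singular_value (tangent_space (sphere 0 1) x) (differential (sphere 0 1) f x) \<sigma> \<and> \<sigma> \<noteq> 0 \<and>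
        singular_value (tangent_space (sphere 0 1) x) (differential (sphere 0 1) f x) \<tau> \<and> \<tau> \<noteq> 0
        \<longrightarrow> \<sigma> = \<tau>)"


section \<open>Spherical harmonics\<close>

definition laplacian :: "('a::euclidean_space \<Rightarrow> real) \<Rightarrow> 'a \<Rightarrow> real" where
  "laplacian P x =
     (\<Sum>b\<in>Basis. frechet_derivative (\<lambda>y. frechet_derivative P (at y) b) (at x) b)"

definition homogeneous_harmonic_polynomial :: "nat \<Rightarrow> ('a::euclidean_space \<Rightarrow> real) \<Rightarrow> bool" where
  "homogeneous_harmonic_polynomial k P \<longleftrightarrow>
     real_polynomial_function P \<and> (\<forall>t x. P (t *\<^sub>R x) = t ^ k * P x) \<and> (\<forall>x. laplacian P x = 0)"

definition spherical_harmonic :: "nat \<Rightarrow> ('a::euclidean_space \<Rightarrow> real) \<Rightarrow> bool" where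
  "spherical_harmonic k g \<longleftrightarrow>
     (\<exists>P. homogeneous_harmonic_polynomial k P \<and> (\<forall>x\<in>sphere 0 1. g x = P x))"

end

theory Submission
  imports Defs
begin

text \<open>Let \<open>F\<close> be the 0-homogeneous extension of \<open>f\<close>. Minimality of \<open>M\<^bsub>f,\<theta>\<^esub>\<close> says that the trace of the
  Hessian of \<open>F\<close> with respect to the metric induced by \<open>\<theta>\<close> is a prescribed multiple of \<open>F\<close>. If all
  nonzero singular values agree, pairing this with \<open>F\<close> determines \<open>\<lambda>\<close> from the rank, so the energy
  density takes finitely many values and \<open>\<lambda>\<close>, \<open>p\<close> are constant. Differentiating
  \<open>dF (dF\<^sup>* dF) = \<lambda>\<^sup>2 dF\<close> then shows that the fibres are minimal and that the Hessian of horizontal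
  vectors is normal to the image, hence \<open>f\<close> is an eigenmap with eigenvalue \<open>p \<lambda>\<^sup>2\<close>. With
  \<open>\<alpha> (\<alpha> + n - 1) = p \<lambda>\<^sup>2\<close> the components of \<open>\<bar>x\<bar>\<^sup>\<alpha> F\<close> are harmonic and \<open>\<alpha>\<close>-homogeneous off the
  origin. Differentiating reduces to degree in \<open>[0, 1)\<close>, where the maximum principle applied to
  \<open>\<bar>x\<bar>\<^bsup>2-2\<alpha>\<^esup> \<bar>\<nabla>u\<bar>\<^sup>2\<close> forces the gradient to vanish, and Euler's relation integrates back to a homogeneous
  polynomial. The case \<open>p = n\<close> gives \<open>\<lambda> = 1\<close>, where Bochner's argument makes \<open>f\<close> linear and hence
  totally geodesic; otherwise \<open>p \<lambda>\<^sup>2 > n\<close> and \<open>k \<ge> 2\<close>.\<close>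

section \<open>Calculus of smooth maps\<close>

text \<open>Since radial derivatives of the extension vanish, its flat Hessian at a unit vector,
  taken in tangential directions, is the intrinsic Hessian of the vector-valued \<open>f\<close>;
  charts and covariant derivatives disappear from the computation. The obstacle is that the singular
  value condition is pointwise, and bases adapted to the differential need not vary smoothly. Frames
  are therefore used at a single point only. Everything that is differentiated or needs continuity
  is frame-free: the energy density, and the operator dF^* dF in coordinates. Minimality at one
  angle determines the Hessian traces over horizontal and vertical directions, and their values do
  not involve the angle. Every other angle is then decided by the scalar relation
  \<open>p * lam^2 = n * (cos^2 + sin^2 * lam^2)\<close>, which is linear in the squared cosine;
  solving it gives the arccos formula. The exponent \<alpha> arises as a root of a quadratic, so it
  is a priori only real. That it is an integer is part of the claim, which is why homogeneity is
  treated for real degrees.\<close>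

abbreviation dd :: "'a::euclidean_space \<Rightarrow> ('a \<Rightarrow> 'b::euclidean_space) \<Rightarrow> 'a \<Rightarrow> 'b" where
  "dd v f \<equiv> (\<lambda>x. frechet_derivative f (at x) v)"

lemma dd_eqI: "(f has_derivative f') (at x) \<Longrightarrow> frechet_derivative f (at x) v = f' v"
  using frechet_derivative_at by metis

text \<open>\<open>frechet_derivative\<close> is a choice among the derivatives at the point.
  Functions that agree near the point offer the same candidates, so the chosen maps
  coincide.\<close>

lemma frechet_derivative_cong_open:
  assumes "open U" "x \<in> U" "\<And>y. y \<in> U \<Longrightarrow> f y = g y"
  shows "frechet_derivative f (at x) = frechet_derivative g (at x)"
proof -
  have "(f has_derivative f') (at x) \<longleftrightarrow> (g has_derivative f') (at x)" for f'
    using has_derivative_transform_within_open[OF _ assms(1,2)] assms(3) by metis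
  then show ?thesis by (simp add: frechet_derivative_def)
qed

section \<open>Functions of finite differentiability class\<close>

lemma Ck_on_cong:
  assumes "open U" "\<And>y. y \<in> U \<Longrightarrow> f y = g y" "Ck_on k U f"
  shows "Ck_on k U g"
  using assms(2,3)
proof (induction k arbitrary: f g)
  case 0
  then show ?case using continuous_on_cong by (metis Ck_on.simps(1))
next
  case (Suc k)
  have "g differentiable_on U"
    using Suc.prems by (metis Ck_on.simps(2) differentiable_transform_within differentiable_on_def zero_less_one)
  moreover have "Ck_on k U (dd v g)" for v
  proof (rule Suc.IH[of "dd v f"])
    show "dd v f y = dd v g y" if "y \<in> U" for y
      using frechet_derivative_cong_open[OF assms(1) that, of f g] Suc.prems(1) by metis
  qed (use Suc.prems in auto)
  ultimately show ?case by simp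
qed

lemma Ck_on_mono: "Ck_on (Suc k) U f \<Longrightarrow> Ck_on k U f"
proof (induction k arbitrary: f)
  case 0
  then show ?case by (simp add: differentiable_imp_continuous_on)
qed simp

lemma Ck_on_subset:
  assumes "open U" "open V" "V \<subseteq> U" "Ck_on k U f" shows "Ck_on k V f"
  using assms(4)
proof (induction k arbitrary: f)
  case 0 then show ?case using assms continuous_on_subset by auto
next
  case (Suc k) then show ?case using assms differentiable_on_subset by auto
qed

lemma Ck_on_local:
  assumes "open U" "\<And>x. x \<in> U \<Longrightarrow> \<exists>V. open V \<and> x \<in> V \<and> Ck_on k V f"
  shows "Ck_on k U f"
  using assms(2)
proof (induction k arbitrary: f)
  case 0
  then show ?case
    by (metis Ck_on.simps(1) assms(1) continuous_at_imp_continuous_on continuous_on_eq_continuous_at)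
next
  case (Suc k)
  have "f differentiable (at x)" if "x \<in> U" for x
    using Suc.prems[OF that] by (auto simp: differentiable_on_eq_differentiable_at)
  then have "f differentiable_on U"
    by (simp add: differentiable_at_imp_differentiable_on)
  moreover have "Ck_on k U (dd v f)" for v
    using Suc.prems by (intro Suc.IH) fastforce
  ultimately show ?case by simp
qed

lemma Ck_on_differentiable:
  assumes "open U" "Ck_on (Suc k) U f" "x \<in> U"
  shows "(f has_derivative frechet_derivative f (at x)) (at x)"
  using assms by (metis Ck_on.simps(2) differentiable_on_eq_differentiable_at frechet_derivative_works)

text \<open>Lets the derivative be supplied by a formula, so that the inductions below avoid the
  choice in \<open>frechet_derivative\<close>.\<close>

lemma Ck_on_SucI:
  assumes "open U" "\<And>x. x \<in> U \<Longrightarrow> (f has_derivative f' x) (at x)"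
    "\<And>v. Ck_on k U (\<lambda>x. f' x v)"
  shows "Ck_on (Suc k) U f"
proof -
  have "f differentiable_on U"
    using assms(2) by (meson differentiable_at_imp_differentiable_on differentiableI)
  moreover have "Ck_on k U (dd v f)" for v
    by (rule Ck_on_cong[OF assms(1) _ assms(3)[of v]]) (use dd_eqI[OF assms(2)] in metis)
  ultimately show ?thesis by simp
qed

lemma Ck_on_const: "open U \<Longrightarrow> Ck_on k U (\<lambda>x. c)"
  by (induction k arbitrary: c) (auto intro!: Ck_on_SucI[where f'="\<lambda>_ _. 0"])

lemma Ck_on_linear:
  assumes "bounded_linear L" "open U" shows "Ck_on k U L"
proof (cases k)
  case 0
  then show ?thesis using assms linear_continuous_on by auto
next
  case (Suc j)
  then show ?thesis
    using Ck_on_SucI[OF assms(2) bounded_linear_imp_has_derivative[OF assms(1)] Ck_on_const[OF assms(2)]]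
    by blast
qed

lemma Ck_on_add:
  assumes "open U" "Ck_on k U f" "Ck_on k U g" shows "Ck_on k U (\<lambda>x. f x + g x)"
  using assms(2,3)
proof (induction k arbitrary: f g)
  case 0 then show ?case by (auto intro: continuous_intros)
next
  case (Suc k)
  show ?case
  proof (rule Ck_on_SucI[OF assms(1)])
    fix x assume "x \<in> U"
    show "((\<lambda>x. f x + g x) has_derivative (\<lambda>v. dd v f x + dd v g x)) (at x)"
      by (rule has_derivative_add; rule Ck_on_differentiable[OF assms(1) _ \<open>x \<in> U\<close>]; fact)
  qed (use Suc in auto)
qed

text \<open>Multiplication, scaling and the inner product are all instances. The product rule leaves
  one factor undifferentiated, which is where \<open>Ck_on_mono\<close> enters.\<close>

lemma Ck_on_bilinear:
  assumes bl: "bounded_bilinear pr" and "open U" "Ck_on k U f" "Ck_on k U g"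
  shows "Ck_on k U (\<lambda>x. pr (f x) (g x))"
  using assms(3,4)
proof (induction k arbitrary: f g)
  case 0 then show ?case
    by (auto intro: bounded_bilinear.continuous_on[OF bl])
next
  case (Suc k)
  show ?case
  proof (rule Ck_on_SucI[OF assms(2)])
    fix x assume "x \<in> U"
    show "((\<lambda>x. pr (f x) (g x)) has_derivative (\<lambda>v. pr (f x) (dd v g x) + pr (dd v f x) (g x))) (at x)"
      by (rule bounded_bilinear.FDERIV[OF bl]; rule Ck_on_differentiable[OF assms(2) _ \<open>x \<in> U\<close>]; fact)
  next
    fix v
    show "Ck_on k U (\<lambda>x. pr (f x) (dd v g x) + pr (dd v f x) (g x))"
      using Suc.prems Ck_on_mono[of k U f] Ck_on_mono[of k U g]
      by (intro Ck_on_add[OF assms(2)] Suc.IH) auto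
  qed
qed

lemma Ck_on_sum:
  assumes "open U" "\<And>i. i \<in> I \<Longrightarrow> Ck_on k U (f i)"
  shows "Ck_on k U (\<lambda>x. \<Sum>i\<in>I. f i x)"
  using assms(2)
  by (induction I rule: infinite_finite_induct) (auto intro: Ck_on_add Ck_on_const assms(1))

lemma linear_eq_sum_Basis:
  assumes "linear L" shows "L v = (\<Sum>b\<in>Basis. (v \<bullet> b) *\<^sub>R L b)"
proof -
  have "L v = L (\<Sum>b\<in>Basis. (v \<bullet> b) *\<^sub>R b)" by (simp add: euclidean_representation)
  then show ?thesis using assms by (simp add: linear_sum linear_cmul)
qed

text \<open>The chain rule differentiates \<open>f\<close> in a direction that moves with
  \<open>x\<close>, whereas \<open>Ck_on\<close> speaks of fixed directions. Expanding the moving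
  direction in \<open>Basis\<close> reduces to products of functions already under control.\<close>

lemma Ck_on_compose:
  assumes "open U" "open V" "g ` U \<subseteq> V" "Ck_on k V f" "Ck_on k U g"
  shows "Ck_on k U (\<lambda>x. f (g x))"
  using assms(4,5)
proof (induction k arbitrary: f)
  case 0 then show ?case using assms(3)
    by (auto intro!: continuous_on_compose2[of V f U g])
next
  case (Suc k)
  show ?case
  proof (rule Ck_on_SucI[OF assms(1)])
    fix x assume x: "x \<in> U"
    have gx: "g x \<in> V" using x assms by auto
    have 1: "(f has_derivative frechet_derivative f (at (g x))) (at (g x))"
      by (rule Ck_on_differentiable[OF assms(2) Suc.prems(1) gx])
    have "((\<lambda>x. f (g x)) has_derivative (\<lambda>v. frechet_derivative f (at (g x)) (dd v g x))) (at x)"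
      by (rule has_derivative_compose[OF Ck_on_differentiable[OF assms(1) Suc.prems(2) x] 1])
    also have "(\<lambda>v. frechet_derivative f (at (g x)) (dd v g x))
      = (\<lambda>v. \<Sum>b\<in>Basis. (dd v g x \<bullet> b) *\<^sub>R dd b f (g x))"
      using linear_eq_sum_Basis[OF has_derivative_linear[OF 1]] by blast
    finally show "((\<lambda>x. f (g x)) has_derivative (\<lambda>v. \<Sum>b\<in>Basis. (dd v g x \<bullet> b) *\<^sub>R dd b f (g x))) (at x)" .
  next
    fix v
    have "Ck_on k U (\<lambda>x. dd b f (g x))" for b
      using Suc.prems Ck_on_mono[of k U g] by (intro Suc.IH) auto
    moreover have "Ck_on k U (\<lambda>x. dd v g x \<bullet> b)" for b
      using Suc.prems by (intro Ck_on_bilinear[OF bounded_bilinear_inner assms(1)] Ck_on_const assms) auto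
    ultimately show "Ck_on k U (\<lambda>x. \<Sum>b\<in>Basis. (dd v g x \<bullet> b) *\<^sub>R dd b f (g x))"
      by (intro Ck_on_sum Ck_on_bilinear[OF bounded_bilinear_scaleR] assms)
  qed
qed

lemma Ck_on_powr: "Ck_on k {0<..} (\<lambda>x::real. x powr a)"
proof (induction k arbitrary: a)
  case 0
  then show ?case by (auto intro!: continuous_intros)
next
  case (Suc k)
  show ?case
  proof (rule Ck_on_SucI)
    fix x :: real assume "x \<in> {0<..}"
    then show "((\<lambda>x. x powr a) has_derivative (\<lambda>v. (a * x powr (a - 1)) * v)) (at x)"
      using has_real_derivative_powr[of x a] by (simp add: has_field_derivative_def)
  next
    fix v
    show "Ck_on k {0<..} (\<lambda>x. a * x powr (a - 1) * v)"
      by (intro Ck_on_bilinear[OF bounded_bilinear_mult] Ck_on_const Suc) auto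
  qed simp
qed


section \<open>Closure properties of smooth functions and symmetry of second derivatives\<close>

lemma smooth_on_open_open: "smooth_on_open U f \<Longrightarrow> open U"
  by (simp add: smooth_on_open_def)

lemma smooth_on_has_derivative:
  "smooth_on_open U f \<Longrightarrow> x \<in> U \<Longrightarrow> (f has_derivative frechet_derivative f (at x)) (at x)"
  using Ck_on_differentiable unfolding smooth_on_open_def by blast

lemma smooth_on_linear_dd: "smooth_on_open U f \<Longrightarrow> x \<in> U \<Longrightarrow> linear (frechet_derivative f (at x))"
  using has_derivative_linear smooth_on_has_derivative by blast

lemma smooth_on_dd: "smooth_on_open U f \<Longrightarrow> smooth_on_open U (dd v f)"
  by (simp add: smooth_on_open_def) (metis Ck_on.simps(2))

lemma smooth_on_continuous: "smooth_on_open U f \<Longrightarrow> continuous_on U f"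
  by (metis Ck_on.simps(1) smooth_on_open_def)

lemma smooth_on_subset: "smooth_on_open U f \<Longrightarrow> open V \<Longrightarrow> V \<subseteq> U \<Longrightarrow> smooth_on_open V f"
  using Ck_on_subset unfolding smooth_on_open_def by blast

lemma smooth_on_cong: "smooth_on_open U f \<Longrightarrow> (\<And>x. x \<in> U \<Longrightarrow> f x = g x) \<Longrightarrow> smooth_on_open U g"
  using Ck_on_cong unfolding smooth_on_open_def by blast

lemma smooth_on_local:
  assumes "open U" "\<And>x. x \<in> U \<Longrightarrow> \<exists>V. x \<in> V \<and> smooth_on_open V f"
  shows "smooth_on_open U f"
  using Ck_on_local[OF assms(1)] assms unfolding smooth_on_open_def by meson

lemma smooth_on_const: "open U \<Longrightarrow> smooth_on_open U (\<lambda>x. c)"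
  by (simp add: smooth_on_open_def Ck_on_const)

lemma smooth_on_bounded_linear: "bounded_linear L \<Longrightarrow> open U \<Longrightarrow> smooth_on_open U L"
  by (simp add: smooth_on_open_def Ck_on_linear)

lemma smooth_on_id: "open U \<Longrightarrow> smooth_on_open U (\<lambda>x. x)"
  by (simp add: smooth_on_bounded_linear bounded_linear_ident)

lemma smooth_on_add: "smooth_on_open U f \<Longrightarrow> smooth_on_open U g \<Longrightarrow> smooth_on_open U (\<lambda>x. f x + g x)"
  by (simp add: smooth_on_open_def Ck_on_add)

lemma smooth_on_sum:
  "open U \<Longrightarrow> (\<And>i. i \<in> I \<Longrightarrow> smooth_on_open U (f i)) \<Longrightarrow> smooth_on_open U (\<lambda>x. \<Sum>i\<in>I. f i x)"
  by (simp add: smooth_on_open_def Ck_on_sum)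

lemma smooth_on_bilinear:
  "bounded_bilinear pr \<Longrightarrow> smooth_on_open U f \<Longrightarrow> smooth_on_open U g \<Longrightarrow> smooth_on_open U (\<lambda>x. pr (f x) (g x))"
  by (simp add: smooth_on_open_def Ck_on_bilinear)

lemmas smooth_on_mult = smooth_on_bilinear[OF bounded_bilinear_mult]
lemmas smooth_on_scaleR = smooth_on_bilinear[OF bounded_bilinear_scaleR]
lemmas smooth_on_inner = smooth_on_bilinear[OF bounded_bilinear_inner]

lemma smooth_on_compose:
  "smooth_on_open V f \<Longrightarrow> smooth_on_open U g \<Longrightarrow> g ` U \<subseteq> V \<Longrightarrow> smooth_on_open U (\<lambda>x. f (g x))"
  unfolding smooth_on_open_def using Ck_on_compose by blast

lemma smooth_on_linear_compose:
  "bounded_linear L \<Longrightarrow> smooth_on_open U g \<Longrightarrow> smooth_on_open U (\<lambda>x. L (g x))"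
  using smooth_on_compose[of UNIV L U g] smooth_on_bounded_linear by auto

lemma smooth_on_diff:
  assumes "smooth_on_open U f" "smooth_on_open U g" shows "smooth_on_open U (\<lambda>x. f x - g x)"
  using smooth_on_add[OF assms(1) smooth_on_linear_compose[OF bounded_linear_minus[OF bounded_linear_ident] assms(2)]]
  by simp

lemma smooth_on_Pair:
  assumes "smooth_on_open U f" "smooth_on_open U g" shows "smooth_on_open U (\<lambda>x. (f x, g x))"
proof -
  have "smooth_on_open U (\<lambda>x. (f x, 0) + (0, g x))"
    by (intro smooth_on_add smooth_on_linear_compose[OF _ assms(1)] smooth_on_linear_compose[OF _ assms(2)])
      (auto intro: bounded_linear_Pair bounded_linear_ident bounded_linear_zero)
  then show ?thesis by simp
qed

lemma smooth_on_powr: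
  assumes "smooth_on_open U g" "\<And>x. x \<in> U \<Longrightarrow> g x > (0::real)"
  shows "smooth_on_open U (\<lambda>x. g x powr a)"
proof (rule smooth_on_compose[of "{0<..}" "\<lambda>t. t powr a", OF _ assms(1)])
  show "smooth_on_open {0<..} (\<lambda>t::real. t powr a)"
    using Ck_on_powr by (auto simp: smooth_on_open_def)
qed (use assms(2) in auto)

lemma smooth_on_inverse:
  assumes "smooth_on_open U g" "\<And>x. x \<in> U \<Longrightarrow> g x > (0::real)"
  shows "smooth_on_open U (\<lambda>x. inverse (g x))"
  by (rule smooth_on_cong[OF smooth_on_powr[OF assms, of "-1"]]) (use assms(2) in \<open>auto simp: powr_minus less_imp_le\<close>)

text \<open>Linearity in the inner direction is a statement about functions near \<open>x\<close>:
  \<open>dd (b + c) f\<close> is known to split on \<open>U\<close>, and openness of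
  \<open>U\<close> lets the outer derivative see only that.\<close>

lemma dd_dd_linear_right:
  assumes "smooth_on_open U f" "x \<in> U"
  shows "linear (\<lambda>b. dd a (dd b f) x)"
proof (rule linearI)
  have lin: "linear (frechet_derivative f (at y))" if "y \<in> U" for y
    using assms(1) that by (rule smooth_on_linear_dd)
  have D: "(dd b f has_derivative frechet_derivative (dd b f) (at x)) (at x)" for b
    by (rule smooth_on_has_derivative[OF smooth_on_dd assms(2)]) (rule assms)
  note op = smooth_on_open_open[OF assms(1)]
  show "dd a (dd (b + c) f) x = dd a (dd b f) x + dd a (dd c f) x" for b c
  proof -
    have "frechet_derivative (dd (b + c) f) (at x) = frechet_derivative (\<lambda>y. dd b f y + dd c f y) (at x)"
      by (rule frechet_derivative_cong_open[OF op assms(2)]) (simp add: lin linear_add)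
    then show ?thesis using dd_eqI[OF has_derivative_add[OF D D]] by metis
  qed
  show "dd a (dd (r *\<^sub>R b) f) x = r *\<^sub>R dd a (dd b f) x" for b r
  proof -
    have "frechet_derivative (dd (r *\<^sub>R b) f) (at x) = frechet_derivative (\<lambda>y. r *\<^sub>R dd b f y) (at x)"
      by (rule frechet_derivative_cong_open[OF op assms(2)]) (simp add: lin linear_cmul)
    then show ?thesis using dd_eqI[OF has_derivative_scaleR_right[OF D]] by metis
  qed
qed

lemma dd_dd_linear_left:
  "smooth_on_open U f \<Longrightarrow> x \<in> U \<Longrightarrow> linear (\<lambda>a. dd a (dd b f) x)"
  using smooth_on_linear_dd smooth_on_dd by blast

text \<open>Product rule for a differential whose base point and direction both move. It serves to
  differentiate tangent fields along curves and the identity for dF^* dF.\<close>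

lemma has_derivative_dd_compose:
  assumes f: "smooth_on_open U f" and z: "\<phi> z \<in> U"
    and \<phi>: "(\<phi> has_derivative \<phi>') (at z)" and w: "(w has_derivative w') (at z)"
  shows "((\<lambda>y. dd (w y) f (\<phi> y)) has_derivative
            (\<lambda>h. dd (\<phi>' h) (dd (w z) f) (\<phi> z) + dd (w' h) f (\<phi> z))) (at z)"
proof -
  note op = smooth_on_open_open[OF f]
  have comp: "((\<lambda>y. dd b f (\<phi> y)) has_derivative (\<lambda>h. dd (\<phi>' h) (dd b f) (\<phi> z))) (at z)" for b
    by (rule has_derivative_compose[OF \<phi> smooth_on_has_derivative[OF smooth_on_dd[OF f] z]])
  have D: "((\<lambda>y. \<Sum>b\<in>Basis. (w y \<bullet> b) *\<^sub>R dd b f (\<phi> y)) has_derivative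
      (\<lambda>h. \<Sum>b\<in>Basis. ((w z \<bullet> b) *\<^sub>R dd (\<phi>' h) (dd b f) (\<phi> z) + (w' h \<bullet> b) *\<^sub>R dd b f (\<phi> z)))) (at z)"
    by (intro has_derivative_sum has_derivative_scaleR comp has_derivative_inner_left w)
  have eq: "(\<lambda>h. \<Sum>b\<in>Basis. ((w z \<bullet> b) *\<^sub>R dd (\<phi>' h) (dd b f) (\<phi> z) + (w' h \<bullet> b) *\<^sub>R dd b f (\<phi> z)))
      = (\<lambda>h. dd (\<phi>' h) (dd (w z) f) (\<phi> z) + dd (w' h) f (\<phi> z))"
  proof
    fix h
    show "(\<Sum>b\<in>Basis. ((w z \<bullet> b) *\<^sub>R dd (\<phi>' h) (dd b f) (\<phi> z) + (w' h \<bullet> b) *\<^sub>R dd b f (\<phi> z)))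
      = dd (\<phi>' h) (dd (w z) f) (\<phi> z) + dd (w' h) f (\<phi> z)"
      unfolding sum.distrib
      using linear_eq_sum_Basis[OF smooth_on_linear_dd[OF f z], of "w' h"]
        linear_eq_sum_Basis[OF dd_dd_linear_right[OF f z], of "w z" "\<phi>' h"] by simp
  qed
  have "isCont \<phi> z" using \<phi> has_derivative_continuous by blast
  then obtain S where S: "open S" "z \<in> S" "\<forall>y\<in>S. \<phi> y \<in> U"
    using op z unfolding continuous_at_open by blast
  show ?thesis
  proof (rule has_derivative_transform_within_open[OF D[unfolded eq] S(1,2)])
    show "(\<Sum>b\<in>Basis. (w y \<bullet> b) *\<^sub>R dd b f (\<phi> y)) = dd (w y) f (\<phi> y)" if "y \<in> S" for y
      using linear_eq_sum_Basis[OF smooth_on_linear_dd[OF f], of "\<phi> y" "w y"] S(3) that by simp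
  qed
qed

lemma line_has_derivative: "((\<lambda>t. x + t *\<^sub>R v) has_derivative (\<lambda>t. t *\<^sub>R v)) (at (s::real))"
  by (auto intro!: derivative_eq_intros)

lemma has_real_derivative_along_line:
  fixes g :: "'a::euclidean_space \<Rightarrow> real"
  assumes "smooth_on_open U g" "y + s *\<^sub>R v \<in> U"
  shows "((\<lambda>s. g (y + s *\<^sub>R v)) has_real_derivative dd v g (y + s *\<^sub>R v)) (at s)"
  using has_derivative_compose[OF line_has_derivative smooth_on_has_derivative[OF assms]]
  by (simp add: has_field_derivative_def linear_cmul[OF smooth_on_linear_dd[OF assms]] mult_commute_abs)

text \<open>The mean value theorem is applied along \<open>a\<close> to the increment in direction
  \<open>b\<close>, then along \<open>b\<close>. The second difference is symmetric in
  \<open>a\<close> and \<open>b\<close>, while the mixed derivative it produces is not visibly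
  so.\<close>

lemma second_difference_mean_value:
  fixes f :: "'a::euclidean_space \<Rightarrow> real"
  assumes f: "smooth_on_open U f" and h: "h > 0"
    and box: "\<And>s t. 0 \<le> s \<Longrightarrow> s \<le> h \<Longrightarrow> 0 \<le> t \<Longrightarrow> t \<le> h \<Longrightarrow> x + s *\<^sub>R a + t *\<^sub>R b \<in> U"
  shows "\<exists>s t. 0 < s \<and> s < h \<and> 0 < t \<and> t < h \<and>
    f (x + h *\<^sub>R a + h *\<^sub>R b) - f (x + h *\<^sub>R a) - f (x + h *\<^sub>R b) + f x
      = h * h * dd b (dd a f) (x + s *\<^sub>R a + t *\<^sub>R b)"
proof -
  define \<phi> where "\<phi> s = f ((x + h *\<^sub>R b) + s *\<^sub>R a) - f (x + s *\<^sub>R a)" for s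
  have "\<exists>s. 0 < s \<and> s < h \<and> \<phi> h - \<phi> 0 = (h - 0) * (dd a f ((x + h *\<^sub>R b) + s *\<^sub>R a) - dd a f (x + s *\<^sub>R a))"
    unfolding \<phi>_def
  proof (rule MVT2[OF h])
    fix s assume "0 \<le> s" "s \<le> h"
    then show "((\<lambda>s. f ((x + h *\<^sub>R b) + s *\<^sub>R a) - f (x + s *\<^sub>R a)) has_real_derivative
      dd a f ((x + h *\<^sub>R b) + s *\<^sub>R a) - dd a f (x + s *\<^sub>R a)) (at s)"
      using box[of s h] box[of s 0] h by (intro DERIV_diff has_real_derivative_along_line[OF f]) (auto simp: algebra_simps)
  qed
  then obtain s where s: "0 < s" "s < h"
    "\<phi> h - \<phi> 0 = h * (dd a f ((x + h *\<^sub>R b) + s *\<^sub>R a) - dd a f (x + s *\<^sub>R a))" by auto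
  have "\<exists>t. 0 < t \<and> t < h \<and> dd a f ((x + s *\<^sub>R a) + h *\<^sub>R b) - dd a f ((x + s *\<^sub>R a) + 0 *\<^sub>R b)
      = (h - 0) * dd b (dd a f) ((x + s *\<^sub>R a) + t *\<^sub>R b)"
    by (rule MVT2[OF h]) (use s in \<open>auto intro!: has_real_derivative_along_line[OF smooth_on_dd[OF f]] box\<close>)
  then obtain t where t: "0 < t" "t < h" "dd a f ((x + s *\<^sub>R a) + h *\<^sub>R b) - dd a f (x + s *\<^sub>R a)
      = h * dd b (dd a f) ((x + s *\<^sub>R a) + t *\<^sub>R b)" by auto
  have "f (x + h *\<^sub>R a + h *\<^sub>R b) - f (x + h *\<^sub>R a) - f (x + h *\<^sub>R b) + f x = \<phi> h - \<phi> 0"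
    by (simp add: \<phi>_def algebra_simps)
  also have "\<dots> = h * h * dd b (dd a f) (x + s *\<^sub>R a + t *\<^sub>R b)"
    using s(3) t(3) by (simp add: algebra_simps)
  finally show ?thesis using s t by blast
qed

text \<open>If the mixed derivatives differed at \<open>x\<close>, continuity would keep them apart
  on a small ball; but one and the same second difference computes both of them at points of that
  ball.\<close>

lemma dd_commute_real:
  fixes f :: "'a::euclidean_space \<Rightarrow> real"
  assumes f: "smooth_on_open U f" and x: "x \<in> U"
  shows "dd a (dd b f) x = dd b (dd a f) x"
proof (rule ccontr)
  assume "dd a (dd b f) x \<noteq> dd b (dd a f) x"
  define e where "e = \<bar>dd a (dd b f) x - dd b (dd a f) x\<bar> / 2"
  have e: "e > 0" using \<open>dd a (dd b f) x \<noteq> _\<close> by (simp add: e_def)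
  note op = smooth_on_open_open[OF f]
  have cont: "\<exists>d>0. \<forall>y. dist y x < d \<longrightarrow> y \<in> U \<and> \<bar>dd u (dd v f) y - dd u (dd v f) x\<bar> < e" for u v
  proof -
    have "isCont (dd u (dd v f)) x"
      using smooth_on_continuous[OF smooth_on_dd[OF smooth_on_dd[OF f]]] op x
      by (simp add: continuous_on_eq_continuous_at)
    then obtain d1 where "d1 > 0" "\<forall>y. dist y x < d1 \<longrightarrow> \<bar>dd u (dd v f) y - dd u (dd v f) x\<bar> < e"
      using e by (auto simp: continuous_at_eps_delta dist_real_def)
    moreover obtain d2 where "d2 > 0" "\<forall>y. dist y x < d2 \<longrightarrow> y \<in> U"
      using op x by (metis open_dist)
    ultimately show ?thesis by (intro exI[of _ "min d1 d2"]) auto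
  qed
  obtain d1 where d1: "d1 > 0" "\<forall>y. dist y x < d1 \<longrightarrow> y \<in> U \<and> \<bar>dd a (dd b f) y - dd a (dd b f) x\<bar> < e"
    using cont[where u=a and v=b] by blast
  obtain d2 where d2: "d2 > 0" "\<forall>y. dist y x < d2 \<longrightarrow> y \<in> U \<and> \<bar>dd b (dd a f) y - dd b (dd a f) x\<bar> < e"
    using cont[where u=b and v=a] by blast
  \<comment> \<open>Points of the parallelogram lie within \<open>h * c\<close> of \<open>x\<close>.
    The summand 1 keeps \<open>c\<close> positive for zero vectors, and the factor 2 in
    \<open>h\<close> makes the bound strict.\<close>
  define c where "c = norm a + norm b + 1"
  define h where "h = min d1 d2 / (2 * c)"
  have N: "c > 0" by (simp add: c_def add_nonneg_pos)
  have h: "h > 0" using d1 d2 N by (simp add: h_def)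
  have near: "dist (x + s *\<^sub>R a + t *\<^sub>R b) x < min d1 d2" if "0 \<le> s" "s \<le> h" "0 \<le> t" "t \<le> h" for s t
  proof -
    have "dist (x + s *\<^sub>R a + t *\<^sub>R b) x = norm (s *\<^sub>R a + t *\<^sub>R b)" by (simp add: dist_norm algebra_simps)
    also have "\<dots> \<le> s * norm a + t * norm b" using that norm_triangle_ineq[of "s *\<^sub>R a" "t *\<^sub>R b"] by simp
    also have "\<dots> \<le> h * norm a + h * norm b" using that by (intro add_mono mult_right_mono) auto
    also have "\<dots> \<le> h * c" using h by (simp add: c_def algebra_simps)
    also have "\<dots> = min d1 d2 / 2" using N by (simp add: h_def)
    also have "\<dots> < min d1 d2" using d1(1) d2(1) by linarith
    finally show ?thesis .
  qed
  have box: "x + s *\<^sub>R a + t *\<^sub>R b \<in> U" if "0 \<le> s" "s \<le> h" "0 \<le> t" "t \<le> h" for s t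
    using d1(2)[rule_format, of "x + s *\<^sub>R a + t *\<^sub>R b"] near[OF that] by simp
  obtain s t where st: "0 < s" "s < h" "0 < t" "t < h"
    "f (x + h *\<^sub>R a + h *\<^sub>R b) - f (x + h *\<^sub>R a) - f (x + h *\<^sub>R b) + f x
      = h * h * dd b (dd a f) (x + s *\<^sub>R a + t *\<^sub>R b)"
    using second_difference_mean_value[OF f h box] by blast
  have nearswap: "dist (x + s *\<^sub>R b + t *\<^sub>R a) x < min d1 d2" if "0 \<le> s" "s \<le> h" "0 \<le> t" "t \<le> h" for s t
    using near[of t s] that by (simp add: algebra_simps)
  have boxswap: "x + s *\<^sub>R b + t *\<^sub>R a \<in> U" if "0 \<le> s" "s \<le> h" "0 \<le> t" "t \<le> h" for s t
    using d1(2)[rule_format, of "x + s *\<^sub>R b + t *\<^sub>R a"] nearswap[OF that] by simp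
  obtain s' t' where st': "0 < s'" "s' < h" "0 < t'" "t' < h"
    "f (x + h *\<^sub>R b + h *\<^sub>R a) - f (x + h *\<^sub>R b) - f (x + h *\<^sub>R a) + f x
      = h * h * dd a (dd b f) (x + s' *\<^sub>R b + t' *\<^sub>R a)"
    using second_difference_mean_value[OF f h boxswap] by blast
  have "f (x + h *\<^sub>R a + h *\<^sub>R b) - f (x + h *\<^sub>R a) - f (x + h *\<^sub>R b) + f x
     = f (x + h *\<^sub>R b + h *\<^sub>R a) - f (x + h *\<^sub>R b) - f (x + h *\<^sub>R a) + f x"
    by (simp add: add.assoc add.commute[of "h *\<^sub>R a"])
  then have "h * h * dd b (dd a f) (x + s *\<^sub>R a + t *\<^sub>R b) = h * h * dd a (dd b f) (x + s' *\<^sub>R b + t' *\<^sub>R a)"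
    using st(5) st'(5) by linarith
  then have "dd b (dd a f) (x + s *\<^sub>R a + t *\<^sub>R b) = dd a (dd b f) (x + s' *\<^sub>R b + t' *\<^sub>R a)"
    using h by simp
  moreover have "\<bar>dd b (dd a f) (x + s *\<^sub>R a + t *\<^sub>R b) - dd b (dd a f) x\<bar> < e"
    using d2(2)[rule_format, of "x + s *\<^sub>R a + t *\<^sub>R b"] near[of s t] st by simp
  moreover have "\<bar>dd a (dd b f) (x + s' *\<^sub>R b + t' *\<^sub>R a) - dd a (dd b f) x\<bar> < e"
    using d1(2)[rule_format, of "x + s' *\<^sub>R b + t' *\<^sub>R a"] nearswap[of s' t'] st' by simp
  ultimately show False by (simp add: e_def abs_if split: if_splits)
qed

lemma dd_inner_right:
  assumes "smooth_on_open U f" "x \<in> U"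
  shows "dd v (\<lambda>y. f y \<bullet> c) x = dd v f x \<bullet> c"
  using dd_eqI[OF has_derivative_inner_left[OF smooth_on_has_derivative[OF assms]]] .

lemma dd_dd_inner_right:
  assumes f: "smooth_on_open U f" and x: "x \<in> U"
  shows "dd u (dd v (\<lambda>y. f y \<bullet> c)) x = dd u (dd v f) x \<bullet> c"
proof -
  have "frechet_derivative (dd v (\<lambda>y. f y \<bullet> c)) (at x) = frechet_derivative (\<lambda>y. dd v f y \<bullet> c) (at x)"
    using dd_inner_right[OF f]
    by (intro frechet_derivative_cong_open[OF smooth_on_open_open[OF f] x]) simp
  then show ?thesis
    using dd_inner_right[OF smooth_on_dd[OF f] x] by simp
qed

lemma dd_commute:
  assumes f: "smooth_on_open U f" and x: "x \<in> U"
  shows "dd a (dd b f) x = dd b (dd a f) x"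
proof (rule euclidean_eqI)
  fix c :: 'b
  have "smooth_on_open U (\<lambda>y. f y \<bullet> c)"
    by (intro smooth_on_inner f smooth_on_const smooth_on_open_open[OF f])
  from dd_commute_real[OF this x, of a b] show "dd a (dd b f) x \<bullet> c = dd b (dd a f) x \<bullet> c"
    by (simp only: dd_dd_inner_right[OF f x])
qed

lemma smooth_on_dd_compose:
  assumes f: "smooth_on_open V f" and w: "smooth_on_open U w" and \<phi>: "smooth_on_open U \<phi>"
    and sub: "\<phi> ` U \<subseteq> V"
  shows "smooth_on_open U (\<lambda>y. dd (w y) f (\<phi> y))"
proof (rule smooth_on_cong)
  show "smooth_on_open U (\<lambda>y. \<Sum>b\<in>Basis. (w y \<bullet> b) *\<^sub>R dd b f (\<phi> y))"
  proof (intro smooth_on_sum smooth_on_scaleR smooth_on_inner w smooth_on_const)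
    show "smooth_on_open U (\<lambda>y. dd b f (\<phi> y))" for b
      by (rule smooth_on_compose[OF smooth_on_dd[OF f] \<phi> sub])
  qed (rule smooth_on_open_open[OF w])+
  show "(\<Sum>b\<in>Basis. (w y \<bullet> b) *\<^sub>R dd b f (\<phi> y)) = dd (w y) f (\<phi> y)" if "y \<in> U" for y
    using linear_eq_sum_Basis[OF smooth_on_linear_dd[OF f], of "\<phi> y" "w y"] that sub by auto
qed

section \<open>Powers of the norm, radial projection and homogeneous functions\<close>

lemma open_nonzero: "open (- {0 :: 'a::euclidean_space})"
  by auto

text \<open>Trades the norm for the polynomial \<open>x \<bullet> x\<close>, whose smoothness is
  immediate.\<close>

lemma norm_powr_eq: "norm (x::'a::euclidean_space) powr \<beta> = (x \<bullet> x) powr (\<beta>/2)"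
proof (cases "x = 0")
  case False
  have "norm x = (x \<bullet> x) powr (1/2)"
    by (simp add: norm_eq_sqrt_inner powr_half_sqrt)
  then show ?thesis by (simp add: powr_powr)
qed auto

lemma smooth_on_norm_powr: "smooth_on_open (- {0}) (\<lambda>x::'a::euclidean_space. norm x powr \<beta>)"
  unfolding norm_powr_eq
  by (intro smooth_on_powr smooth_on_inner smooth_on_id open_nonzero) auto

lemma has_derivative_norm_powr:
  fixes x :: "'a::euclidean_space"
  assumes "x \<noteq> 0"
  shows "((\<lambda>x. norm x powr \<beta>) has_derivative (\<lambda>h. \<beta> * norm x powr (\<beta> - 2) * (x \<bullet> h))) (at x)"
proof -
  have 1: "((\<lambda>x::'a. x \<bullet> x) has_derivative (\<lambda>h. x \<bullet> h + h \<bullet> x)) (at x)"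
    by (auto intro!: derivative_eq_intros)
  have "((\<lambda>t. t powr (\<beta>/2)) has_derivative (*) (\<beta>/2 * (x \<bullet> x) powr (\<beta>/2 - 1))) (at (x \<bullet> x))"
    using has_real_derivative_powr[of "x \<bullet> x" "\<beta>/2"] assms by (simp add: has_field_derivative_def)
  from has_derivative_compose[OF 1 this]
  have "((\<lambda>x::'a. (x \<bullet> x) powr (\<beta>/2)) has_derivative (\<lambda>h. \<beta>/2 * (x \<bullet> x) powr (\<beta>/2 - 1) * (x \<bullet> h + h \<bullet> x))) (at x)" .
  moreover have "norm x powr (\<beta> - 2) = (x \<bullet> x) powr (\<beta>/2 - 1)"
    by (simp add: norm_powr_eq diff_divide_distrib)
  ultimately show ?thesis by (simp add: norm_powr_eq inner_commute mult.assoc)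
qed

lemma dd_norm_powr:
  "(x::'a::euclidean_space) \<noteq> 0 \<Longrightarrow> dd h (\<lambda>x. norm x powr \<beta>) x = \<beta> * norm x powr (\<beta> - 2) * (x \<bullet> h)"
  using dd_eqI[OF has_derivative_norm_powr] .

lemma sgn_eq_powr: "sgn x = norm x powr - 1 *\<^sub>R (x::'a::euclidean_space)"
  by (cases "x = 0") (auto simp: sgn_div_norm powr_minus)

lemma smooth_on_sgn: "smooth_on_open (- {0}) (sgn :: 'a::euclidean_space \<Rightarrow> 'a)"
proof (rule smooth_on_cong)
  show "smooth_on_open (- {0}) (\<lambda>x::'a. norm x powr - 1 *\<^sub>R x)"
    by (intro smooth_on_scaleR smooth_on_norm_powr smooth_on_id open_nonzero)
qed (simp add: sgn_eq_powr)

lemma dd_sgn: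
  assumes "(x::'a::euclidean_space) \<noteq> 0"
  shows "dd h sgn x = norm x powr - 1 *\<^sub>R h - (norm x powr - 3 * (x \<bullet> h)) *\<^sub>R x"
proof -
  have "((\<lambda>x::'a. norm x powr - 1 *\<^sub>R x) has_derivative
     (\<lambda>h. norm x powr - 1 *\<^sub>R h + (- 1 * norm x powr (- 1 - 2) * (x \<bullet> h)) *\<^sub>R x)) (at x)"
    by (intro has_derivative_scaleR has_derivative_norm_powr assms has_derivative_ident)
  then show ?thesis unfolding sgn_eq_powr[abs_def]
    using dd_eqI by fastforce
qed

lemma dd_sgn_unit: "norm (x::'a::euclidean_space) = 1 \<Longrightarrow> dd h sgn x = h - (x \<bullet> h) *\<^sub>R x"
  using dd_sgn[of x h] by (cases "x = 0") auto

text \<open>This is the second fundamental form of the unit sphere in flat space; for tangential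
  directions only the radial term survives.\<close>

lemma dd_dd_sgn_unit:
  assumes "norm (x::'a::euclidean_space) = 1" "x \<bullet> a = 0" "x \<bullet> b = 0"
  shows "dd a (dd b sgn) x = - (a \<bullet> b) *\<^sub>R x"
proof -
  have x: "x \<noteq> 0" using assms by auto
  have "frechet_derivative (dd b sgn) (at x)
    = frechet_derivative (\<lambda>x. norm x powr - 1 *\<^sub>R b - (norm x powr - 3 * (x \<bullet> b)) *\<^sub>R x) (at x)"
    by (rule frechet_derivative_cong_open[OF open_nonzero]) (use x dd_sgn in auto)
  moreover have "((\<lambda>x. norm x powr - 1 *\<^sub>R b - (norm x powr - 3 * (x \<bullet> b)) *\<^sub>R x) has_derivative
     (\<lambda>h. (- 1 * norm x powr (- 1 - 2) * (x \<bullet> h)) *\<^sub>R b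
        - ((norm x powr - 3 * (x \<bullet> b)) *\<^sub>R h + (norm x powr - 3 * (h \<bullet> b)
            + (- 3 * norm x powr (- 3 - 2) * (x \<bullet> h)) * (x \<bullet> b)) *\<^sub>R x))) (at x)"
    by (intro has_derivative_diff has_derivative_scaleR has_derivative_scaleR_left has_derivative_mult has_derivative_inner_left
        has_derivative_norm_powr x has_derivative_ident)
  ultimately show ?thesis using dd_eqI assms by fastforce
qed

text \<open>The degree is real and the origin is excluded: the functions in question are extended
  from the sphere along rays, possibly singular at 0, and their degree is recognised as an integer
  only at the end.\<close>

definition homog :: "real \<Rightarrow> ('a::euclidean_space \<Rightarrow> 'b::euclidean_space) \<Rightarrow> bool" where
  "homog \<beta> F \<longleftrightarrow> (\<forall>t>0. \<forall>x. x \<noteq> 0 \<longrightarrow> F (t *\<^sub>R x) = t powr \<beta> *\<^sub>R F x)"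

lemma homogD: "homog \<beta> F \<Longrightarrow> t > 0 \<Longrightarrow> x \<noteq> 0 \<Longrightarrow> F (t *\<^sub>R x) = t powr \<beta> *\<^sub>R F x"
  by (simp add: homog_def)

lemma homog_sgn:
  assumes "homog \<beta> F" "x \<noteq> 0" shows "F x = norm x powr \<beta> *\<^sub>R F (sgn x)"
proof -
  have "x = norm x *\<^sub>R sgn x" using assms by (simp add: sgn_div_norm)
  then have "F x = F (norm x *\<^sub>R sgn x)" by simp
  also have "\<dots> = norm x powr \<beta> *\<^sub>R F (sgn x)"
    using assms by (intro homogD) (auto simp: sgn_zero_iff)
  finally show ?thesis .
qed

text \<open>Differentiating \<open>F (t *\<^sub>R x)\<close> in \<open>x\<close> once by the chain
  rule and once by homogeneity produces a factor \<open>t\<close> on one side only.\<close>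

lemma homog_dd:
  assumes F: "smooth_on_open (- {0}) F" and h: "homog \<beta> F"
  shows "homog (\<beta> - 1) (dd v F)"
  unfolding homog_def
proof (intro allI impI)
  fix t :: real and x :: 'a assume t: "t > 0" and x: "x \<noteq> 0"
  have tx: "t *\<^sub>R x \<in> - {0}" and x': "x \<in> - {0}" using t x by auto
  have "((\<lambda>y. t *\<^sub>R y) has_derivative (\<lambda>y. t *\<^sub>R y)) (at x)" by (auto intro!: derivative_eq_intros)
  from has_derivative_compose[OF this smooth_on_has_derivative[OF F tx]]
  have 1: "((\<lambda>y. F (t *\<^sub>R y)) has_derivative (\<lambda>h. dd (t *\<^sub>R h) F (t *\<^sub>R x))) (at x)" .
  have 2: "((\<lambda>y. F (t *\<^sub>R y)) has_derivative (\<lambda>h. t powr \<beta> *\<^sub>R dd h F x)) (at x)"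
    using has_derivative_scaleR_right[OF smooth_on_has_derivative[OF F x'], of "t powr \<beta>"]
    by (rule has_derivative_transform_within_open[OF _ open_nonzero x']) (use homogD[OF h t] in auto)
  have "dd (t *\<^sub>R v) F (t *\<^sub>R x) = t powr \<beta> *\<^sub>R dd v F x"
    using has_derivative_unique[OF 1 2] by meson
  then have "t *\<^sub>R dd v F (t *\<^sub>R x) = t powr \<beta> *\<^sub>R dd v F x"
    by (simp add: linear_cmul[OF smooth_on_linear_dd[OF F tx]])
  then have "dd v F (t *\<^sub>R x) = (t powr \<beta> / t) *\<^sub>R dd v F x"
    using t by (metis divideR_right divide_inverse_commute less_irrefl scaleR_scaleR)
  then show "dd v F (t *\<^sub>R x) = t powr (\<beta> - 1) *\<^sub>R dd v F x"
    using t by (simp add: powr_diff divide_inverse)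
qed

text \<open>Euler's relation: the two descriptions of \<open>F\<close> along the ray through
  \<open>x\<close> are differentiated at parameter 1.\<close>

lemma homog_euler:
  assumes F: "smooth_on_open (- {0}) F" and h: "homog \<beta> F" and x: "x \<noteq> 0"
  shows "dd x F x = \<beta> *\<^sub>R F x"
proof -
  have x': "1 *\<^sub>R x \<in> - {0}" using x by auto
  have "((\<lambda>s. s *\<^sub>R x) has_derivative (\<lambda>s. s *\<^sub>R x)) (at (1::real))" by (auto intro!: derivative_eq_intros)
  from has_derivative_compose[OF this smooth_on_has_derivative[OF F x']]
  have 1: "((\<lambda>s. F (s *\<^sub>R x)) has_derivative (\<lambda>s. dd (s *\<^sub>R x) F x)) (at 1)" by simp
  have "((\<lambda>s::real. s powr \<beta>) has_derivative (*) \<beta>) (at 1)"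
    using has_real_derivative_powr[of 1 \<beta>] by (simp add: has_field_derivative_def)
  then have "((\<lambda>s. s powr \<beta> *\<^sub>R F x) has_derivative (\<lambda>s. (\<beta> * s) *\<^sub>R F x)) (at 1)"
    by (rule has_derivative_scaleR_left)
  then have 2: "((\<lambda>s. F (s *\<^sub>R x)) has_derivative (\<lambda>s. (\<beta> * s) *\<^sub>R F x)) (at 1)"
    by (rule has_derivative_transform_within_open[of _ _ _ _ "{0<..}"]) (use homogD[OF h] x in auto)
  show ?thesis using fun_cong[OF has_derivative_unique[OF 1 2], of 1] by simp
qed

section \<open>Orthogonal projections, orthonormal bases and traces\<close>

lemma orth_proj_facts:
  fixes V :: "'a::euclidean_space set"
  assumes V: "subspace V"
  shows orth_proj_mem: "orth_proj V x \<in> V"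
    and orth_proj_orthogonal: "z \<in> V \<Longrightarrow> (x - orth_proj V x) \<bullet> z = 0"
    and orth_proj_eqI: "y \<in> V \<Longrightarrow> (\<And>z. z \<in> V \<Longrightarrow> (x - y) \<bullet> z = 0) \<Longrightarrow> orth_proj V x = y"
proof -
  \<comment> \<open>Two candidates differ by a vector of \<open>V\<close> that is orthogonal to
    itself, so the description in \<open>orth_proj\<close> is proper.\<close>
  have uniq: "y = y'" if "y \<in> V" "\<forall>z\<in>V. orthogonal (x - y) z" "y' \<in> V" "\<forall>z\<in>V. orthogonal (x - y') z" for y y'
  proof -
    have "y - y' \<in> V" using that V by (simp add: subspace_diff)
    then have "(x - y) \<bullet> (y - y') = 0" "(x - y') \<bullet> (y - y') = 0"
      using that by (auto simp: orthogonal_def)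
    then have "(y - y') \<bullet> (y - y') = 0" by (simp add: inner_diff_left)
    then show ?thesis by simp
  qed
  obtain y0 z0 where "y0 \<in> span V" "\<And>w. w \<in> span V \<Longrightarrow> orthogonal z0 w" "x = y0 + z0"
    using orthogonal_subspace_decomp_exists[of V x] by metis
  moreover have "span V = V" using V span_eq_iff by blast
  ultimately have ex: "y0 \<in> V \<and> (\<forall>z\<in>V. orthogonal (x - y0) z)" by simp
  have eq: "orth_proj V x = y'" if "y' \<in> V" "\<forall>z\<in>V. orthogonal (x - y') z" for y'
    unfolding orth_proj_def using that uniq by (intro the_equality) auto
  show "orth_proj V x \<in> V" using eq ex by metis
  show "(x - orth_proj V x) \<bullet> z = 0" if "z \<in> V" using eq ex that by (metis orthogonal_def)
  show "y \<in> V \<Longrightarrow> (\<And>z. z \<in> V \<Longrightarrow> (x - y) \<bullet> z = 0) \<Longrightarrow> orth_proj V x = y"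
    by (rule eq) (auto simp: orthogonal_def)
qed

lemma linear_orth_proj:
  assumes V: "subspace V" shows "linear (orth_proj V)"
proof (rule linearI)
  show "orth_proj V (x + y) = orth_proj V x + orth_proj V y" for x y
  proof (rule orth_proj_eqI[OF V])
    show "orth_proj V x + orth_proj V y \<in> V"
      using V orth_proj_mem[OF V] by (simp add: subspace_add)
    show "(x + y - (orth_proj V x + orth_proj V y)) \<bullet> z = 0" if "z \<in> V" for z
      using orth_proj_orthogonal[OF V that, of x] orth_proj_orthogonal[OF V that, of y]
      by (simp add: inner_diff_left inner_add_left)
  qed
  show "orth_proj V (r *\<^sub>R x) = r *\<^sub>R orth_proj V x" for r x
  proof (rule orth_proj_eqI[OF V])
    show "r *\<^sub>R orth_proj V x \<in> V"
      using V orth_proj_mem[OF V] by (simp add: subspace_scale)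
    show "(r *\<^sub>R x - r *\<^sub>R orth_proj V x) \<bullet> z = 0" if "z \<in> V" for z
      using orth_proj_orthogonal[OF V that, of x] by (simp flip: scaleR_diff_right)
  qed
qed

lemma orth_proj_eq_0_iff:
  assumes V: "subspace V" shows "orth_proj V x = 0 \<longleftrightarrow> (\<forall>z\<in>V. x \<bullet> z = 0)"
proof
  show "\<forall>z\<in>V. x \<bullet> z = 0" if "orth_proj V x = 0"
    using orth_proj_orthogonal[OF V, of _ x] that by simp
  show "orth_proj V x = 0" if "\<forall>z\<in>V. x \<bullet> z = 0"
    using orth_proj_eqI[OF V, of 0 x] subspace_0[OF V] that by simp
qed

lemma orthonormal_basis_of_finite_card:
  fixes V :: "'a::euclidean_space set"
  assumes "orthonormal_basis_of V E" shows "finite E" "card E = dim V"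
proof -
  have "pairwise orthogonal E" "0 \<notin> E" "span E = V" using assms by (auto simp: orthonormal_basis_of_def)
  then show "finite E" "card E = dim V"
    using pairwise_orthogonal_imp_finite pairwise_orthogonal_independent[of E] dim_eq_card_independent[of E]
      dim_span[of E] by auto
qed

lemma orthonormal_basis_of_inner:
  "orthonormal_basis_of V E \<Longrightarrow> e \<in> E \<Longrightarrow> e' \<in> E \<Longrightarrow> e \<bullet> e' = (if e = e' then 1 else 0)"
  by (auto simp: orthonormal_basis_of_def pairwise_def orthogonal_def norm_eq_1)

lemma orthonormal_basis_of_expand:
  fixes V :: "'a::euclidean_space set"
  assumes "orthonormal_basis_of V E" "v \<in> V" shows "(\<Sum>e\<in>E. (v \<bullet> e) *\<^sub>R e) = v"
  using assms orthonormal_basis_of_finite_card(1)[OF assms(1)] unfolding orthonormal_basis_of_def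
  by (intro orthonormal_basis_expand) auto

text \<open>Used in two ways: it frees the mean curvature vector from the basis picked by
  \<open>SOME\<close>, and it turns sums over \<open>Basis\<close>, such as Laplacian and energy,
  into sums over a frame. The proof expands in \<open>E'\<close> and applies Parseval's identity
  with respect to \<open>E\<close>.\<close>

lemma trace_orthonormal_basis_eq:
  fixes B :: "'a::euclidean_space \<Rightarrow> 'a \<Rightarrow> 'b::euclidean_space"
  assumes l: "\<And>v. linear (\<lambda>u. B u v)" and r: "\<And>u. linear (B u)"
    and E: "orthonormal_basis_of V E" and E': "orthonormal_basis_of V E'"
  shows "(\<Sum>e\<in>E. B e e) = (\<Sum>e\<in>E'. B e e)"
proof -
  have V: "e \<in> V" if "e \<in> E" for e using that E by (auto simp: orthonormal_basis_of_def)
  have V': "e \<in> V" if "e \<in> E'" for e using that E' by (auto simp: orthonormal_basis_of_def)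
  have "(\<Sum>e\<in>E. B e e) = (\<Sum>e\<in>E. \<Sum>i\<in>E'. \<Sum>j\<in>E'. ((e \<bullet> i) * (e \<bullet> j)) *\<^sub>R B i j)"
  proof (rule sum.cong[OF refl])
    fix e assume e: "e \<in> E"
    have "B e e = B (\<Sum>i\<in>E'. (e \<bullet> i) *\<^sub>R i) (\<Sum>j\<in>E'. (e \<bullet> j) *\<^sub>R j)"
      using orthonormal_basis_of_expand[OF E' V[OF e]] by simp
    also have "\<dots> = (\<Sum>i\<in>E'. (e \<bullet> i) *\<^sub>R B i (\<Sum>j\<in>E'. (e \<bullet> j) *\<^sub>R j))"
      by (simp add: linear_sum[OF l] linear_cmul[OF l])
    also have "\<dots> = (\<Sum>i\<in>E'. \<Sum>j\<in>E'. ((e \<bullet> i) * (e \<bullet> j)) *\<^sub>R B i j)"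
      by (simp add: linear_sum[OF r] linear_cmul[OF r] scaleR_sum_right)
    finally show "B e e = (\<Sum>i\<in>E'. \<Sum>j\<in>E'. ((e \<bullet> i) * (e \<bullet> j)) *\<^sub>R B i j)" .
  qed
  also have "\<dots> = (\<Sum>i\<in>E'. \<Sum>j\<in>E'. (\<Sum>e\<in>E. (e \<bullet> i) * (e \<bullet> j)) *\<^sub>R B i j)"
    by (subst sum.swap, rule sum.cong[OF refl], subst sum.swap) (simp add: scaleR_sum_left)
  also have "\<dots> = (\<Sum>i\<in>E'. \<Sum>j\<in>E'. (i \<bullet> j) *\<^sub>R B i j)"
  proof (intro sum.cong refl)
    fix i j assume ij: "i \<in> E'" "j \<in> E'"
    have "i \<bullet> j = (\<Sum>e\<in>E. (i \<bullet> e) *\<^sub>R e) \<bullet> j" using orthonormal_basis_of_expand[OF E V'[OF ij(1)]] by simp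
    also have "\<dots> = (\<Sum>e\<in>E. (e \<bullet> i) * (e \<bullet> j))" by (simp add: inner_sum_left inner_commute[of i])
    finally show "(\<Sum>e\<in>E. (e \<bullet> i) * (e \<bullet> j)) *\<^sub>R B i j = (i \<bullet> j) *\<^sub>R B i j" by simp
  qed
  also have "\<dots> = (\<Sum>i\<in>E'. \<Sum>j\<in>E'. if i = j then B i j else 0)"
    by (intro sum.cong refl) (simp add: orthonormal_basis_of_inner[OF E'])
  also have "\<dots> = (\<Sum>e\<in>E'. B e e)"
    by (simp add: orthonormal_basis_of_finite_card[OF E'] sum.delta)
  finally show ?thesis .
qed

section \<open>Embedded spheres\<close>

lemma smooth_map_onI:
  "smooth_on_open U F \<Longrightarrow> X \<subseteq> U \<Longrightarrow> (\<And>x. x \<in> X \<Longrightarrow> F x = f x) \<Longrightarrow> smooth_map_on X f"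
  unfolding smooth_map_on_def by blast

text \<open>The derivative of a local smooth extension, restricted to \<open>M\<close>, shows that
  the choice in \<open>differential\<close> has a candidate.\<close>

lemma smooth_map_on_has_derivative:
  assumes "smooth_map_on M Y" "p \<in> M"
  shows "(Y has_derivative differential M Y p) (at p within M)"
proof -
  obtain U F where U: "p \<in> U" "smooth_on_open U F" "\<forall>y\<in>M \<inter> U. F y = Y y"
    using assms unfolding smooth_map_on_def by blast
  have "(F has_derivative frechet_derivative F (at p)) (at p within M)"
    using smooth_on_has_derivative[OF U(2,1)] has_derivative_at_withinI by blast
  moreover obtain d where "d > 0" "ball p d \<subseteq> U"
    using smooth_on_open_open[OF U(2)] U(1) open_contains_ball by blast
  ultimately have "(Y has_derivative frechet_derivative F (at p)) (at p within M)"
    using U(3) assms(2)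
    by (intro has_derivative_transform_within[of F _ p M d Y]) (auto simp: subset_iff dist_commute)
  then show ?thesis
    unfolding differential_def using frechet_derivative_works differentiable_def by blast
qed

text \<open>\<open>\<Phi>\<close> parametrises the image of the unit sphere and is constant along
  rays. The linear \<open>R\<close> undoes it up to normalisation; being globally defined and
  smooth, it replaces the inverse function theorem wherever a chart or an extension off
  \<open>M\<close> is required.\<close>

locale sphere_embedding =
  fixes \<Phi> :: "'a::euclidean_space \<Rightarrow> 'c::euclidean_space" and R :: "'c \<Rightarrow> 'a"
  assumes smooth: "smooth_on_open (- {0}) \<Phi>"
    and hom: "homog 0 \<Phi>"
    and R: "bounded_linear R"
    and R_\<Phi>: "x \<noteq> 0 \<Longrightarrow> R (\<Phi> x) = sgn x"
begin

definition "M = \<Phi> ` sphere 0 1"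

lemma \<Phi>_sgn: "x \<noteq> 0 \<Longrightarrow> \<Phi> (sgn x) = \<Phi> x"
  using homog_sgn[OF hom, of x] by simp

lemma \<Phi>_mem: "x \<noteq> 0 \<Longrightarrow> \<Phi> x \<in> M"
  using \<Phi>_sgn[of x] unfolding M_def by (metis image_eqI mem_sphere_0 norm_sgn)

lemma R_\<Phi>_unit: "norm x = 1 \<Longrightarrow> R (\<Phi> x) = x"
  using R_\<Phi>[of x] by (cases "x = 0") (auto simp: sgn_div_norm)

lemma R_mem: "q \<in> M \<Longrightarrow> norm (R q) = 1 \<and> \<Phi> (R q) = q"
  unfolding M_def using R_\<Phi>_unit by auto

lemma \<Phi>_deriv: "x \<noteq> 0 \<Longrightarrow> (\<Phi> has_derivative frechet_derivative \<Phi> (at x)) (at x)"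
  using smooth_on_has_derivative[OF smooth] by simp

lemma linear_d\<Phi>: "x \<noteq> 0 \<Longrightarrow> linear (frechet_derivative \<Phi> (at x))"
  using smooth_on_linear_dd[OF smooth] by simp

lemma d\<Phi>_radial: "x \<noteq> 0 \<Longrightarrow> dd x \<Phi> x = 0"
  using homog_euler[OF smooth hom] by simp

lemma d\<Phi>_tangential: "norm x = 1 \<Longrightarrow> dd c \<Phi> x = dd (c - (x \<bullet> c) *\<^sub>R x) \<Phi> x"
  using linear_d\<Phi>[of x] d\<Phi>_radial[of x] by (cases "x = 0") (auto simp: linear_diff linear_cmul)

text \<open>Differentiates \<open>R (\<Phi> x) = sgn x\<close>. In particular the differential of
  \<open>\<Phi>\<close> is injective on tangent vectors, with inverse \<open>R\<close>.\<close>

lemma R_d\<Phi>: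
  assumes "norm x = 1" "x \<bullet> a = 0" shows "R (dd a \<Phi> x) = a"
proof -
  have x: "x \<noteq> 0" using assms by auto
  have "((\<lambda>x. R (\<Phi> x)) has_derivative (\<lambda>h. R (dd h \<Phi> x))) (at x)"
    by (rule bounded_linear.has_derivative[OF R \<Phi>_deriv[OF x]])
  then have "(sgn has_derivative (\<lambda>h. R (dd h \<Phi> x))) (at x)"
    by (rule has_derivative_transform_within_open[OF _ open_nonzero]) (use x R_\<Phi> in auto)
  from dd_eqI[OF this, of a] show ?thesis using dd_sgn_unit[OF assms(1), of a] assms by simp
qed

text \<open>A tangent line misses the origin. As \<open>\<Phi>\<close> ignores the radius, such
  lines can stand in for great circles.\<close>

lemma line_nonzero: "norm x = 1 \<Longrightarrow> x \<bullet> a = 0 \<Longrightarrow> x + t *\<^sub>R a \<noteq> 0"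
proof
  assume "norm x = 1" "x \<bullet> a = 0" "x + t *\<^sub>R a = 0"
  have "x \<bullet> (x + t *\<^sub>R a) = x \<bullet> x + t * (x \<bullet> a)" by (simp add: inner_add_right)
  then show False
    using \<open>norm x = 1\<close> \<open>x \<bullet> a = 0\<close> \<open>x + t *\<^sub>R a = 0\<close> by (simp add: norm_eq_1)
qed

lemma curve_deriv:
  assumes "norm x = 1" "x \<bullet> a = 0"
  shows "((\<lambda>t. \<Phi> (x + t *\<^sub>R a)) has_derivative (\<lambda>t. t *\<^sub>R dd a \<Phi> x)) (at (0::real))"
proof -
  have x: "x + 0 *\<^sub>R a \<noteq> 0" using assms by auto
  show ?thesis using has_derivative_compose[OF line_has_derivative \<Phi>_deriv[OF x]] x
    by (simp add: linear_cmul[OF linear_d\<Phi>])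
qed

text \<open>Tangent lines supply enough curves. Conversely \<open>R\<close> maps a curve in
  \<open>M\<close> to a curve on the unit sphere, whose velocity is orthogonal to \<open>x\<close>
  and is carried back by the differential of \<open>\<Phi>\<close>.\<close>

lemma tangent_space_M:
  assumes x: "norm x = 1"
  shows "tangent_space M (\<Phi> x) = {dd a \<Phi> x |a. x \<bullet> a = 0}"
proof (intro set_eqI iffI)
  fix v assume "v \<in> {dd a \<Phi> x |a. x \<bullet> a = 0}"
  then obtain a where a: "v = dd a \<Phi> x" "x \<bullet> a = 0" by auto
  have "smooth_on_open {-1<..<1} (\<lambda>t. \<Phi> (x + t *\<^sub>R a))"
    by (rule smooth_on_compose[OF smooth])
      (use line_nonzero[OF x a(2)] in \<open>auto intro!: smooth_on_add smooth_on_scaleR smooth_on_id smooth_on_const\<close>)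
  moreover have "(\<lambda>t. \<Phi> (x + t *\<^sub>R a)) ` {-1<..<1} \<subseteq> M"
    using line_nonzero[OF x a(2)] \<Phi>_mem by auto
  moreover have "((\<lambda>t. \<Phi> (x + t *\<^sub>R a)) has_vector_derivative v) (at 0)"
    using curve_deriv[OF x a(2)] a(1) by (simp add: has_vector_derivative_def)
  ultimately show "v \<in> tangent_space M (\<Phi> x)"
    unfolding tangent_space_def
    by (auto intro!: exI[of _ "\<lambda>t. \<Phi> (x + t *\<^sub>R a)"] exI[of _ "1::real"])
next
  fix v assume "v \<in> tangent_space M (\<Phi> x)"
  then obtain \<gamma> \<epsilon> where \<gamma>: "\<epsilon> > 0" "\<gamma> ` {-\<epsilon><..<\<epsilon>} \<subseteq> M" "\<gamma> 0 = \<Phi> x"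
    "(\<gamma> has_vector_derivative v) (at (0::real))" unfolding tangent_space_def by auto
  define \<xi> where "\<xi> t = R (\<gamma> t)" for t
  have \<xi>0: "\<xi> 0 = x" using R_\<Phi>_unit[OF x] by (simp add: \<xi>_def \<gamma>)
  have in\<epsilon>: "norm (\<xi> t) = 1 \<and> \<Phi> (\<xi> t) = \<gamma> t" if "t \<in> {-\<epsilon><..<\<epsilon>}" for t
    using R_mem[of "\<gamma> t"] \<gamma>(2) imageI[OF that, of \<gamma>] unfolding \<xi>_def by blast
  have d\<xi>: "(\<xi> has_derivative (\<lambda>h. R (h *\<^sub>R v))) (at 0)"
    using bounded_linear.has_derivative[OF R \<gamma>(4)[unfolded has_vector_derivative_def]]
    by (simp add: \<xi>_def[abs_def])
  have o: "open {-\<epsilon><..<\<epsilon>}" "0 \<in> {-\<epsilon><..<\<epsilon>}" using \<gamma> by auto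
  have "((\<lambda>t. \<xi> t \<bullet> \<xi> t) has_derivative (\<lambda>h. \<xi> 0 \<bullet> R (h *\<^sub>R v) + R (h *\<^sub>R v) \<bullet> \<xi> 0)) (at 0)"
    by (rule has_derivative_inner[OF d\<xi> d\<xi>])
  moreover have "((\<lambda>t. \<xi> t \<bullet> \<xi> t) has_derivative (\<lambda>h. 0)) (at 0)"
    by (rule has_derivative_transform_within_open[OF has_derivative_const[of 1] o])
      (use in\<epsilon> in \<open>auto simp: norm_eq_1\<close>)
  ultimately have "\<xi> 0 \<bullet> R (1 *\<^sub>R v) + R (1 *\<^sub>R v) \<bullet> \<xi> 0 = 0"
    using has_derivative_unique by metis
  then have "x \<bullet> R v = 0" by (simp add: \<xi>0 inner_commute)
  moreover have "v = dd (R v) \<Phi> x"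
  proof -
    have "\<xi> 0 \<noteq> 0" using \<xi>0 x by auto
    from has_derivative_compose[OF d\<xi> \<Phi>_deriv[OF this]]
    have "((\<lambda>t. \<Phi> (\<xi> t)) has_derivative (\<lambda>h. dd (R (h *\<^sub>R v)) \<Phi> x)) (at 0)" by (simp add: \<xi>0)
    then have "(\<gamma> has_derivative (\<lambda>h. dd (R (h *\<^sub>R v)) \<Phi> x)) (at 0)"
      by (rule has_derivative_transform_within_open[OF _ o]) (use in\<epsilon> in auto)
    from fun_cong[OF has_derivative_unique[OF this \<gamma>(4)[unfolded has_vector_derivative_def]], of 1]
    show ?thesis by simp
  qed
  ultimately show "v \<in> {dd a \<Phi> x |a. x \<bullet> a = 0}" by blast
qed

lemma subspace_tangent_space_M:
  assumes x: "norm x = 1" shows "subspace (tangent_space M (\<Phi> x))"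
proof -
  have "x \<noteq> 0" using x by auto
  have "tangent_space M (\<Phi> x) = frechet_derivative \<Phi> (at x) ` {a. x \<bullet> a = 0}"
    unfolding tangent_space_M[OF x] by auto
  then show ?thesis
    using linear_subspace_image[OF linear_d\<Phi>[OF \<open>x \<noteq> 0\<close>] subspace_hyperplane] by metis
qed

text \<open>A derivative within \<open>M\<close> is ambiguous off the tangent space; its values on
  velocities are pinned down by the chain rule along curves that stay in \<open>M\<close>.\<close>

lemma differential_curve:
  assumes Y: "smooth_map_on M Y" and x: "norm x = 1" and a: "x \<bullet> a = 0"
  shows "((\<lambda>t. Y (\<Phi> (x + t *\<^sub>R a))) has_derivative
    (\<lambda>t. differential M Y (\<Phi> x) (t *\<^sub>R dd a \<Phi> x))) (at (0::real))"
proof (rule has_derivative_in_compose[OF curve_deriv[OF x a]])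
  have "x \<noteq> 0" using x by auto
  have "(Y has_derivative differential M Y (\<Phi> x)) (at (\<Phi> x) within range (\<lambda>t. \<Phi> (x + t *\<^sub>R a)))"
    by (rule has_derivative_subset[OF smooth_map_on_has_derivative[OF Y \<Phi>_mem[OF \<open>x \<noteq> 0\<close>]]])
      (use line_nonzero[OF x a] \<Phi>_mem in auto)
  then show "(Y has_derivative differential M Y (\<Phi> x))
     (at (\<Phi> (x + 0 *\<^sub>R a)) within range (\<lambda>t. \<Phi> (x + t *\<^sub>R a)))" by simp
qed

text \<open>The constant vector \<open>b\<close>, projected to the tangent spaces of the sphere and
  pushed forward, gives a field; hence the \<open>SOME\<close> in
  \<open>second_fundamental_form\<close> denotes a genuine extension.\<close>

lemma tangent_field_exists:
  assumes x: "norm x = 1" and b: "x \<bullet> b = 0"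
  shows "\<exists>Y. tangent_field M Y \<and> Y (\<Phi> x) = dd b \<Phi> x"
proof -
  define Y where "Y q = dd (b - (R q \<bullet> b) *\<^sub>R R q) \<Phi> (R q)" for q
  have lin: "linear R" using R by (rule bounded_linear.linear)
  have op: "open {q. R q \<noteq> 0}"
    using continuous_open_preimage[OF linear_continuous_on[OF R] open_UNIV open_nonzero]
    by (simp add: vimage_def Compl_eq)
  have "smooth_on_open {q. R q \<noteq> 0} Y"
    unfolding Y_def[abs_def]
    by (rule smooth_on_dd_compose[OF smooth smooth_on_diff[OF smooth_on_const smooth_on_scaleR[OF smooth_on_inner]]])
      (use R op in \<open>auto intro: smooth_on_const smooth_on_bounded_linear\<close>)
  then have "smooth_map_on M Y"
    by (rule smooth_map_onI) (use R_mem in fastforce)+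
  moreover have "Y q \<in> tangent_space M q" if "q \<in> M" for q
  proof -
    have n: "norm (R q) = 1" and q: "\<Phi> (R q) = q" using R_mem[OF that] by auto
    have "R q \<bullet> (b - (R q \<bullet> b) *\<^sub>R R q) = 0" using n by (simp add: inner_diff_right norm_eq_1)
    then show ?thesis using tangent_space_M[OF n] unfolding q Y_def by blast
  qed
  moreover have "Y (\<Phi> x) = dd b \<Phi> x" using R_\<Phi>_unit[OF x] b by (simp add: Y_def)
  ultimately show ?thesis unfolding tangent_field_def by blast
qed

text \<open>With \<open>w = R Y\<close> the field is the differential of \<open>\<Phi>\<close>
  applied to the moving direction \<open>w\<close>. The product rule then gives the second
  derivative of \<open>\<Phi>\<close> plus a tangent vector, and only the latter depends on the
  extension \<open>Y\<close>.\<close>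

lemma differential_tangent_field:
  assumes Y: "tangent_field M Y" and Yx: "Y (\<Phi> x) = dd b \<Phi> x"
    and x: "norm x = 1" and a: "x \<bullet> a = 0" and b: "x \<bullet> b = 0"
  shows "\<exists>c. x \<bullet> c = 0 \<and> differential M Y (\<Phi> x) (dd a \<Phi> x) = dd a (dd b \<Phi>) x + dd c \<Phi> x"
proof -
  have sm: "smooth_map_on M Y" using Y by (simp add: tangent_field_def)
  have x0: "x \<noteq> 0" using x by auto
  define \<xi> where "\<xi> t = sgn (x + t *\<^sub>R a)" for t
  define w where "w t = R (Y (\<Phi> (x + t *\<^sub>R a)))" for t
  let ?D = "differential M Y (\<Phi> x) (dd a \<Phi> x)"
  note dY = differential_curve[OF sm x a]
  have Ylin: "differential M Y (\<Phi> x) (t *\<^sub>R u) = t *\<^sub>R differential M Y (\<Phi> x) u" for t u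
    using smooth_map_on_has_derivative[OF sm \<Phi>_mem[OF x0]] has_derivative_linear linear_cmul by blast
  have \<xi>0: "\<xi> 0 = x" using x by (simp add: \<xi>_def sgn_div_norm)
  have w0: "w 0 = b" using R_d\<Phi>[OF x b] by (simp add: w_def Yx)
  have dw: "(w has_derivative (\<lambda>t. t *\<^sub>R R ?D)) (at 0)"
    using bounded_linear.has_derivative[OF R dY] 
    by (simp add: w_def[abs_def] Ylin linear_cmul[OF bounded_linear.linear[OF R]])
  have x0': "x + 0 *\<^sub>R a \<in> - {0}" using x0 by simp
  have "((\<lambda>t. sgn (x + t *\<^sub>R a)) has_derivative (\<lambda>t. dd (t *\<^sub>R a) sgn x)) (at 0)"
    using has_derivative_compose[OF line_has_derivative smooth_on_has_derivative[OF smooth_on_sgn x0']] by simp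
  then have d\<xi>: "(\<xi> has_derivative (\<lambda>t. t *\<^sub>R a)) (at 0)"
    by (simp add: \<xi>_def[abs_def] dd_sgn_unit[OF x] a)
  have eq: "Y (\<Phi> (x + t *\<^sub>R a)) = dd (w t) \<Phi> (\<xi> t)" for t
  proof -
    have nz: "x + t *\<^sub>R a \<noteq> 0" by (rule line_nonzero[OF x a])
    then have n: "norm (\<xi> t) = 1" by (simp add: \<xi>_def norm_sgn)
    have "Y (\<Phi> (\<xi> t)) \<in> tangent_space M (\<Phi> (\<xi> t))"
      using Y \<Phi>_mem[of "\<xi> t"] n unfolding tangent_field_def by fastforce
    then obtain c where c: "Y (\<Phi> (\<xi> t)) = dd c \<Phi> (\<xi> t)" "\<xi> t \<bullet> c = 0"
      unfolding tangent_space_M[OF n] by auto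
    moreover have "\<Phi> (\<xi> t) = \<Phi> (x + t *\<^sub>R a)" unfolding \<xi>_def by (rule \<Phi>_sgn[OF nz])
    ultimately show ?thesis using R_d\<Phi>[OF n c(2)] by (simp add: w_def)
  qed
  have "\<xi> 0 \<in> - {0}" using \<xi>0 x0 by simp
  from has_derivative_dd_compose[OF smooth this d\<xi> dw]
  have "((\<lambda>t. dd (w t) \<Phi> (\<xi> t)) has_derivative
      (\<lambda>h. dd (h *\<^sub>R a) (dd b \<Phi>) x + dd (h *\<^sub>R R ?D) \<Phi> x)) (at 0)" by (simp add: \<xi>0 w0)
  from fun_cong[OF has_derivative_unique[OF dY this[folded eq]], of 1]
  have "?D = dd a (dd b \<Phi>) x + dd (R ?D) \<Phi> x" by simp
  also have "dd (R ?D) \<Phi> x = dd (R ?D - (x \<bullet> R ?D) *\<^sub>R x) \<Phi> x" by (rule d\<Phi>_tangential[OF x])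
  finally have "?D = dd a (dd b \<Phi>) x + dd (R ?D - (x \<bullet> R ?D) *\<^sub>R x) \<Phi> x" .
  moreover have "x \<bullet> (R ?D - (x \<bullet> R ?D) *\<^sub>R x) = 0"
    using x by (simp add: inner_diff_right norm_eq_1)
  ultimately show ?thesis by blast
qed

lemma subspace_normal_space:
  assumes "subspace (tangent_space N p)" shows "subspace (normal_space N L p)"
  using assms unfolding normal_space_def orthogonal_def
  by (auto simp: subspace_def inner_add_left)

text \<open>The term depending on the chosen field is tangent to \<open>M\<close>, so the normal
  projection removes it.\<close>

lemma second_fundamental_form_eq:
  assumes N: "subspace (tangent_space N (\<Phi> x))"
    and x: "norm x = 1" and a: "x \<bullet> a = 0" and b: "x \<bullet> b = 0"
  shows "second_fundamental_form N M (\<Phi> x) (dd a \<Phi> x) (dd b \<Phi> x)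
     = orth_proj (normal_space N M (\<Phi> x)) (dd a (dd b \<Phi>) x)"
proof -
  define Y where "Y = (SOME Y. tangent_field M Y \<and> Y (\<Phi> x) = dd b \<Phi> x)"
  have Y: "tangent_field M Y" "Y (\<Phi> x) = dd b \<Phi> x"
    using someI_ex[OF tangent_field_exists[OF x b]] by (auto simp: Y_def)
  obtain c where c: "x \<bullet> c = 0" "differential M Y (\<Phi> x) (dd a \<Phi> x) = dd a (dd b \<Phi>) x + dd c \<Phi> x"
    using differential_tangent_field[OF Y x a b] by blast
  note sub = subspace_normal_space[OF N, of M]
  have "dd c \<Phi> x \<in> tangent_space M (\<Phi> x)" using c(1) tangent_space_M[OF x] by blast
  then have "orth_proj (normal_space N M (\<Phi> x)) (dd c \<Phi> x) = 0"
    unfolding orth_proj_eq_0_iff[OF sub] by (auto simp: normal_space_def orthogonal_def inner_commute)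
  then show ?thesis
    unfolding second_fundamental_form_def Let_def Y_def[symmetric] c(2)
    by (simp add: linear_add[OF linear_orth_proj[OF sub]])
qed

text \<open>The chart near \<open>p\<close> is central projection of the open hemisphere around
  \<open>x\<close> to the tangent plane, carried by the differential of \<open>\<Phi>\<close> into
  the ambient space, where the model subspace must live. Its inverse needs no normalisation because
  \<open>\<Phi>\<close> is constant along rays.\<close>

lemma smooth_submanifold_M: "smooth_submanifold (DIM('a) - 1) M"
  unfolding smooth_submanifold_def
proof
  fix p assume "p \<in> M"
  define x where "x = R p"
  have x: "norm x = 1" and p: "\<Phi> x = p" using R_mem[OF \<open>p \<in> M\<close>] by (auto simp: x_def)
  have x0: "x \<noteq> 0" using x by auto
  have xx: "x \<bullet> x = 1" using x by (simp add: norm_eq_1)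
  note lin = bounded_linear.linear[OF R]
  let ?D = "frechet_derivative \<Phi> (at x)"
  note lD = linear_d\<Phi>[OF x0]
  define W where "W = {q \<in> M. R q \<bullet> x > 0}"
  define L where "L = ?D ` {a. x \<bullet> a = 0}"
  define \<phi> where "\<phi> q = ?D (inverse (R q \<bullet> x) *\<^sub>R R q - x)" for q
  define \<psi> where "\<psi> l = \<Phi> (x + R l)" for l
  have op: "open {q. R q \<bullet> x > 0}"
    by (intro open_Collect_less continuous_intros linear_continuous_on R)
  have "openin (top_of_set M) W"
    unfolding W_def using openin_open_Int[OF op, of M] by (simp add: Int_def)
  moreover have "p \<in> W" using \<open>p \<in> M\<close> xx by (simp add: W_def x_def)
  moreover have "subspace L"
    unfolding L_def by (rule linear_subspace_image[OF lD subspace_hyperplane])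
  moreover have "dim L = DIM('a) - 1"
  proof -
    have "inj_on ?D (span {a. x \<bullet> a = 0})"
      using R_d\<Phi>[OF x] by (auto intro!: inj_on_inverseI[of _ R] simp: span_eq_iff[THEN iffD2, OF subspace_hyperplane])
    then have "dim L = dim {a. x \<bullet> a = 0}" unfolding L_def by (intro dim_image_eq lD)
    also have "\<dots> = DIM('a) - 1" by (rule dim_hyperplane[OF x0])
    finally show ?thesis .
  qed
  moreover have "openin (top_of_set L) L" by simp
  have sm\<phi>: "smooth_on_open {q. R q \<bullet> x > 0} \<phi>"
  proof -
    have "smooth_on_open {q. R q \<bullet> x > 0} (\<lambda>q. inverse (R q \<bullet> x) *\<^sub>R R q - x)"
      by (intro smooth_on_diff smooth_on_scaleR smooth_on_inverse smooth_on_inner smooth_on_const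
          smooth_on_bounded_linear R op) auto
    then show ?thesis unfolding \<phi>_def[abs_def]
      by (rule smooth_on_linear_compose[rotated]) (use lD linear_conv_bounded_linear in blast)
  qed
  \<comment> \<open>The half space is an open neighbourhood of \<open>L\<close> on which
    \<open>x + R l\<close> keeps a positive component along \<open>x\<close>, so it avoids the
    singularity of \<open>\<Phi>\<close> at 0.\<close>
  have sm\<psi>: "smooth_on_open {l. x \<bullet> R l > - 1} \<psi>"
    unfolding \<psi>_def[abs_def]
  proof (rule smooth_on_compose[OF smooth])
    have "open {l. x \<bullet> R l > - 1}"
      by (intro open_Collect_less continuous_intros linear_continuous_on R)
    then show "smooth_on_open {l. x \<bullet> R l > - 1} (\<lambda>l. x + R l)"
      by (intro smooth_on_add smooth_on_const smooth_on_bounded_linear R)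
    show "(\<lambda>l. x + R l) ` {l. x \<bullet> R l > - 1} \<subseteq> - {0}"
    proof clarsimp
      fix l assume "- 1 < x \<bullet> R l" "x + R l = 0"
      then have "x \<bullet> (x + R l) = 0" by simp
      then show False using \<open>- 1 < x \<bullet> R l\<close> by (simp add: inner_add_right xx)
    qed
  qed
  have W\<phi>: "W \<subseteq> {q. R q \<bullet> x > 0}" by (auto simp: W_def)
  have RL: "x \<bullet> R l = 0" "?D (R l) = l" if "l \<in> L" for l
    using that R_d\<Phi>[OF x] by (auto simp: L_def)
  have L\<psi>: "L \<subseteq> {l. x \<bullet> R l > - 1}" using RL by auto
  moreover have "homeomorphism W L \<phi> \<psi>"
  proof (rule homeomorphismI)
    show "continuous_on W \<phi>" "continuous_on L \<psi>"
      using smooth_on_continuous[OF sm\<phi>] smooth_on_continuous[OF sm\<psi>] W\<phi> L\<psi> continuous_on_subset by blast+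
    have R\<phi>: "R (\<phi> q) = inverse (R q \<bullet> x) *\<^sub>R R q - x" "\<phi> q \<in> L" if "q \<in> W" for q
    proof -
      have "x \<bullet> (inverse (R q \<bullet> x) *\<^sub>R R q - x) = 0"
        using that by (simp add: W_def inner_diff_right xx inner_commute)
      then show "R (\<phi> q) = inverse (R q \<bullet> x) *\<^sub>R R q - x" "\<phi> q \<in> L"
        unfolding \<phi>_def L_def using R_d\<Phi>[OF x] by blast+
    qed
    have R\<psi>: "R (\<psi> l) = inverse (norm (x + R l)) *\<^sub>R (x + R l)" "\<psi> l \<in> M" "x + R l \<noteq> 0" if "l \<in> L" for l
    proof -
      have "x \<bullet> (x + R l) = 1" using RL(1)[OF that] by (simp add: inner_add_right xx)
      then show "x + R l \<noteq> 0" by auto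
      then show "R (\<psi> l) = inverse (norm (x + R l)) *\<^sub>R (x + R l)" "\<psi> l \<in> M"
        using R_\<Phi>[of "x + R l"] \<Phi>_mem[of "x + R l"] by (auto simp: \<psi>_def sgn_div_norm)
    qed
    have R\<psi>x: "R (\<psi> l) \<bullet> x = inverse (norm (x + R l))" if "l \<in> L" for l
      using R\<psi>(1)[OF that] RL(1)[OF that] by (simp add: inner_add_left xx inner_commute[of "R l"])
    show "\<phi> ` W \<subseteq> L" using R\<phi> by auto
    show "\<psi> ` L \<subseteq> W" using R\<psi> R\<psi>x by (auto simp: W_def)
    show "\<psi> (\<phi> q) = q" if "q \<in> W" for q
    proof -
      have q: "q \<in> M" "R q \<bullet> x > 0" using that by (auto simp: W_def)
      have "\<psi> (\<phi> q) = \<Phi> (inverse (R q \<bullet> x) *\<^sub>R R q)" by (simp add: \<psi>_def R\<phi>(1)[OF that])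
      also have "\<dots> = \<Phi> (R q)" using homogD[OF hom, of "inverse (R q \<bullet> x)" "R q"] q R_mem[OF q(1)]
        by fastforce
      finally show ?thesis using R_mem[OF q(1)] by simp
    qed
    show "\<phi> (\<psi> l) = l" if "l \<in> L" for l
    proof -
      have "inverse (R (\<psi> l) \<bullet> x) *\<^sub>R R (\<psi> l) - x = R l"
        unfolding R\<psi>x[OF that] using R\<psi>(3)[OF that] by (simp add: R\<psi>(1)[OF that])
      then show ?thesis unfolding \<phi>_def using RL(2)[OF that] by simp
    qed
  qed
  ultimately have "openin (top_of_set M) W \<and> p \<in> W \<and> subspace L \<and> dim L = DIM('a) - 1 \<and>
      openin (top_of_set L) L \<and> homeomorphism W L \<phi> \<psi> \<and> smooth_map_on W \<phi> \<and> smooth_map_on L \<psi>"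
    by (intro conjI smooth_map_onI[OF sm\<phi> W\<phi> refl] smooth_map_onI[OF sm\<psi> L\<psi> refl]) simp_all
  then show "\<exists>W L U (\<phi> :: 'c \<Rightarrow> 'c) \<psi>. openin (top_of_set M) W \<and> p \<in> W \<and> subspace L \<and> dim L = DIM('a) - 1 \<and>
      openin (top_of_set L) U \<and> homeomorphism W U \<phi> \<psi> \<and> smooth_map_on W \<phi> \<and> smooth_map_on U \<psi>"
    by blast
qed

end

text \<open>The unit sphere is itself an instance, which yields its tangent spaces and the behaviour
  of differentials of maps defined on it.\<close>

interpretation id_embedding: sphere_embedding "sgn :: 'a::euclidean_space \<Rightarrow> 'a" "\<lambda>x. x"
  rewrites "sphere_embedding.M sgn = (sphere 0 1 :: 'a set)"
proof -
  show e: "sphere_embedding (sgn :: 'a \<Rightarrow> 'a) (\<lambda>x. x)"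
  proof (rule sphere_embedding.intro)
    show "homog 0 (sgn :: 'a \<Rightarrow> 'a)" by (auto simp: homog_def sgn_scaleR)
  qed (rule smooth_on_sgn bounded_linear_ident refl)+
  have "sgn x = x" if "norm x = 1" for x :: 'a using that by (simp add: sgn_div_norm)
  then show "sphere_embedding.M sgn = (sphere 0 1 :: 'a set)"
    unfolding sphere_embedding.M_def[OF e] by force
qed

lemma tangent_space_sphere:
  assumes "norm (x::'a::euclidean_space) = 1"
  shows "tangent_space (sphere 0 1) x = {v. x \<bullet> v = 0}"
proof -
  have "sgn x = x" using assms by (simp add: sgn_div_norm)
  then have "tangent_space (sphere 0 1) x = {a - (x \<bullet> a) *\<^sub>R x |a. x \<bullet> a = 0}"
    using id_embedding.tangent_space_M[OF assms] by (simp add: dd_sgn_unit[OF assms])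
  also have "\<dots> = {v. x \<bullet> v = 0}" by force
  finally show ?thesis .
qed

text \<open>The normal space of \<open>M\<close> in the sphere is the orthogonal complement of the
  tangent space of \<open>M\<close> together with the position vector. A vector projects to 0 there
  exactly if it lies in their sum \<open>S\<close>, which turns the condition into an equation with
  two unknowns \<open>a\<close> and \<open>t\<close>.\<close>

lemma (in sphere_embedding) mean_curvature_vector_sphere_eq_0_iff:
  assumes unit: "\<And>z. z \<noteq> 0 \<Longrightarrow> norm (\<Phi> z) = 1"
    and x: "norm x = 1" and E: "orthonormal_basis_of (tangent_space M (\<Phi> x)) E"
  shows "mean_curvature_vector (sphere 0 1) M (\<Phi> x) = 0 \<longleftrightarrow>
    (\<exists>a t. x \<bullet> a = 0 \<and> (\<Sum>e\<in>E. dd (R e) (dd (R e) \<Phi>) x) = dd a \<Phi> x + t *\<^sub>R \<Phi> x)"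
proof -
  have x0: "x \<noteq> 0" using x by auto
  define T where "T = tangent_space M (\<Phi> x)"
  define V where "V = normal_space (sphere 0 1) M (\<Phi> x)"
  define E' where "E' = (SOME E. orthonormal_basis_of T E)"
  have E': "orthonormal_basis_of T E'" unfolding E'_def by (rule someI) (rule E[folded T_def])
  have n: "norm (\<Phi> x) = 1" using unit x0 by simp
  have N: "tangent_space (sphere 0 1) (\<Phi> x) = {v. \<Phi> x \<bullet> v = 0}" by (rule tangent_space_sphere[OF n])
  have subN: "subspace (tangent_space (sphere 0 1) (\<Phi> x))" unfolding N by (rule subspace_hyperplane)
  have V: "subspace V" unfolding V_def by (rule subspace_normal_space[OF subN])
  have V_iff: "w \<in> V \<longleftrightarrow> \<Phi> x \<bullet> w = 0 \<and> (\<forall>v\<in>T. w \<bullet> v = 0)" for w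
    by (auto simp: V_def normal_space_def N T_def orthogonal_def)
  have T_eq: "T = {dd a \<Phi> x |a. x \<bullet> a = 0}" unfolding T_def by (rule tangent_space_M[OF x])
  have subT: "subspace T" unfolding T_def by (rule subspace_tangent_space_M[OF x])
  let ?B = "\<lambda>u v. dd (R u) (dd (R v) \<Phi>) x"
  note lR = bounded_linear.linear[OF R]
  have xU: "x \<in> - {0}" using x0 by simp
  have l: "linear (\<lambda>u. ?B u v)" and r: "linear (?B u)" for u v
    using linear_compose[OF lR dd_dd_linear_left[OF smooth xU]]
      linear_compose[OF lR dd_dd_linear_right[OF smooth xU]] by (auto simp: o_def)
  have "mean_curvature_vector (sphere 0 1) M (\<Phi> x) = (\<Sum>e\<in>E'. orth_proj V (?B e e))"
    unfolding mean_curvature_vector_def Let_def T_def[symmetric] E'_def[symmetric]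
  proof (rule sum.cong[OF refl])
    fix e assume "e \<in> E'"
    then have "e \<in> T" using E' by (auto simp: orthonormal_basis_of_def)
    then obtain a where a: "e = dd a \<Phi> x" "x \<bullet> a = 0" by (auto simp: T_eq)
    show "second_fundamental_form (sphere 0 1) M (\<Phi> x) e e = orth_proj V (?B e e)"
      using second_fundamental_form_eq[OF subN x a(2) a(2)] by (simp add: a R_d\<Phi>[OF x] V_def)
  qed
  also have "\<dots> = orth_proj V (\<Sum>e\<in>E'. ?B e e)" by (simp add: linear_sum[OF linear_orth_proj[OF V]])
  also have "(\<Sum>e\<in>E'. ?B e e) = (\<Sum>e\<in>E. ?B e e)"
    by (rule trace_orthonormal_basis_eq[OF l r E' E[folded T_def]])
  finally have eq: "mean_curvature_vector (sphere 0 1) M (\<Phi> x) = orth_proj V (\<Sum>e\<in>E. ?B e e)" .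
  define S where "S = {u + v |u v. u \<in> T \<and> v \<in> span {\<Phi> x}}"
  have S: "subspace S" unfolding S_def by (rule subspace_sums[OF subT subspace_span])
  have S_iff: "w \<in> S \<longleftrightarrow> (\<exists>a t. x \<bullet> a = 0 \<and> w = dd a \<Phi> x + t *\<^sub>R \<Phi> x)" for w
    by (auto simp: S_def T_eq span_singleton)
  have "(\<forall>z\<in>V. w \<bullet> z = 0) \<longleftrightarrow> w \<in> S" for w
  proof
    assume h: "\<forall>z\<in>V. w \<bullet> z = 0"
    define z where "z = w - orth_proj S w"
    have zS: "z \<bullet> s = 0" if "s \<in> S" for s unfolding z_def by (rule orth_proj_orthogonal[OF S that])
    have "\<Phi> x \<in> S" using subspace_0[OF subT] by (force simp: S_def intro: span_base)
    moreover have "v \<in> S" if "v \<in> T" for v using that by (force simp: S_def intro: span_zero)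
    ultimately have "z \<in> V" using zS by (auto simp: V_iff inner_commute[of "\<Phi> x"])
    then have "w \<bullet> z = 0" using h by blast
    moreover have "orth_proj S w \<bullet> z = 0" using zS[OF orth_proj_mem[OF S]] by (simp add: inner_commute)
    ultimately have "z \<bullet> z = 0" by (simp add: z_def inner_diff_left)
    then have "w = orth_proj S w" by (simp add: z_def)
    then show "w \<in> S" using orth_proj_mem[OF S] by metis
  next
    assume "w \<in> S"
    then obtain a t where "x \<bullet> a = 0" "w = dd a \<Phi> x + t *\<^sub>R \<Phi> x" by (auto simp: S_iff)
    moreover from this have "dd a \<Phi> x \<in> T" by (auto simp: T_eq)
    ultimately show "\<forall>z\<in>V. w \<bullet> z = 0"
      by (auto simp: V_iff inner_add_left) (metis inner_commute add_0)
  qed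
  then show ?thesis unfolding eq orth_proj_eq_0_iff[OF V] S_iff by blast
qed

lemma norm_add_scaleR_power2:
  "(norm (u + t *\<^sub>R v))^2 = (norm u)^2 + 2 * t * (u \<bullet> v) + t^2 * (norm v)^2"
  unfolding power2_norm_eq_inner
  by (simp add: inner_add_left inner_add_right inner_commute[of v u] power2_eq_square[of t] distrib_left)

text \<open>Singular value decomposition. A unit vector \<open>e\<close> maximising
  \<open>norm (A e)\<close> is critical, which forces \<open>A e\<close> to be orthogonal to the
  image of the complement of \<open>e\<close> in \<open>V\<close>; induction continues in that
  complement.\<close>

lemma adapted_orthonormal_basis:
  fixes A :: "'a::euclidean_space \<Rightarrow> 'b::euclidean_space"
  assumes A: "linear A" and V: "subspace V"
  obtains E where "orthonormal_basis_of V E" "\<And>e e'. e \<in> E \<Longrightarrow> e' \<in> E \<Longrightarrow> e \<noteq> e' \<Longrightarrow> A e \<bullet> A e' = 0"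
proof -
  have "\<exists>E. orthonormal_basis_of V E \<and> (\<forall>e\<in>E. \<forall>e'\<in>E. e \<noteq> e' \<longrightarrow> A e \<bullet> A e' = 0)"
    using V
  proof (induction "dim V" arbitrary: V rule: less_induct)
    case less
    show ?case
    proof (cases "V = {0}")
      case True
      then show ?thesis by (intro exI[of _ "{}"]) (auto simp: orthonormal_basis_of_def)
    next
      case False
      define K where "K = V \<inter> sphere 0 1"
      obtain v where "v \<in> V" "v \<noteq> 0" using False subspace_0[OF less.prems] by auto
      then have "sgn v \<in> K" using less.prems by (simp add: K_def norm_sgn sgn_div_norm subspace_scale)
      then have K1: "K \<noteq> {}" by auto
      have K2: "compact K"
        unfolding K_def using closed_subspace[OF less.prems] by (simp add: closed_Int_compact)
      have K3: "continuous_on K (\<lambda>v. norm (A v))"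
        by (intro continuous_intros linear_continuous_on linear_conv_bounded_linear[THEN iffD1] A)
      obtain e where e: "e \<in> K" "\<And>v. v \<in> K \<Longrightarrow> norm (A v) \<le> norm (A e)"
        using continuous_attains_sup[OF K2 K1 K3] by blast
      have eV: "e \<in> V" and en: "norm e = 1" using e by (auto simp: K_def)
      have max: "norm (A v) \<le> norm (A e) * norm v" if "v \<in> V" for v
      proof (cases "v = 0")
        case False
        have "sgn v \<in> K" using False that less.prems by (simp add: K_def norm_sgn sgn_div_norm subspace_scale)
        then have "norm (A (sgn v)) \<le> norm (A e)" by (rule e(2))
        then show ?thesis using False by (simp add: sgn_div_norm linear_cmul[OF A] field_simps)
      qed (simp add: linear_0[OF A])
      have crit: "A e \<bullet> A w = 0" if w: "w \<in> V" "e \<bullet> w = 0" for w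
      proof (rule ccontr)
        assume ne: "A e \<bullet> A w \<noteq> 0"
        define \<alpha> where "\<alpha> = A e \<bullet> A w"
        \<comment> \<open>Moving \<open>e\<close> by \<open>t *\<^sub>R w\<close> gains
          \<open>2 * t * \<alpha>\<close> to first order and is allowed at most
          \<open>t^2 * C\<close>. At \<open>t = \<alpha> / C\<close> the allowance is only half of
          the gain; the summand 1 makes \<open>C\<close> positive.\<close>
        define C where "C = (norm (A e))^2 * (norm w)^2 + 1"
        have C: "C > 0" unfolding C_def by (simp add: add_nonneg_pos)
        define t where "t = \<alpha> / C"
        have "e + t *\<^sub>R w \<in> V" using eV w less.prems by (simp add: subspace_add subspace_scale)
        then have "(norm (A (e + t *\<^sub>R w)))^2 \<le> (norm (A e) * norm (e + t *\<^sub>R w))^2"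
          by (intro power_mono max) auto
        moreover have "(norm (A (e + t *\<^sub>R w)))^2 = (norm (A e))^2 + 2 * t * \<alpha> + t^2 * (norm (A w))^2"
          by (simp only: linear_add[OF A] linear_cmul[OF A] norm_add_scaleR_power2 \<alpha>_def)
        moreover have "(norm (e + t *\<^sub>R w))^2 = 1 + t^2 * (norm w)^2"
          using en w by (simp add: norm_add_scaleR_power2)
        ultimately have "2 * t * \<alpha> + t^2 * (norm (A w))^2 \<le> t^2 * ((norm (A e))^2 * (norm w)^2)"
          by (simp add: power_mult_distrib algebra_simps)
        also have "\<dots> \<le> t^2 * C" by (simp add: C_def algebra_simps)
        also have "t^2 * C = t * \<alpha>" using C by (simp add: t_def power2_eq_square)
        finally have "t * \<alpha> + t^2 * (norm (A w))^2 \<le> 0" by linarith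
        moreover have "t * \<alpha> = \<alpha>^2 / C" by (simp add: t_def power2_eq_square)
        then have "t * \<alpha> > 0" using C ne by (simp add: \<alpha>_def)
        moreover have "0 \<le> t^2 * (norm (A w))^2" by simp
        ultimately show False by linarith
      qed
      define W where "W = V \<inter> {w. e \<bullet> w = 0}"
      have W: "subspace W" unfolding W_def by (intro subspace_inter less.prems subspace_hyperplane)
      have "e \<notin> W" using en by (auto simp: W_def norm_eq_1)
      moreover have "W \<subseteq> V" by (auto simp: W_def)
      ultimately have "W \<subset> V" using eV by blast
      moreover have "span W = W" "span V = V" using W less.prems span_eq_iff by blast+
      ultimately have "dim W < dim V" using dim_psubset[of W V] by metis
      then obtain E where E: "orthonormal_basis_of W E" "\<forall>e\<in>E. \<forall>e'\<in>E. e \<noteq> e' \<longrightarrow> A e \<bullet> A e' = 0"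
        using less.hyps[OF _ W] by blast
      have EW: "f \<in> V" "e \<bullet> f = 0" if "f \<in> E" for f
        using E(1) that by (auto simp: orthonormal_basis_of_def W_def)
      have "span (insert e E) = V"
      proof (rule antisym)
        show "span (insert e E) \<subseteq> V" using eV EW less.prems by (intro span_minimal) auto
        show "V \<subseteq> span (insert e E)"
        proof
          fix v assume v: "v \<in> V"
          have "v - (e \<bullet> v) *\<^sub>R e \<in> W"
            using v eV en less.prems by (simp add: W_def subspace_diff subspace_scale inner_diff_right norm_eq_1)
          then have "v - (e \<bullet> v) *\<^sub>R e \<in> span E" using E(1) by (simp add: orthonormal_basis_of_def)
          then show "v \<in> span (insert e E)" unfolding span_insert by blast
        qed
      qed
      moreover have "pairwise orthogonal (insert e E)"
        using E(1) EW(2) by (auto simp: orthonormal_basis_of_def pairwise_insert orthogonal_def inner_commute)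
      moreover have "\<forall>f\<in>insert e E. norm f = 1" using E(1) en by (auto simp: orthonormal_basis_of_def)
      ultimately have "orthonormal_basis_of V (insert e E)"
        using eV EW by (auto simp: orthonormal_basis_of_def)
      moreover have "\<forall>f\<in>insert e E. \<forall>f'\<in>insert e E. f \<noteq> f' \<longrightarrow> A f \<bullet> A f' = 0"
        using E(2) crit EW crit[unfolded inner_commute[of "A e"]] by auto
      ultimately show ?thesis by blast
    qed
  qed
  then show ?thesis using that by blast
qed

section \<open>Maps between spheres and the parametrisation of Lawson-Osserman sets\<close>

locale spherical_map =
  fixes F :: "'a::euclidean_space \<Rightarrow> 'b::euclidean_space"
  assumes smooth: "smooth_on_open (- {0}) F"
    and hom: "homog 0 F"
    and unit: "x \<noteq> 0 \<Longrightarrow> norm (F x) = 1"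
begin

abbreviation "D2 x a b \<equiv> dd a (dd b F) x"

lemma linear_dF: "x \<noteq> 0 \<Longrightarrow> linear (frechet_derivative F (at x))"
  using smooth_on_linear_dd[OF smooth] by simp

lemma dF_radial: "x \<noteq> 0 \<Longrightarrow> dd x F x = 0"
  using homog_euler[OF smooth hom] by simp

lemma dF_orthogonal: "x \<noteq> 0 \<Longrightarrow> dd v F x \<bullet> F x = 0"
proof -
  assume x: "x \<noteq> 0"
  have xU: "x \<in> - {0}" using x by simp
  note D = smooth_on_has_derivative[OF smooth xU]
  have 1: "((\<lambda>x. F x \<bullet> F x) has_derivative (\<lambda>h. F x \<bullet> dd h F x + dd h F x \<bullet> F x)) (at x)"
    by (rule has_derivative_inner[OF D D])
  have 2: "((\<lambda>x. F x \<bullet> F x) has_derivative (\<lambda>h. 0)) (at x)"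
    by (rule has_derivative_transform_within_open[OF has_derivative_const[of 1] open_nonzero xU])
      (use unit in \<open>auto simp: norm_eq_1\<close>)
  show ?thesis using fun_cong[OF has_derivative_unique[OF 1 2], of v] by (simp add: inner_commute)
qed

text \<open>Differentiates the orthogonality of \<open>F\<close> and its first derivatives. This
  identity is what extracts a scalar equation when the minimal surface system is paired with
  \<open>F\<close>.\<close>

lemma D2_inner: "x \<noteq> 0 \<Longrightarrow> D2 x a b \<bullet> F x = - (dd a F x \<bullet> dd b F x)"
proof -
  assume x: "x \<noteq> 0"
  have xU: "x \<in> - {0}" using x by simp
  have 1: "((\<lambda>x. dd b F x \<bullet> F x) has_derivative (\<lambda>h. dd b F x \<bullet> dd h F x + dd h (dd b F) x \<bullet> F x)) (at x)"
    by (rule has_derivative_inner[OF smooth_on_has_derivative[OF smooth_on_dd[OF smooth] xU] smooth_on_has_derivative[OF smooth xU]])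
  have 2: "((\<lambda>x. dd b F x \<bullet> F x) has_derivative (\<lambda>h. 0)) (at x)"
    by (rule has_derivative_transform_within_open[OF has_derivative_const[of 0] open_nonzero xU])
      (use dF_orthogonal in auto)
  show ?thesis using fun_cong[OF has_derivative_unique[OF 1 2], of a]
    by (simp add: inner_commute[of "dd b F x" "dd a F x"] eq_neg_iff_add_eq_0 add.commute)
qed

definition "\<Psi> \<theta> x = (cos \<theta> *\<^sub>R sgn x, sin \<theta> *\<^sub>R F x)"

lemma \<Psi>_has_derivative:
  "x \<noteq> 0 \<Longrightarrow> (\<Psi> \<theta> has_derivative (\<lambda>a. (cos \<theta> *\<^sub>R dd a sgn x, sin \<theta> *\<^sub>R dd a F x))) (at x)"
  unfolding \<Psi>_def[abs_def]
  using smooth_on_has_derivative[OF smooth, of x] smooth_on_has_derivative[OF smooth_on_sgn, of x]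
  by (intro has_derivative_Pair has_derivative_scaleR_right) auto

lemma dd_\<Psi>: "x \<noteq> 0 \<Longrightarrow> dd a (\<Psi> \<theta>) x = (cos \<theta> *\<^sub>R dd a sgn x, sin \<theta> *\<^sub>R dd a F x)"
  by (rule dd_eqI[OF \<Psi>_has_derivative])

lemma dd_\<Psi>_unit: "norm x = 1 \<Longrightarrow> x \<bullet> a = 0 \<Longrightarrow> dd a (\<Psi> \<theta>) x = (cos \<theta> *\<^sub>R a, sin \<theta> *\<^sub>R dd a F x)"
  using dd_\<Psi>[of x \<theta> a] dd_sgn_unit[of x a] by (cases "x = 0") auto

lemma dd_dd_\<Psi>_unit:
  assumes "norm x = 1" "x \<bullet> a = 0" "x \<bullet> b = 0"
  shows "dd a (dd b (\<Psi> \<theta>)) x = (- (cos \<theta> * (a \<bullet> b)) *\<^sub>R x, sin \<theta> *\<^sub>R D2 x a b)"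
proof -
  have x: "x \<in> - {0}" using assms by auto
  have "frechet_derivative (dd b (\<Psi> \<theta>)) (at x)
    = frechet_derivative (\<lambda>x. (cos \<theta> *\<^sub>R dd b sgn x, sin \<theta> *\<^sub>R dd b F x)) (at x)"
    by (rule frechet_derivative_cong_open[OF open_nonzero x]) (simp add: dd_\<Psi>)
  moreover have "((\<lambda>x. (cos \<theta> *\<^sub>R dd b sgn x, sin \<theta> *\<^sub>R dd b F x)) has_derivative
      (\<lambda>a. (cos \<theta> *\<^sub>R dd a (dd b sgn) x, sin \<theta> *\<^sub>R D2 x a b))) (at x)"
    by (intro has_derivative_Pair has_derivative_scaleR_right
        smooth_on_has_derivative[OF smooth_on_dd[OF smooth] x]
        smooth_on_has_derivative[OF smooth_on_dd[OF smooth_on_sgn] x])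
  ultimately have "dd a (dd b (\<Psi> \<theta>)) x = (cos \<theta> *\<^sub>R dd a (dd b sgn) x, sin \<theta> *\<^sub>R D2 x a b)"
    using dd_eqI by fastforce
  then show ?thesis by (simp add: dd_dd_sgn_unit[OF assms])
qed

text \<open>The cosine of an acute angle is positive, so the first component recovers the point of
  the sphere linearly.\<close>

lemma \<Psi>_embedding:
  assumes "\<theta> \<in> {0<..<pi/2}"
  shows "sphere_embedding (\<Psi> \<theta>) (\<lambda>q. fst q /\<^sub>R cos \<theta>)"
proof (rule sphere_embedding.intro)
  have c: "cos \<theta> > 0" using assms by (intro cos_gt_zero_pi) auto
  show "smooth_on_open (- {0}) (\<Psi> \<theta>)"
    unfolding \<Psi>_def[abs_def]
    by (intro smooth_on_Pair smooth_on_scaleR smooth_on_const open_nonzero smooth smooth_on_sgn)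
  show "homog 0 (\<Psi> \<theta>)"
    using hom by (auto simp: homog_def \<Psi>_def sgn_scaleR)
  show "bounded_linear (\<lambda>q::'a \<times> 'b. fst q /\<^sub>R cos \<theta>)"
    by (intro bounded_linear_const_scaleR bounded_linear_fst)
  show "fst (\<Psi> \<theta> x) /\<^sub>R cos \<theta> = sgn x" if "x \<noteq> 0" for x
    using c by (simp add: \<Psi>_def)
qed

lemma norm_\<Psi>: "x \<noteq> 0 \<Longrightarrow> norm (\<Psi> \<theta> x) = 1"
  using unit by (simp add: \<Psi>_def norm_Pair norm_sgn)

end

section \<open>The minimal surface equation\<close>

lemma orthonormal_basis_of_Basis: "orthonormal_basis_of UNIV (Basis :: 'a::euclidean_space set)"
  by (auto simp: orthonormal_basis_of_def pairwise_def orthogonal_def inner_Basis)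

text \<open>Completing a tangent basis by the radial direction makes it comparable with
  \<open>Basis\<close> through \<open>trace_orthonormal_basis_eq\<close>.\<close>

lemma orthonormal_basis_of_insert_normal:
  fixes x :: "'a::euclidean_space"
  assumes x: "norm x = 1" and E: "orthonormal_basis_of {v. x \<bullet> v = 0} E"
  shows "orthonormal_basis_of UNIV (insert x E)" "x \<notin> E"
proof -
  have Ex: "x \<bullet> e = 0" if "e \<in> E" for e using E that by (auto simp: orthonormal_basis_of_def)
  show "x \<notin> E" using Ex[of x] x by (auto simp: norm_eq_1)
  have "v \<in> span (insert x E)" for v
  proof -
    have "v - (x \<bullet> v) *\<^sub>R x \<in> span E"
      using E x by (simp add: orthonormal_basis_of_def inner_diff_right norm_eq_1)
    then show ?thesis unfolding span_insert by blast
  qed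
  then have "span (insert x E) = UNIV" by blast
  then show "orthonormal_basis_of UNIV (insert x E)"
    using E x Ex by (auto simp: orthonormal_basis_of_def pairwise_insert orthogonal_def inner_commute)
qed

text \<open>Meant for the differential of \<open>\<Psi> \<theta>\<close>: an adapted basis stays
  orthogonal, and only the lengths \<open>sqrt (w e)\<close> have to be divided out. Injectivity is
  recorded for reindexing the trace.\<close>

lemma orthonormal_basis_of_image:
  fixes f :: "'a::euclidean_space \<Rightarrow> 'b::euclidean_space"
  assumes E: "orthonormal_basis_of V E" and lin: "linear f" and pos: "\<And>e. e \<in> E \<Longrightarrow> w e > 0"
    and ip: "\<And>e e'. e \<in> E \<Longrightarrow> e' \<in> E \<Longrightarrow> f e \<bullet> f e' = (if e = e' then w e else 0)"
  shows "orthonormal_basis_of (f ` V) ((\<lambda>e. f e /\<^sub>R sqrt (w e)) ` E)"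
    and "inj_on (\<lambda>e. f e /\<^sub>R sqrt (w e)) E"
proof -
  let ?g = "\<lambda>e. f e /\<^sub>R sqrt (w e)"
  have gg: "?g e \<bullet> ?g e' = (if e = e' then 1 else 0)" if "e \<in> E" "e' \<in> E" for e e'
    using ip[OF that] pos[OF that(1)] by (auto simp: field_simps)
  show inj: "inj_on ?g E"
    using gg by (intro inj_onI) (metis zero_neq_one)
  have V: "E \<subseteq> V" "span E = V" using E by (auto simp: orthonormal_basis_of_def)
  have sV: "subspace V" using V(2) by (metis subspace_span)
  have g_in: "?g e \<in> f ` V" if "e \<in> E" for e
  proof -
    have "?g e = f (e /\<^sub>R sqrt (w e))" by (simp add: linear_cmul[OF lin])
    moreover have "e /\<^sub>R sqrt (w e) \<in> V" using that V(1) sV by (simp add: subspace_scale subset_iff)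
    ultimately show ?thesis by blast
  qed
  have "span (?g ` E) = f ` V"
  proof (rule antisym)
    show "span (?g ` E) \<subseteq> f ` V"
      using g_in linear_subspace_image[OF lin sV] by (intro span_minimal) auto
    have "f e \<in> span (?g ` E)" if "e \<in> E" for e
    proof -
      have "sqrt (w e) *\<^sub>R ?g e \<in> span (?g ` E)" using that by (intro span_mul span_base) auto
      then show ?thesis using pos[OF that] by simp
    qed
    then have "f ` E \<subseteq> span (?g ` E)" by auto
    then have "span (f ` E) \<subseteq> span (?g ` E)" by (intro span_minimal) auto
    then show "f ` V \<subseteq> span (?g ` E)" using linear_span_image[OF lin, of E] V(2) by simp
  qed
  moreover have "pairwise orthogonal (?g ` E)"
    by (auto simp: pairwise_image pairwise_def orthogonal_def gg simp del: inner_scaleR_left inner_scaleR_right)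
  moreover have "\<forall>u\<in>?g ` E. norm u = 1" using gg by (auto simp: norm_eq_1)
  ultimately show "orthonormal_basis_of (f ` V) (?g ` E)"
    using g_in by (auto simp: orthonormal_basis_of_def)
qed

context spherical_map
begin

lemma M_\<Psi>: "\<theta> \<in> {0<..<pi/2} \<Longrightarrow> sphere_embedding.M (\<Psi> \<theta>) = LO_set F \<theta>"
proof -
  assume t: "\<theta> \<in> {0<..<pi/2}"
  have "\<Psi> \<theta> x = (cos \<theta> *\<^sub>R x, sin \<theta> *\<^sub>R F x)" if "x \<in> sphere 0 1" for x
    using that by (simp add: \<Psi>_def sgn_div_norm)
  then show ?thesis
    unfolding sphere_embedding.M_def[OF \<Psi>_embedding[OF t]] LO_set_def by (intro image_cong) auto
qed

text \<open>Being a submanifold of the sphere is automatic, so minimality reduces to the vanishing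
  of the mean curvature vector.\<close>

lemma LO_sphere_iff:
  assumes t: "\<theta> \<in> {0<..<pi/2}"
  shows "LO_sphere F \<theta> \<longleftrightarrow>
    (\<forall>x. norm x = 1 \<longrightarrow> mean_curvature_vector (sphere 0 1) (LO_set F \<theta>) (\<Psi> \<theta> x) = 0)"
proof -
  have M: "LO_set F \<theta> = \<Psi> \<theta> ` sphere 0 1"
    using M_\<Psi>[OF t] sphere_embedding.M_def[OF \<Psi>_embedding[OF t]] by simp
  have nz: "x \<noteq> 0" if "norm x = 1" for x :: 'a using that by auto
  have "LO_set F \<theta> \<subseteq> sphere 0 1" unfolding M by (auto intro!: norm_\<Psi> nz)
  moreover have "smooth_submanifold (DIM('a) - 1) (LO_set F \<theta>)"
    using sphere_embedding.smooth_submanifold_M[OF \<Psi>_embedding[OF t]] unfolding M_\<Psi>[OF t] .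
  ultimately show ?thesis
    unfolding LO_sphere_def minimal_submanifold_def by (auto simp: M)
qed

text \<open>\<open>w e\<close> is the squared length of the image of \<open>e\<close> under the
  differential of \<open>\<Psi> \<theta>\<close>. The first component of the equation determines
  both unknowns, \<open>a = 0\<close> and \<open>t = - (\<Sum>e\<in>E. 1 / w e)\<close>; the second
  component is what remains.\<close>

lemma mean_curvature_vector_LO_set_eq_0_iff:
  assumes t: "\<theta> \<in> {0<..<pi/2}" and x: "norm x = 1"
    and E: "orthonormal_basis_of {v. x \<bullet> v = 0} E"
    and orth: "\<And>e e'. e \<in> E \<Longrightarrow> e' \<in> E \<Longrightarrow> e \<noteq> e' \<Longrightarrow> dd e F x \<bullet> dd e' F x = 0"
  defines "w \<equiv> \<lambda>e. (cos \<theta>)^2 + (sin \<theta>)^2 * (norm (dd e F x))^2"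
  shows "mean_curvature_vector (sphere 0 1) (LO_set F \<theta>) (\<Psi> \<theta> x) = 0 \<longleftrightarrow>
    (\<Sum>e\<in>E. (1 / w e) *\<^sub>R D2 x e e) = - (\<Sum>e\<in>E. 1 / w e) *\<^sub>R F x"
proof -
  have x0: "x \<noteq> 0" using x by auto
  have c: "cos \<theta> > 0" using t by (intro cos_gt_zero_pi) auto
  have s: "sin \<theta> > 0" using t by (intro sin_gt_zero2) auto
  interpret em: sphere_embedding "\<Psi> \<theta>" "\<lambda>q. fst q /\<^sub>R cos \<theta>" by (rule \<Psi>_embedding[OF t])
  have perp: "x \<bullet> e = 0" if "e \<in> E" for e using E that by (auto simp: orthonormal_basis_of_def)
  let ?f = "frechet_derivative (\<Psi> \<theta>) (at x)"
  let ?g = "\<lambda>e. ?f e /\<^sub>R sqrt (w e)"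
  have f: "?f e = (cos \<theta> *\<^sub>R e, sin \<theta> *\<^sub>R dd e F x)" if "x \<bullet> e = 0" for e
    by (rule dd_\<Psi>_unit[OF x that])
  have wpos: "w e > 0" for e using c by (simp add: w_def add_pos_nonneg)
  have lin: "linear ?f" by (rule em.linear_d\<Phi>[OF x0])
  have ip: "?f e \<bullet> ?f e' = (if e = e' then w e else 0)" if "e \<in> E" "e' \<in> E" for e e'
    using orthonormal_basis_of_inner[OF E that] orth[OF that]
    by (auto simp: f perp that w_def power2_eq_square power2_norm_eq_inner[unfolded power2_eq_square])
  have "?f ` {v. x \<bullet> v = 0} = tangent_space em.M (\<Psi> \<theta> x)"
    unfolding em.tangent_space_M[OF x] by auto
  then have onb: "orthonormal_basis_of (tangent_space em.M (\<Psi> \<theta> x)) (?g ` E)"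
    and inj: "inj_on ?g E"
    using orthonormal_basis_of_image[OF E lin wpos ip] by auto
  have Rg: "fst (?g e) /\<^sub>R cos \<theta> = e /\<^sub>R sqrt (w e)" if "e \<in> E" for e
    using c by (simp add: f perp that)
  have sum: "(\<Sum>u\<in>?g ` E. dd (fst u /\<^sub>R cos \<theta>) (dd (fst u /\<^sub>R cos \<theta>) (\<Psi> \<theta>)) x)
     = (- (cos \<theta> * (\<Sum>e\<in>E. 1 / w e)) *\<^sub>R x, sin \<theta> *\<^sub>R (\<Sum>e\<in>E. (1 / w e) *\<^sub>R D2 x e e))"
  proof -
    have xU: "x \<in> - {0}" using x0 by simp
    have "dd (fst (?g e) /\<^sub>R cos \<theta>) (dd (fst (?g e) /\<^sub>R cos \<theta>) (\<Psi> \<theta>)) x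
      = (- (cos \<theta> * (1 / w e)) *\<^sub>R x, sin \<theta> *\<^sub>R (1 / w e) *\<^sub>R D2 x e e)" if e: "e \<in> E" for e
    proof -
      have sq: "inverse (sqrt (w e)) * inverse (sqrt (w e)) = 1 / w e"
        using wpos[of e] by (simp add: inverse_eq_divide flip: real_sqrt_mult)
      have "dd (e /\<^sub>R sqrt (w e)) (dd (e /\<^sub>R sqrt (w e)) (\<Psi> \<theta>)) x
        = (inverse (sqrt (w e)) * inverse (sqrt (w e))) *\<^sub>R dd e (dd e (\<Psi> \<theta>)) x"
        by (simp add: linear_cmul[OF dd_dd_linear_left[OF em.smooth xU]]
            linear_cmul[OF dd_dd_linear_right[OF em.smooth xU]])
      also have "\<dots> = (1 / w e) *\<^sub>R (- (cos \<theta> * (e \<bullet> e)) *\<^sub>R x, sin \<theta> *\<^sub>R D2 x e e)"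
        unfolding sq dd_dd_\<Psi>_unit[OF x perp[OF e] perp[OF e]] ..
      also have "e \<bullet> e = 1" using orthonormal_basis_of_inner[OF E e e] by simp
      finally show ?thesis unfolding Rg[OF e] by simp
    qed
    then show ?thesis
      unfolding sum.reindex[OF inj] o_def
      by (simp add: sum_prod sum_distrib_left scaleR_sum_left scaleR_sum_right sum_negf prod_eq_iff fst_sum snd_sum)
  qed
  have "mean_curvature_vector (sphere 0 1) em.M (\<Psi> \<theta> x) = 0 \<longleftrightarrow>
    (\<exists>a t. x \<bullet> a = 0 \<and> (\<Sum>u\<in>?g ` E. dd (fst u /\<^sub>R cos \<theta>) (dd (fst u /\<^sub>R cos \<theta>) (\<Psi> \<theta>)) x)
        = dd a (\<Psi> \<theta>) x + t *\<^sub>R \<Psi> \<theta> x)"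
    by (rule em.mean_curvature_vector_sphere_eq_0_iff[OF norm_\<Psi> x onb])
  also have "\<dots> \<longleftrightarrow> (\<exists>a t. x \<bullet> a = 0 \<and> - (cos \<theta> * (\<Sum>e\<in>E. 1 / w e)) *\<^sub>R x = cos \<theta> *\<^sub>R a + t *\<^sub>R cos \<theta> *\<^sub>R x
     \<and> sin \<theta> *\<^sub>R (\<Sum>e\<in>E. (1 / w e) *\<^sub>R D2 x e e) = sin \<theta> *\<^sub>R dd a F x + t *\<^sub>R sin \<theta> *\<^sub>R F x)"
    unfolding sum using x by (intro ex_cong1 conj_cong refl) (simp add: f \<Psi>_def sgn_div_norm)
  also have "\<dots> \<longleftrightarrow> (\<Sum>e\<in>E. (1 / w e) *\<^sub>R D2 x e e) = - (\<Sum>e\<in>E. 1 / w e) *\<^sub>R F x"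
  proof
    assume "\<exists>a t. x \<bullet> a = 0 \<and> - (cos \<theta> * (\<Sum>e\<in>E. 1 / w e)) *\<^sub>R x = cos \<theta> *\<^sub>R a + t *\<^sub>R cos \<theta> *\<^sub>R x
     \<and> sin \<theta> *\<^sub>R (\<Sum>e\<in>E. (1 / w e) *\<^sub>R D2 x e e) = sin \<theta> *\<^sub>R dd a F x + t *\<^sub>R sin \<theta> *\<^sub>R F x"
    then obtain a t where a: "x \<bullet> a = 0"
      and 1: "- (cos \<theta> * (\<Sum>e\<in>E. 1 / w e)) *\<^sub>R x = cos \<theta> *\<^sub>R a + t *\<^sub>R cos \<theta> *\<^sub>R x"
      and 2: "sin \<theta> *\<^sub>R (\<Sum>e\<in>E. (1 / w e) *\<^sub>R D2 x e e) = sin \<theta> *\<^sub>R dd a F x + t *\<^sub>R sin \<theta> *\<^sub>R F x"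
      by blast
    \<comment> \<open>Pairing with \<open>x\<close> removes the tangential \<open>a\<close> and
      isolates \<open>t\<close>.\<close>
    have "x \<bullet> (- (cos \<theta> * (\<Sum>e\<in>E. 1 / w e)) *\<^sub>R x) = x \<bullet> (cos \<theta> *\<^sub>R a + t *\<^sub>R cos \<theta> *\<^sub>R x)"
      unfolding 1 ..
    then have "- (cos \<theta> * (\<Sum>e\<in>E. 1 / w e)) = t * cos \<theta>"
      using x a by (simp add: inner_add_right norm_eq_1)
    then have "cos \<theta> * t = cos \<theta> * (- (\<Sum>e\<in>E. 1 / w e))" by (simp only: mult_minus_right mult.commute)
    then have t_eq: "t = - (\<Sum>e\<in>E. 1 / w e)" using c by (metis less_irrefl mult_cancel_left)
    have "a = 0" using 1 c unfolding t_eq by (simp add: mult.commute)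
    then have "sin \<theta> *\<^sub>R (\<Sum>e\<in>E. (1 / w e) *\<^sub>R D2 x e e) = sin \<theta> *\<^sub>R (t *\<^sub>R F x)"
      using 2 linear_0[OF linear_dF[OF x0]] by (simp add: mult.commute)
    then have "(\<Sum>e\<in>E. (1 / w e) *\<^sub>R D2 x e e) = t *\<^sub>R F x"
      unfolding real_vector.scale_cancel_left using s by simp
    then show "(\<Sum>e\<in>E. (1 / w e) *\<^sub>R D2 x e e) = - (\<Sum>e\<in>E. 1 / w e) *\<^sub>R F x" unfolding t_eq .
  next
    assume h: "(\<Sum>e\<in>E. (1 / w e) *\<^sub>R D2 x e e) = - (\<Sum>e\<in>E. 1 / w e) *\<^sub>R F x"
    show "\<exists>a t. x \<bullet> a = 0 \<and> - (cos \<theta> * (\<Sum>e\<in>E. 1 / w e)) *\<^sub>R x = cos \<theta> *\<^sub>R a + t *\<^sub>R cos \<theta> *\<^sub>R x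
     \<and> sin \<theta> *\<^sub>R (\<Sum>e\<in>E. (1 / w e) *\<^sub>R D2 x e e) = sin \<theta> *\<^sub>R dd a F x + t *\<^sub>R sin \<theta> *\<^sub>R F x"
      unfolding h
      by (rule exI[of _ 0], rule exI[of _ "- (\<Sum>e\<in>E. 1 / w e)"])
        (simp add: linear_0[OF linear_dF[OF x0]] mult.commute)
  qed
  finally show ?thesis unfolding M_\<Psi>[OF t] .
qed

text \<open>\<open>H\<close> is a basis of the horizontal space, on which the differential is
  \<open>lam\<close> times an isometry, and \<open>K\<close> one of the kernel, both at the single
  point \<open>x\<close>. The eigenvector condition is tested against all \<open>v\<close>; for
  radial \<open>v\<close> both of its sides vanish.\<close>

definition frame :: "real \<Rightarrow> 'a \<Rightarrow> 'a set \<Rightarrow> 'a set \<Rightarrow> bool" where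
  "frame lam x H K \<longleftrightarrow> orthonormal_basis_of {v. x \<bullet> v = 0} (H \<union> K) \<and> H \<inter> K = {} \<and>
     (\<forall>e\<in>H. \<forall>v. dd e F x \<bullet> dd v F x = lam^2 * (e \<bullet> v)) \<and> (\<forall>e\<in>K. dd e F x = 0)"

lemma frame_facts:
  assumes fr: "frame lam x H K" and x: "norm x = 1"
  shows frame_finite: "finite H" "finite K"
    and frame_card: "card H + card K = DIM('a) - 1"
    and frame_norm: "e \<in> H \<Longrightarrow> (norm (dd e F x))^2 = lam^2"
    and frame_perp: "e \<in> H \<union> K \<Longrightarrow> x \<bullet> e = 0"
    and frame_orth: "e \<in> H \<union> K \<Longrightarrow> e' \<in> H \<union> K \<Longrightarrow> e \<noteq> e' \<Longrightarrow> dd e F x \<bullet> dd e' F x = 0"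
    and frame_unit: "e \<in> H \<union> K \<Longrightarrow> norm e = 1"
proof -
  have onb: "orthonormal_basis_of {v. x \<bullet> v = 0} (H \<union> K)" and disj: "H \<inter> K = {}"
    using fr by (auto simp: frame_def)
  have x0: "x \<noteq> 0" using x by auto
  show fin: "finite H" "finite K" using orthonormal_basis_of_finite_card(1)[OF onb] by auto
  show "card H + card K = DIM('a) - 1"
    using orthonormal_basis_of_finite_card(2)[OF onb] dim_hyperplane[OF x0] card_Un_disjoint[OF fin disj] by simp
  show "(norm (dd e F x))^2 = lam^2" if "e \<in> H"
    using fr that orthonormal_basis_of_inner[OF onb, of e e] by (simp add: frame_def power2_norm_eq_inner)
  show "x \<bullet> e = 0" "norm e = 1" if "e \<in> H \<union> K" for e
    using onb that by (auto simp: orthonormal_basis_of_def)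
  show "dd e F x \<bullet> dd e' F x = 0" if "e \<in> H \<union> K" "e' \<in> H \<union> K" "e \<noteq> e'"
    using orthonormal_basis_of_inner[OF onb that(1,2)] that fr by (auto simp: frame_def inner_commute)
qed

text \<open>With equal nonzero singular values the weights \<open>1 / w e\<close> take just two
  values, one on \<open>H\<close> and one on \<open>K\<close>.\<close>

lemma mean_curvature_frame_iff:
  assumes t: "\<theta> \<in> {0<..<pi/2}" and x: "norm x = 1" and fr: "frame lam x H K"
  defines "y \<equiv> 1 / ((cos \<theta>)^2 + (sin \<theta>)^2 * lam^2)"
  shows "mean_curvature_vector (sphere 0 1) (LO_set F \<theta>) (\<Psi> \<theta> x) = 0 \<longleftrightarrow>
    y *\<^sub>R (\<Sum>e\<in>H. D2 x e e) + (1 / (cos \<theta>)^2) *\<^sub>R (\<Sum>e\<in>K. D2 x e e)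
      = - (real (card H) * y + real (card K) / (cos \<theta>)^2) *\<^sub>R F x"
proof -
  have onb: "orthonormal_basis_of {v. x \<bullet> v = 0} (H \<union> K)" and disj: "H \<inter> K = {}"
    and K: "\<forall>e\<in>K. dd e F x = 0" using fr by (auto simp: frame_def)
  note fin = frame_finite[OF fr x]
  have w: "1 / ((cos \<theta>)^2 + (sin \<theta>)^2 * (norm (dd e F x))^2) = y" if "e \<in> H" for e
    using frame_norm[OF fr x that] by (simp add: y_def)
  have orth: "dd e F x \<bullet> dd e' F x = 0" if "e \<in> H \<union> K" "e' \<in> H \<union> K" "e \<noteq> e'" for e e'
    using frame_orth[OF fr x that] .
  let ?w = "\<lambda>e. (cos \<theta>)^2 + (sin \<theta>)^2 * (norm (dd e F x))^2"
  have "mean_curvature_vector (sphere 0 1) (LO_set F \<theta>) (\<Psi> \<theta> x) = 0 \<longleftrightarrow>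
      (\<Sum>e\<in>H \<union> K. (1 / ?w e) *\<^sub>R D2 x e e) = - (\<Sum>e\<in>H \<union> K. 1 / ?w e) *\<^sub>R F x"
    by (rule mean_curvature_vector_LO_set_eq_0_iff[OF t x onb]) (rule orth)
  also have "(\<Sum>e\<in>H \<union> K. (1 / ?w e) *\<^sub>R D2 x e e)
      = y *\<^sub>R (\<Sum>e\<in>H. D2 x e e) + (1 / (cos \<theta>)^2) *\<^sub>R (\<Sum>e\<in>K. D2 x e e)"
    unfolding sum.union_disjoint[OF fin disj] by (simp add: w K scaleR_sum_right)
  also have "(\<Sum>e\<in>H \<union> K. 1 / ?w e) = real (card H) * y + real (card K) / (cos \<theta>)^2"
    unfolding sum.union_disjoint[OF fin disj] by (simp add: w K)
  finally show ?thesis .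
qed

lemma horizontal_trace_inner:
  assumes x: "norm x = 1" and fr: "frame lam x H K"
  shows "(\<Sum>e\<in>H. D2 x e e) \<bullet> F x = - (real (card H) * lam^2)"
proof -
  have "D2 x e e \<bullet> F x = - (lam^2)" if "e \<in> H" for e
    using D2_inner[of x e e] x frame_norm[OF fr x that] by (cases "x = 0") (auto simp: power2_norm_eq_inner)
  then show ?thesis by (simp add: inner_sum_left)
qed

text \<open>In the pairing with \<open>F x\<close> the trace over \<open>K\<close> drops out,
  because the first derivatives vanish there. Writing the squared cosine as 1 minus the squared sine
  then gathers everything into one multiple of the horizontal weight \<open>g\<close>.\<close>

lemma minimal_relation:
  assumes t: "\<theta> \<in> {0<..<pi/2}" and x: "norm x = 1" and fr: "frame lam x H K"
    and m: "mean_curvature_vector (sphere 0 1) (LO_set F \<theta>) (\<Psi> \<theta> x) = 0"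
  shows "real (card H) * lam^2 = (real (card H) + real (card K)) * ((cos \<theta>)^2 + (sin \<theta>)^2 * lam^2)"
proof -
  have x0: "x \<noteq> 0" using x by auto
  have c: "(cos \<theta>)^2 > 0" using t cos_gt_zero_pi[of \<theta>] by simp
  define g where "g = (cos \<theta>)^2 + (sin \<theta>)^2 * lam^2"
  have g: "g > 0" using c by (simp add: g_def add_pos_nonneg)
  have "((1 / g) *\<^sub>R (\<Sum>e\<in>H. D2 x e e) + (1 / (cos \<theta>)^2) *\<^sub>R (\<Sum>e\<in>K. D2 x e e)) \<bullet> F x
      = (- (real (card H) * (1 / g) + real (card K) / (cos \<theta>)^2) *\<^sub>R F x) \<bullet> F x"
    using m[unfolded mean_curvature_frame_iff[OF t x fr]] by (simp add: g_def)
  moreover note horizontal_trace_inner[OF x fr]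
  moreover have "(\<Sum>e\<in>K. D2 x e e) \<bullet> F x = 0"
    using D2_inner[OF x0] fr by (simp add: inner_sum_left frame_def)
  moreover have "F x \<bullet> F x = 1" using unit[OF x0] by (simp add: norm_eq_1)
  ultimately have "real (card H) * lam^2 / g = real (card H) / g + real (card K) / (cos \<theta>)^2"
    by (simp add: inner_add_left)
  then have "real (card H) * lam^2 * (cos \<theta>)^2 = real (card H) * (cos \<theta>)^2 + real (card K) * g"
    using g c by (simp add: field_simps)
  then have "real (card H) * lam^2 * (1 - (sin \<theta>)^2) = real (card H) * (cos \<theta>)^2 + real (card K) * g"
    by (simp add: cos_squared_eq)
  then show ?thesis by (simp add: g_def algebra_simps)
qed

text \<open>Summation over the fixed \<open>Basis\<close> makes continuity evident. On the unit
  sphere this is the squared Hilbert-Schmidt norm of the differential, as the radial direction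
  contributes 0.\<close>

definition "energy x = (\<Sum>b\<in>Basis. dd b F x \<bullet> dd b F x)"

lemma energy_eq:
  assumes x: "norm x = 1" and fr: "frame lam x H K"
  shows "energy x = real (card H) * lam^2"
proof -
  have x0: "x \<noteq> 0" using x by auto
  have onb: "orthonormal_basis_of {v. x \<bullet> v = 0} (H \<union> K)" and disj: "H \<inter> K = {}"
    and K: "\<forall>e\<in>K. dd e F x = 0" using fr by (auto simp: frame_def)
  note fin = frame_finite[OF fr x]
  note ins = orthonormal_basis_of_insert_normal[OF x onb]
  note l = linear_dF[OF x0]
  have "energy x = (\<Sum>e\<in>insert x (H \<union> K). dd e F x \<bullet> dd e F x)"
    unfolding energy_def
    by (rule trace_orthonormal_basis_eq[OF _ _ orthonormal_basis_of_Basis ins(1)])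
      (auto intro!: linearI simp: linear_add[OF l] linear_cmul[OF l] inner_add_left inner_add_right)
  also have "\<dots> = (\<Sum>e\<in>H. dd e F x \<bullet> dd e F x)"
    using ins(2) fin disj K dF_radial[OF x0] by (simp add: sum.union_disjoint)
  also have "\<dots> = (\<Sum>e\<in>H. lam^2)"
    by (intro sum.cong refl) (simp add: frame_norm[OF fr x, symmetric] power2_norm_eq_inner)
  finally show ?thesis by simp
qed

lemma continuous_on_energy: "continuous_on (- {0}) energy"
  unfolding energy_def[abs_def]
  by (intro continuous_intros smooth_on_continuous smooth_on_dd smooth)

text \<open>Continuity is available for the energy, not directly for \<open>lam\<close> or the rank.
  Finitely many values on a connected sphere mean one value; \<open>n * (c + s * lam^2)\<close> then
  gives back \<open>lam\<close>, and \<open>card H * lam^2\<close> gives back the rank.\<close>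

lemma constant_frame:
  assumes t: "\<theta> \<in> {0<..<pi/2}" and LO: "LO_sphere F \<theta>" and dim: "DIM('a) \<ge> 2"
    and fr: "\<And>x. norm x = 1 \<Longrightarrow> \<exists>lam H K. lam \<ge> 0 \<and> frame lam x H K"
  obtains lam p where "lam > 0" "p > 0"
    "real p * lam^2 = real (DIM('a) - 1) * ((cos \<theta>)^2 + (sin \<theta>)^2 * lam^2)"
    "\<And>x. norm x = 1 \<Longrightarrow> \<exists>H K. frame lam x H K \<and> card H = p"
proof -
  define n where "n = real (DIM('a) - 1)"
  define c where "c = (cos \<theta>)^2"
  define s where "s = (sin \<theta>)^2"
  have n: "n > 0" using dim by (simp add: n_def)
  have c: "c > 0" using t cos_gt_zero_pi[of \<theta>] by (simp add: c_def)
  have s: "s > 0" using t sin_gt_zero2[of \<theta>] by (simp add: s_def)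
  have rel: "real (card H) * lam^2 = n * (c + s * lam^2)" "card H \<le> DIM('a)"
    if "norm x = 1" "frame lam x H K" for x lam H K
    using minimal_relation[OF t that] LO that(1) frame_card[OF that(2,1)]
    unfolding LO_sphere_iff[OF t] by (simp_all add: n_def c_def s_def flip: of_nat_add)
  have el: "energy x = n * (c + s * lam^2)" if "norm x = 1" "frame lam x H K" for x lam H K
    using energy_eq[OF that] rel[OF that] by simp
  \<comment> \<open>The right-hand side is the relation solved for \<open>lam^2\<close>, one
    candidate per rank, with \<open>DIM('a)\<close> as a crude bound on the rank.\<close>
  have "energy ` sphere 0 1 \<subseteq> (\<lambda>p. n * (c + s * (n * c / (real p - n * s)))) ` {..DIM('a)}"
  proof clarify
    fix x :: 'a assume "x \<in> sphere 0 1"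
    then have x: "norm x = 1" by simp
    obtain lam H K where fr': "frame lam x H K" using fr[OF x] by blast
    have "lam^2 * (real (card H) - n * s) = n * c" using rel(1)[OF x fr'] by (simp add: algebra_simps)
    \<comment> \<open>A zero factor would contradict \<open>n * c > 0\<close>.\<close>
    moreover from this have "real (card H) - n * s \<noteq> 0" using n c by auto
    ultimately have "lam^2 = n * c / (real (card H) - n * s)" by (simp add: field_simps)
    then have "energy x = n * (c + s * (n * c / (real (card H) - n * s)))"
      using el[OF x fr'] by simp
    then show "energy x \<in> (\<lambda>p. n * (c + s * (n * c / (real p - n * s)))) ` {..DIM('a)}"
      using rel(2)[OF x fr'] by auto
  qed
  then have "finite (energy ` sphere 0 1)" by (rule finite_subset) simp
  moreover have "connected (energy ` sphere 0 1)"
    using connected_sphere[OF dim, of 0 1]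
    by (intro connected_continuous_image continuous_on_subset[OF continuous_on_energy]) auto
  moreover have ne: "sphere 0 1 \<noteq> ({} :: 'a set)" by simp
  ultimately obtain E where "energy ` sphere 0 1 = {E}"
    using connected_finite_iff_sing by blast
  then have E: "energy x = E" if "norm x = 1" for x using that by auto
  obtain x0 :: 'a where x0: "norm x0 = 1" using ne by (metis ex_in_conv mem_sphere_0)
  obtain lam H0 K0 where lam: "lam \<ge> 0" and fr0: "frame lam x0 H0 K0" using fr[OF x0] by blast
  have "n * (c + s * lam^2) > 0" using n c s by (simp add: add_pos_nonneg)
  then have pl: "real (card H0) * lam^2 > 0" using rel[OF x0 fr0] by simp
  then have lam_pos: "lam > 0" using lam by (cases "lam = 0") auto
  have "card H0 > 0" using pl by (cases "card H0 = 0") auto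
  moreover have "\<exists>H K. frame lam x H K \<and> card H = card H0" if x: "norm x = 1" for x
  proof -
    obtain l H K where l: "l \<ge> 0" and fr': "frame l x H K" using fr[OF x] by blast
    have "n * (c + s * l^2) = n * (c + s * lam^2)"
      using el[OF x fr'] el[OF x0 fr0] E[OF x] E[OF x0] by simp
    then have "l^2 = lam^2" using n s by simp
    then have "l = lam" using l lam by simp
    moreover have "real (card H) * l^2 = real (card H0) * lam^2"
      using energy_eq[OF x fr'] energy_eq[OF x0 fr0] E[OF x] E[OF x0] by simp
    ultimately have "card H = card H0" using lam_pos by simp
    then show ?thesis using fr' \<open>l = lam\<close> by blast
  qed
  ultimately show ?thesis
    using that[OF lam_pos] rel(1)[OF x0 fr0] unfolding n_def c_def s_def by blast
qed

end

section \<open>Differentiating the singular value condition\<close>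

context spherical_map
begin

text \<open>This is dF^* dF applied to \<open>a\<close>. Written in coordinates it is smooth in
  \<open>x\<close>, unlike a frame.\<close>

definition gram :: "'a \<Rightarrow> 'a \<Rightarrow> 'a" where
  "gram x a = (\<Sum>b\<in>Basis. (dd a F x \<bullet> dd b F x) *\<^sub>R b)"

definition gram_deriv :: "'a \<Rightarrow> 'a \<Rightarrow> 'a \<Rightarrow> 'a" where
  "gram_deriv x u a = (\<Sum>b\<in>Basis. (dd a F x \<bullet> D2 x u b + D2 x u a \<bullet> dd b F x) *\<^sub>R b)"

lemma nonzero_unit: "norm x = 1 \<Longrightarrow> x \<in> - {0 :: 'a}"
  by auto

lemma gram_inner:
  assumes "x \<noteq> 0" shows "gram x a \<bullet> v = dd a F x \<bullet> dd v F x"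
proof -
  have "dd v F x = (\<Sum>b\<in>Basis. (v \<bullet> b) *\<^sub>R dd b F x)" by (rule linear_eq_sum_Basis[OF linear_dF[OF assms]])
  then show ?thesis by (simp add: gram_def inner_sum_left inner_sum_right mult.commute inner_commute[of v])
qed

lemma gram_deriv_inner:
  assumes "x \<noteq> 0" shows "gram_deriv x u a \<bullet> v = dd a F x \<bullet> D2 x u v + D2 x u a \<bullet> dd v F x"
proof -
  have xU: "x \<in> - {0}" using assms by simp
  have 1: "dd v F x = (\<Sum>b\<in>Basis. (v \<bullet> b) *\<^sub>R dd b F x)" by (rule linear_eq_sum_Basis[OF linear_dF[OF assms]])
  have 2: "D2 x u v = (\<Sum>b\<in>Basis. (v \<bullet> b) *\<^sub>R D2 x u b)"
    by (rule linear_eq_sum_Basis[OF dd_dd_linear_right[OF smooth xU]])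
  show ?thesis unfolding 1 2
    by (simp add: gram_deriv_def inner_sum_left inner_sum_right inner_commute[of v] sum.distrib distrib_left mult.commute)
qed

lemma dd_expand:
  assumes x: "norm x = 1" and fr: "frame lam x H K"
  shows "dd a F x = (\<Sum>e\<in>H. (a \<bullet> e) *\<^sub>R dd e F x)"
proof -
  have x0: "x \<noteq> 0" using x by auto
  have onb: "orthonormal_basis_of {v. x \<bullet> v = 0} (H \<union> K)" and disj: "H \<inter> K = {}"
    and K: "\<forall>e\<in>K. dd e F x = 0" using fr by (auto simp: frame_def)
  note fin = frame_finite[OF fr x]
  note ins = orthonormal_basis_of_insert_normal[OF x onb]
  have "a = (\<Sum>e\<in>insert x (H \<union> K). (a \<bullet> e) *\<^sub>R e)"
    using orthonormal_basis_of_expand[OF ins(1)] by simp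
  then have "dd a F x = dd (\<Sum>e\<in>insert x (H \<union> K). (a \<bullet> e) *\<^sub>R e) F x" by (rule arg_cong)
  also have "\<dots> = (\<Sum>e\<in>insert x (H \<union> K). (a \<bullet> e) *\<^sub>R dd e F x)"
    by (simp only: linear_sum[OF linear_dF[OF x0]] linear_cmul[OF linear_dF[OF x0]])
  also have "\<dots> = (\<Sum>e\<in>H. (a \<bullet> e) *\<^sub>R dd e F x)"
    using fin ins(2) dF_radial[OF x0] K by (simp add: sum.union_disjoint[OF fin disj])
  finally show ?thesis .
qed

lemma gram_unit:
  assumes x: "norm x = 1" and fr: "frame lam x H K"
  shows "dd (gram x a) F x = lam^2 *\<^sub>R dd a F x"
proof -
  have x0: "x \<noteq> 0" using x by auto
  have "gram x a = lam^2 *\<^sub>R (\<Sum>e\<in>H. (a \<bullet> e) *\<^sub>R e)"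
  proof (rule vector_eq_ldot[THEN iffD1], intro allI)
    fix v
    have "v \<bullet> gram x a = (\<Sum>e\<in>H. (a \<bullet> e) *\<^sub>R dd e F x) \<bullet> dd v F x"
      using gram_inner[OF x0, of a v] dd_expand[OF x fr, of a] by (simp add: inner_commute)
    also have "\<dots> = (\<Sum>e\<in>H. (a \<bullet> e) * (lam^2 * (e \<bullet> v)))"
      using fr by (simp add: inner_sum_left frame_def)
    also have "\<dots> = v \<bullet> (lam^2 *\<^sub>R (\<Sum>e\<in>H. (a \<bullet> e) *\<^sub>R e))"
      by (simp add: inner_sum_right sum_distrib_left inner_commute[of v] mult.left_commute)
    finally show "v \<bullet> gram x a = v \<bullet> (lam^2 *\<^sub>R (\<Sum>e\<in>H. (a \<bullet> e) *\<^sub>R e))" .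
  qed
  then have "dd (gram x a) F x = lam^2 *\<^sub>R (\<Sum>e\<in>H. (a \<bullet> e) *\<^sub>R dd e F x)"
    by (simp only: linear_sum[OF linear_dF[OF x0]] linear_cmul[OF linear_dF[OF x0]])
  then show ?thesis using dd_expand[OF x fr, of a] by simp
qed

text \<open>To be differentiated, the identity must hold on an open set. Off the sphere
  \<open>gram\<close> scales with degree -2, and the factor \<open>x \<bullet> x\<close>
  compensates.\<close>

lemma gram_all:
  assumes fr: "\<And>x. norm x = 1 \<Longrightarrow> \<exists>H K. frame lam x H K" and x: "x \<noteq> 0"
  shows "dd ((x \<bullet> x) *\<^sub>R gram x a) F x = lam^2 *\<^sub>R dd a F x"
proof -
  define z where "z = sgn x"
  define r where "r = norm x powr (-1)"
  have r: "r * r * (x \<bullet> x) = 1" "r \<noteq> 0"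
    using x by (simp_all add: r_def powr_minus field_simps norm_eq_sqrt_inner)
  have z: "norm z = 1" using x by (simp add: z_def norm_sgn)
  have dF: "dd v F x = r *\<^sub>R dd v F z" for v
    using homog_sgn[OF homog_dd[OF smooth hom] x, of v] by (simp add: z_def r_def)
  have "gram x a = (r * r) *\<^sub>R gram z a"
    unfolding gram_def dF by (simp add: scaleR_sum_right mult.assoc)
  then have "(x \<bullet> x) *\<^sub>R gram x a = gram z a" using r by (simp add: mult.commute)
  moreover obtain H K where "frame lam z H K" using fr[OF z] by blast
  ultimately show ?thesis
    using gram_unit[OF z, of lam H K a] by (simp add: dF)
qed

text \<open>Derivative of \<open>gram_all\<close> in a tangential direction; the factor
  \<open>x \<bullet> x\<close> contributes nothing since \<open>u\<close> is orthogonal to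
  \<open>x\<close>.\<close>

lemma gram_identity:
  assumes fr: "\<And>x. norm x = 1 \<Longrightarrow> \<exists>H K. frame lam x H K" and x: "norm x = 1" and u: "x \<bullet> u = 0"
  shows "D2 x u (gram x a) + dd (gram_deriv x u a) F x = lam^2 *\<^sub>R D2 x u a"
proof -
  note xU = nonzero_unit[OF x]
  note d = smooth_on_has_derivative[OF smooth_on_dd[OF smooth] xU]
  have g: "((\<lambda>y. gram y a) has_derivative (\<lambda>h. gram_deriv x h a)) (at x)"
    unfolding gram_def gram_deriv_def
    by (intro has_derivative_sum has_derivative_scaleR_left has_derivative_inner d)
  have i: "((\<lambda>y. y \<bullet> y) has_derivative (\<lambda>h. x \<bullet> h + h \<bullet> x)) (at x)"
    by (intro has_derivative_inner has_derivative_ident)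
  note w = has_derivative_scaleR[OF i g]
  have id: "((\<lambda>y. y) has_derivative (\<lambda>h. h)) (at x)" by (rule has_derivative_ident)
  have 1: "((\<lambda>y. dd ((y \<bullet> y) *\<^sub>R gram y a) F y) has_derivative
      (\<lambda>h. dd h (dd ((x \<bullet> x) *\<^sub>R gram x a) F) x
         + dd ((x \<bullet> x) *\<^sub>R gram_deriv x h a + (x \<bullet> h + h \<bullet> x) *\<^sub>R gram x a) F x)) (at x)"
    by (rule has_derivative_dd_compose[OF smooth xU id w])
  have 2: "((\<lambda>y. dd ((y \<bullet> y) *\<^sub>R gram y a) F y) has_derivative (\<lambda>h. lam^2 *\<^sub>R D2 x h a)) (at x)"
    using has_derivative_scaleR_right[OF d, of "lam^2" a]
    by (rule has_derivative_transform_within_open[OF _ open_nonzero xU]) (use gram_all[OF fr] in auto)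
  have "x \<bullet> x = 1" using x by (simp add: norm_eq_1)
  then show ?thesis
    using fun_cong[OF has_derivative_unique[OF 1 2], of u] u by (simp add: inner_commute)
qed

text \<open>The trilinear form \<open>D2 x u a \<bullet> dd b F x\<close> is symmetric in
  \<open>u\<close> and \<open>a\<close>. For horizontal \<open>a\<close> the terms with
  \<open>lam^2\<close> cancel in \<open>gram_identity\<close>, which makes the form antisymmetric in
  \<open>a\<close> and \<open>b\<close>. Alternating the two symmetries shows that it equals its own
  negative, as in the uniqueness proof for the Levi-Civita connection.\<close>

lemma horizontal_hessian:
  assumes fr: "\<And>x. norm x = 1 \<Longrightarrow> \<exists>H K. frame lam x H K" and x: "norm x = 1" and lam: "lam > 0"
    and f: "frame lam x H K" and a: "a \<in> H" and b: "b \<in> H" and u: "u \<in> H"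
  shows "D2 x u a \<bullet> dd b F x = 0"
proof -
  have x0: "x \<noteq> 0" using x by auto
  note xU = nonzero_unit[OF x]
  have anti: "D2 x u a \<bullet> dd b F x = - (D2 x u b \<bullet> dd a F x)" if "a \<in> H" "b \<in> H" "u \<in> H" for a b u
  proof -
    have "gram x a = lam^2 *\<^sub>R a"
      by (rule vector_eq_ldot[THEN iffD1])
        (use gram_inner[OF x0, of a] f that in \<open>auto simp: frame_def inner_commute\<close>)
    then have "dd (gram_deriv x u a) F x = 0"
      using gram_identity[OF fr x frame_perp[OF f x], of u a] that
      by (simp add: linear_cmul[OF dd_dd_linear_right[OF smooth xU]])
    then have "dd b F x \<bullet> dd (gram_deriv x u a) F x = 0" by simp
    then have "b \<bullet> gram_deriv x u a = 0" using f that lam by (simp add: frame_def)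
    then show ?thesis using gram_deriv_inner[OF x0, of u a b] by (simp add: inner_commute)
  qed
  have sym: "D2 x u a = D2 x a u" for u a by (rule dd_commute[OF smooth xU])
  show ?thesis
    using anti[OF a b u] anti[OF u a b] anti[OF b u a] by (simp add: sym[of u a] sym[of u b] sym[of b a])
qed

text \<open>The fibres of \<open>F\<close> on the sphere are minimal: the trace of the Hessian over the kernel is
  tangent to the image because the kernel fields can be differentiated, and orthogonal to it by the
  minimal surface system.\<close>

lemma vertical_hessian_trace:
  assumes fr: "\<And>x. norm x = 1 \<Longrightarrow> \<exists>H K. frame lam x H K" and x: "norm x = 1" and lam: "lam > 0"
    and f: "frame lam x H K" and t: "\<theta> \<in> {0<..<pi/2}"
    and m: "mean_curvature_vector (sphere 0 1) (LO_set F \<theta>) (\<Psi> \<theta> x) = 0"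
  shows "(\<Sum>e\<in>K. D2 x e e) = 0"
proof -
  have x0: "x \<noteq> 0" using x by auto
  note xU = nonzero_unit[OF x]
  define k where "k = (\<Sum>e\<in>K. D2 x e e)"
  have c: "(cos \<theta>)^2 > 0" using t cos_gt_zero_pi[of \<theta>] by simp
  have H: "k \<bullet> dd b F x = 0" if b: "b \<in> H" for b
  proof -
    define A where "A = - (real (card H) * (1 / ((cos \<theta>)^2 + (sin \<theta>)^2 * lam^2)) + real (card K) / (cos \<theta>)^2)"
    define y where "y = 1 / ((cos \<theta>)^2 + (sin \<theta>)^2 * lam^2)"
    have "y *\<^sub>R (\<Sum>e\<in>H. D2 x e e) + (1 / (cos \<theta>)^2) *\<^sub>R k = A *\<^sub>R F x"
      using m[unfolded mean_curvature_frame_iff[OF t x f]] unfolding A_def y_def k_def .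
    then have "(y *\<^sub>R (\<Sum>e\<in>H. D2 x e e) + (1 / (cos \<theta>)^2) *\<^sub>R k) \<bullet> dd b F x = (A *\<^sub>R F x) \<bullet> dd b F x" by simp
    moreover have "(\<Sum>e\<in>H. D2 x e e) \<bullet> dd b F x = 0"
      using horizontal_hessian[OF fr x lam f _ b] by (simp add: inner_sum_left)
    moreover have "F x \<bullet> dd b F x = 0" using dF_orthogonal[OF x0] by (simp add: inner_commute)
    ultimately show ?thesis using c by (simp add: inner_add_left)
  qed
  have "k \<bullet> dd v F x = 0" for v
    unfolding dd_expand[OF x f, of v] using H by (simp add: inner_sum_right)
  moreover have "lam^2 *\<^sub>R k = dd (\<Sum>e\<in>K. gram_deriv x e e) F x"
  proof -
    have "lam^2 *\<^sub>R D2 x e e = dd (gram_deriv x e e) F x" if e: "e \<in> K" for e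
    proof -
      have "gram x e = 0" using f e by (simp add: gram_def frame_def)
      then show ?thesis
        using gram_identity[OF fr x frame_perp[OF f x], of e e] e
        by (simp add: linear_0[OF dd_dd_linear_right[OF smooth xU]])
    qed
    then show ?thesis by (simp add: k_def scaleR_sum_right linear_sum[OF linear_dF[OF x0]])
  qed
  ultimately have "k \<bullet> (lam^2 *\<^sub>R k) = 0" by simp
  then show ?thesis using lam by (simp add: k_def)
qed

text \<open>With the vertical trace gone, the system makes the horizontal trace a multiple of
  \<open>F x\<close>; pairing with \<open>F x\<close> identifies the factor, and the angle
  cancels.\<close>

lemma hessian_traces:
  assumes fr: "\<And>x. norm x = 1 \<Longrightarrow> \<exists>H K. frame lam x H K" and x: "norm x = 1" and lam: "lam > 0"
    and f: "frame lam x H K" and t: "\<theta> \<in> {0<..<pi/2}"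
    and m: "mean_curvature_vector (sphere 0 1) (LO_set F \<theta>) (\<Psi> \<theta> x) = 0"
  shows "(\<Sum>e\<in>H. D2 x e e) = - (real (card H) * lam^2) *\<^sub>R F x"
proof -
  have x0: "x \<noteq> 0" using x by auto
  have c: "(cos \<theta>)^2 > 0" using t cos_gt_zero_pi[of \<theta>] by simp
  define g where "g = (cos \<theta>)^2 + (sin \<theta>)^2 * lam^2"
  have g: "g > 0" using c by (simp add: g_def add_pos_nonneg)
  define A where "A = - (real (card H) * (1 / g) + real (card K) / (cos \<theta>)^2)"
  have "(1 / g) *\<^sub>R (\<Sum>e\<in>H. D2 x e e) = A *\<^sub>R F x"
    using m[unfolded mean_curvature_frame_iff[OF t x f]] vertical_hessian_trace[OF assms]
    unfolding A_def g_def by simp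
  then have "g *\<^sub>R (1 / g) *\<^sub>R (\<Sum>e\<in>H. D2 x e e) = g *\<^sub>R A *\<^sub>R F x" by (rule arg_cong)
  then have eq: "(\<Sum>e\<in>H. D2 x e e) = (g * A) *\<^sub>R F x" using g by simp
  have "g * A = - (real (card H) * lam^2)"
    using horizontal_trace_inner[OF x f] unit[OF x0] unfolding eq by (simp add: norm_eq_1)
  then show ?thesis unfolding eq by simp
qed

text \<open>The flat Laplacian of the extension agrees with the spherical one here: first
  derivatives have degree -1, so by Euler's relation the second radial derivative is minus the
  first, which is 0.\<close>

lemma laplacian_eigen_unit:
  assumes fr: "\<And>x. norm x = 1 \<Longrightarrow> \<exists>H K. frame lam x H K \<and> card H = p" and lam: "lam > 0"
    and t: "\<theta> \<in> {0<..<pi/2}" and LO: "LO_sphere F \<theta>" and x: "norm x = 1"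
  shows "(\<Sum>b\<in>Basis. D2 x b b) = - (real p * lam^2) *\<^sub>R F x"
proof -
  have x0: "x \<noteq> 0" using x by auto
  note xU = nonzero_unit[OF x]
  obtain H K where f: "frame lam x H K" and p: "card H = p" using fr[OF x] by blast
  have fr': "\<exists>H K. frame lam x H K" if "norm x = 1" for x using fr[OF that] by blast
  have m: "mean_curvature_vector (sphere 0 1) (LO_set F \<theta>) (\<Psi> \<theta> x) = 0"
    using LO x unfolding LO_sphere_iff[OF t] by blast
  have onb: "orthonormal_basis_of {v. x \<bullet> v = 0} (H \<union> K)" and disj: "H \<inter> K = {}"
    using f by (auto simp: frame_def)
  note fin = frame_finite[OF f x]
  note ins = orthonormal_basis_of_insert_normal[OF x onb]
  have "(\<Sum>b\<in>Basis. D2 x b b) = (\<Sum>e\<in>insert x (H \<union> K). D2 x e e)"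
    by (rule trace_orthonormal_basis_eq[OF dd_dd_linear_left[OF smooth xU] dd_dd_linear_right[OF smooth xU]
        orthonormal_basis_of_Basis ins(1)])
  also have "\<dots> = D2 x x x + ((\<Sum>e\<in>H. D2 x e e) + (\<Sum>e\<in>K. D2 x e e))"
    using ins(2) fin disj by (simp add: sum.union_disjoint)
  also have "D2 x x x = 0"
    using homog_euler[OF smooth_on_dd[OF smooth] homog_dd[OF smooth hom] x0, of x] dF_radial[OF x0] by simp
  finally show ?thesis
    using hessian_traces[OF fr' x lam f t m] vertical_hessian_trace[OF fr' x lam f t m] p by simp
qed

text \<open>The traces are obtained from \<theta>' but their values are free of it. At any other
  angle both sides of the system are therefore multiples of \<open>F x\<close>, and only the scalar
  relation is left to check.\<close>

lemma LO_sphere_iff_relation: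
  assumes fr: "\<And>x. norm x = 1 \<Longrightarrow> \<exists>H K. frame lam x H K \<and> card H = p" and lam: "lam > 0"
    and t0: "\<theta>' \<in> {0<..<pi/2}" and LO: "LO_sphere F \<theta>'" and t: "\<theta> \<in> {0<..<pi/2}"
  shows "LO_sphere F \<theta> \<longleftrightarrow> real p * lam^2 = real (DIM('a) - 1) * ((cos \<theta>)^2 + (sin \<theta>)^2 * lam^2)"
proof
  assume L: "LO_sphere F \<theta>"
  obtain x :: 'a where x: "norm x = 1" using vector_choose_size[of 1] by auto
  obtain H K where f: "frame lam x H K" and p: "card H = p" using fr[OF x] by blast
  show "real p * lam^2 = real (DIM('a) - 1) * ((cos \<theta>)^2 + (sin \<theta>)^2 * lam^2)"
    using minimal_relation[OF t x f] L x frame_card[OF f x] p unfolding LO_sphere_iff[OF t]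
    by (simp flip: of_nat_add)
next
  assume r: "real p * lam^2 = real (DIM('a) - 1) * ((cos \<theta>)^2 + (sin \<theta>)^2 * lam^2)"
  have fr': "\<exists>H K. frame lam x H K" if "norm x = 1" for x using fr[OF that] by blast
  have c: "(cos \<theta>)^2 > 0" using t cos_gt_zero_pi[of \<theta>] by simp
  define g where "g = (cos \<theta>)^2 + (sin \<theta>)^2 * lam^2"
  have g: "g > 0" using c by (simp add: g_def add_pos_nonneg)
  show "LO_sphere F \<theta>"
    unfolding LO_sphere_iff[OF t]
  proof (intro allI impI)
    fix x :: 'a assume x: "norm x = 1"
    obtain H K where f: "frame lam x H K" and p: "card H = p" using fr[OF x] by blast
    have m: "mean_curvature_vector (sphere 0 1) (LO_set F \<theta>') (\<Psi> \<theta>' x) = 0"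
      using LO x unfolding LO_sphere_iff[OF t0] by blast
    \<comment> \<open>From here the computation of \<open>minimal_relation\<close> runs backwards,
      from the scalar relation to the coefficient of \<open>F x\<close>.\<close>
    have "real p * lam^2 = (real p + real (card K)) * g"
      using r frame_card[OF f x] p unfolding g_def by (simp flip: of_nat_add)
    moreover have "lam^2 * (sin \<theta>)^2 = g - (cos \<theta>)^2" by (simp add: g_def)
    then have "lam^2 - lam^2 * (cos \<theta>)^2 = g - (cos \<theta>)^2" by (simp add: sin_squared_eq right_diff_distrib)
    then have "real p * (lam^2 - lam^2 * (cos \<theta>)^2) = real p * (g - (cos \<theta>)^2)" by simp
    ultimately have "real p * lam^2 * (cos \<theta>)^2 = real p * (cos \<theta>)^2 + real (card K) * g"
      unfolding right_diff_distrib distrib_right mult.assoc by linarith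
    then have "real p * lam^2 * (cos \<theta>)^2 / (g * (cos \<theta>)^2)
        = (real p * (cos \<theta>)^2 + real (card K) * g) / (g * (cos \<theta>)^2)" by simp
    then have "real p * lam^2 * (1 / g) = real p * (1 / g) + real (card K) / (cos \<theta>)^2"
      using g c by (simp add: add_divide_distrib)
    then have "- (real p * (1 / g) + real (card K) / (cos \<theta>)^2) = (1 / g) * (- (real p * lam^2))" by simp
    moreover have "(\<Sum>e\<in>K. D2 x e e) = 0" by (rule vertical_hessian_trace[OF fr' x lam f t0 m])
    moreover have "(\<Sum>e\<in>H. D2 x e e) = - (real p * lam^2) *\<^sub>R F x"
      using hessian_traces[OF fr' x lam f t0 m] p by simp
    ultimately show "mean_curvature_vector (sphere 0 1) (LO_set F \<theta>) (\<Psi> \<theta> x) = 0"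
      unfolding mean_curvature_frame_iff[OF t x f] p g_def[symmetric] by (simp only: scaleR_scaleR scaleR_zero_right add_0_right)
  qed
qed

end

section \<open>Homogeneous harmonic functions\<close>

lemma laplacian_cong:
  assumes "open U" "x \<in> U" "\<And>y. y \<in> U \<Longrightarrow> f y = g y"
  shows "laplacian f x = laplacian g x"
proof -
  have "dd b (dd b f) x = dd b (dd b g) x" for b
  proof -
    have "frechet_derivative (dd b f) (at x) = frechet_derivative (dd b g) (at x)"
      by (rule frechet_derivative_cong_open[OF assms(1,2)])
        (rule fun_cong[OF frechet_derivative_cong_open[OF assms(1) _ assms(3)]])
    then show ?thesis by (rule fun_cong)
  qed
  then show ?thesis by (simp add: laplacian_def)
qed

lemma dd_add:
  assumes "smooth_on_open U f" "smooth_on_open U g" "x \<in> U"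
  shows "dd v (\<lambda>y. f y + g y) x = dd v f x + dd v g x"
  using dd_eqI[OF has_derivative_add[OF smooth_on_has_derivative[OF assms(1,3)] smooth_on_has_derivative[OF assms(2,3)]]] .

lemma dd_mult:
  fixes f g :: "'a::euclidean_space \<Rightarrow> real"
  assumes "smooth_on_open U f" "smooth_on_open U g" "x \<in> U"
  shows "dd v (\<lambda>y. f y * g y) x = f x * dd v g x + dd v f x * g x"
  using dd_eqI[OF has_derivative_mult[OF smooth_on_has_derivative[OF assms(1,3)] smooth_on_has_derivative[OF assms(2,3)]]] .

lemma dd_sum:
  assumes "\<And>i. i \<in> I \<Longrightarrow> smooth_on_open U (f i)" "x \<in> U"
  shows "dd v (\<lambda>y. \<Sum>i\<in>I. f i y) x = (\<Sum>i\<in>I. dd v (f i) x)"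
  using dd_eqI[OF has_derivative_sum[OF smooth_on_has_derivative[OF assms(1) assms(2)]]] .

lemma dd_dd_mult:
  fixes f g :: "'a::euclidean_space \<Rightarrow> real"
  assumes f: "smooth_on_open U f" and g: "smooth_on_open U g" and x: "x \<in> U"
  shows "dd v (dd v (\<lambda>y. f y * g y)) x = f x * dd v (dd v g) x + 2 * dd v f x * dd v g x + dd v (dd v f) x * g x"
proof -
  have "frechet_derivative (dd v (\<lambda>y. f y * g y)) (at x)
    = frechet_derivative (\<lambda>y. f y * dd v g y + dd v f y * g y) (at x)"
    by (rule frechet_derivative_cong_open[OF smooth_on_open_open[OF f] x]) (rule dd_mult[OF f g])
  moreover have "dd v (\<lambda>y. f y * dd v g y + dd v f y * g y) x
    = dd v (\<lambda>y. f y * dd v g y) x + dd v (\<lambda>y. dd v f y * g y) x"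
    by (intro dd_add[where U=U] smooth_on_mult smooth_on_dd f g x)
  ultimately have "dd v (dd v (\<lambda>y. f y * g y)) x = dd v (\<lambda>y. f y * dd v g y) x + dd v (\<lambda>y. dd v f y * g y) x"
    by simp
  then show ?thesis
    by (simp add: dd_mult[OF f smooth_on_dd[OF g] x] dd_mult[OF smooth_on_dd[OF f] g x])
qed

lemma laplacian_mult:
  fixes f g :: "'a::euclidean_space \<Rightarrow> real"
  assumes f: "smooth_on_open U f" and g: "smooth_on_open U g" and x: "x \<in> U"
  shows "laplacian (\<lambda>y. f y * g y) x
    = f x * laplacian g x + 2 * (\<Sum>b\<in>Basis. dd b f x * dd b g x) + laplacian f x * g x"
  unfolding laplacian_def dd_dd_mult[OF assms]
  by (simp add: sum.distrib sum_distrib_left sum_distrib_right mult.assoc)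

lemma dd_dd_sum:
  assumes f: "\<And>i. i \<in> I \<Longrightarrow> smooth_on_open U (f i)" and U: "open U" "x \<in> U"
  shows "dd v (dd v (\<lambda>y. \<Sum>i\<in>I. f i y)) x = (\<Sum>i\<in>I. dd v (dd v (f i)) x)"
proof -
  have "frechet_derivative (dd v (\<lambda>y. \<Sum>i\<in>I. f i y)) (at x)
    = frechet_derivative (\<lambda>y. \<Sum>i\<in>I. dd v (f i) y) (at x)"
    by (rule frechet_derivative_cong_open[OF U]) (rule dd_sum[OF f])
  then have "dd v (dd v (\<lambda>y. \<Sum>i\<in>I. f i y)) x = dd v (\<lambda>y. \<Sum>i\<in>I. dd v (f i) y) x" by (rule fun_cong)
  also have "\<dots> = (\<Sum>i\<in>I. dd v (dd v (f i)) x)" by (rule dd_sum[OF smooth_on_dd[OF f] U(2)])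
  finally show ?thesis .
qed

lemma laplacian_sum:
  assumes f: "\<And>i. i \<in> I \<Longrightarrow> smooth_on_open U (f i)" and U: "open U" "x \<in> U"
  shows "laplacian (\<lambda>y. \<Sum>i\<in>I. f i y) x = (\<Sum>i\<in>I. laplacian (f i) x)"
proof -
  have "dd b (dd b (\<lambda>y. \<Sum>i\<in>I. f i y)) x = (\<Sum>i\<in>I. dd b (dd b (f i)) x)" for b
    by (rule dd_dd_sum[OF f U])
  then show ?thesis unfolding laplacian_def by (simp add: sum.swap[of _ I])
qed

lemma smooth_on_laplacian: "smooth_on_open U f \<Longrightarrow> smooth_on_open U (laplacian f)"
  unfolding laplacian_def[abs_def] by (intro smooth_on_sum smooth_on_dd) (auto simp: smooth_on_open_open)

lemma laplacian_dd:
  assumes f: "smooth_on_open U f" and x: "x \<in> U"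
  shows "laplacian (dd v f) x = dd v (laplacian f) x"
proof -
  note op = smooth_on_open_open[OF f]
  have "dd b (dd b (dd v f)) x = dd v (dd b (dd b f)) x" for b
  proof -
    have "frechet_derivative (dd b (dd v f)) (at x) = frechet_derivative (dd v (dd b f)) (at x)"
      by (rule frechet_derivative_cong_open[OF op x]) (rule dd_commute[OF f])
    then have "dd b (dd b (dd v f)) x = dd b (dd v (dd b f)) x" by (rule fun_cong)
    also have "\<dots> = dd v (dd b (dd b f)) x" by (rule dd_commute[OF smooth_on_dd[OF f] x])
    finally show ?thesis .
  qed
  then show ?thesis unfolding laplacian_def
    using dd_sum[of Basis U "\<lambda>b. dd b (dd b f)" x v] smooth_on_dd[OF smooth_on_dd[OF f]] x by simp
qed

lemma laplacian_norm_powr: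
  assumes x: "(x::'a::euclidean_space) \<noteq> 0"
  shows "laplacian (\<lambda>x. norm x powr \<gamma>) x = \<gamma> * (\<gamma> + real DIM('a) - 2) * norm x powr (\<gamma> - 2)"
proof -
  have dd2: "dd b (dd b (\<lambda>x::'a. norm x powr \<gamma>)) x
     = \<gamma> * norm x powr (\<gamma> - 2) + \<gamma> * (\<gamma> - 2) * norm x powr (\<gamma> - 4) * (x \<bullet> b)^2" if "b \<in> Basis" for b
  proof -
    have "frechet_derivative (dd b (\<lambda>x::'a. norm x powr \<gamma>)) (at x)
       = frechet_derivative (\<lambda>x. \<gamma> * norm x powr (\<gamma> - 2) * (x \<bullet> b)) (at x)"
      by (rule frechet_derivative_cong_open[OF open_nonzero]) (use x in \<open>auto simp: dd_norm_powr\<close>)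
    moreover have "((\<lambda>x::'a. \<gamma> * norm x powr (\<gamma> - 2) * (x \<bullet> b)) has_derivative
       (\<lambda>h. \<gamma> * norm x powr (\<gamma> - 2) * (h \<bullet> b)
          + (\<gamma> * ((\<gamma> - 2) * norm x powr (\<gamma> - 2 - 2) * (x \<bullet> h))) * (x \<bullet> b))) (at x)"
      by (intro has_derivative_mult has_derivative_mult_right has_derivative_norm_powr x
          has_derivative_inner_left has_derivative_ident)
    ultimately show ?thesis using that
      by (simp add: dd_eqI power2_eq_square)
  qed
  have "laplacian (\<lambda>x::'a. norm x powr \<gamma>) x
     = (\<Sum>b\<in>Basis. \<gamma> * norm x powr (\<gamma> - 2) + \<gamma> * (\<gamma> - 2) * norm x powr (\<gamma> - 4) * (x \<bullet> b)^2)"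
    unfolding laplacian_def by (intro sum.cong refl dd2)
  also have "\<dots> = real DIM('a) * (\<gamma> * norm x powr (\<gamma> - 2)) + \<gamma> * (\<gamma> - 2) * (norm x powr (\<gamma> - 4) * (\<Sum>b\<in>Basis. (x \<bullet> b)^2))"
    by (simp add: sum.distrib sum_distrib_left mult.assoc)
  also have "(\<Sum>b\<in>Basis. (x \<bullet> b)^2) = norm x powr 2"
    using x by (simp add: euclidean_inner[of x x] power2_eq_square powr_numeral norm_eq_sqrt_inner sum_nonneg)
  also have "norm x powr (\<gamma> - 4) * norm x powr 2 = norm x powr (\<gamma> - 2)"
    unfolding powr_add[symmetric] by simp
  finally show ?thesis by (simp add: algebra_simps)
qed

text \<open>Along the line the first derivative vanishes at the maximum. A positive second
  derivative would make it positive just afterwards, and the mean value theorem would lift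
  \<open>w\<close> above its maximum.\<close>

lemma second_derivative_at_max:
  fixes w :: "'a::euclidean_space \<Rightarrow> real"
  assumes w: "smooth_on_open U w" and x: "x \<in> U" and max: "\<And>y. y \<in> U \<Longrightarrow> w y \<le> w x"
  shows "dd v (dd v w) x \<le> 0"
proof (rule ccontr)
  assume neg: "\<not> ?thesis"
  have "open ((\<lambda>t. x + t *\<^sub>R v) -` U)"
    by (intro open_vimage smooth_on_open_open[OF w] continuous_intros)
  moreover have "0 \<in> (\<lambda>t. x + t *\<^sub>R v) -` U" using x by simp
  ultimately obtain \<epsilon> where \<epsilon>: "\<epsilon> > 0" "ball 0 \<epsilon> \<subseteq> (\<lambda>t. x + t *\<^sub>R v) -` U"
    using open_contains_ball by blast
  then have inU: "x + t *\<^sub>R v \<in> U" if "\<bar>t\<bar> < \<epsilon>" for t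
    using that by (auto simp: subset_iff)
  have x0: "x + 0 *\<^sub>R v \<in> U" using x by simp
  have d0: "dd v w (x + 0 *\<^sub>R v) = 0"
    by (rule DERIV_local_max[OF has_real_derivative_along_line[OF w x0] \<epsilon>(1)]) (use inU max in auto)
  obtain d where d: "d > 0" "\<forall>h>0. h < d \<longrightarrow> dd v w (x + 0 *\<^sub>R v) < dd v w (x + (0 + h) *\<^sub>R v)"
    using DERIV_pos_inc_right[OF has_real_derivative_along_line[OF smooth_on_dd[OF w] x0], of v] neg by auto
  define h where "h = min d \<epsilon> / 2"
  have h: "h > 0" "h < d" "h < \<epsilon>" using d \<epsilon> by (auto simp: h_def)
  have "\<exists>z. 0 < z \<and> z < h \<and> w (x + h *\<^sub>R v) - w (x + 0 *\<^sub>R v) = (h - 0) * dd v w (x + z *\<^sub>R v)"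
    using h by (intro MVT2 has_real_derivative_along_line[OF w] inU) auto
  then obtain z where z: "0 < z" "z < h" "w (x + h *\<^sub>R v) - w x = h * dd v w (x + z *\<^sub>R v)" by auto
  have "dd v w (x + z *\<^sub>R v) > 0" using d(2)[rule_format, of z] z h d0 by simp
  then have "w (x + h *\<^sub>R v) > w x" using z(3) h(1) by (metis diff_gt_0_iff_gt mult_pos_pos)
  then show False using max[OF inU[of h]] h by simp
qed

section \<open>Bochner's formula and the vanishing of gradients in low degree\<close>

definition grad_sq :: "('a::euclidean_space \<Rightarrow> real) \<Rightarrow> 'a \<Rightarrow> real" where
  "grad_sq u x = (\<Sum>b\<in>Basis. dd b u x * dd b u x)"

definition hess_sq :: "('a::euclidean_space \<Rightarrow> real) \<Rightarrow> 'a \<Rightarrow> real" where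
  "hess_sq u x = (\<Sum>b\<in>Basis. \<Sum>c\<in>Basis. (dd c (dd b u) x)^2)"

lemma smooth_on_grad_sq: "smooth_on_open U u \<Longrightarrow> smooth_on_open U (grad_sq u)"
  unfolding grad_sq_def[abs_def]
  by (intro smooth_on_sum smooth_on_mult smooth_on_dd) (auto simp: smooth_on_open_open)

text \<open>Bochner's formula in flat space; partial derivatives of a harmonic function are
  harmonic, so only the Hessian survives.\<close>

lemma laplacian_grad_sq:
  assumes u: "smooth_on_open U u" and harm: "\<And>y. y \<in> U \<Longrightarrow> laplacian u y = 0" and x: "x \<in> U"
  shows "laplacian (grad_sq u) x = 2 * hess_sq u x"
proof -
  note op = smooth_on_open_open[OF u]
  have "laplacian (dd b u) x = 0" for b
  proof -
    have "frechet_derivative (laplacian u) (at x) = frechet_derivative (\<lambda>_. 0) (at x)"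
      by (rule frechet_derivative_cong_open[OF op x]) (use harm in auto)
    then have "dd b (laplacian u) x = dd b (\<lambda>_. 0) x" by (rule fun_cong)
    then show ?thesis by (simp add: laplacian_dd[OF u x])
  qed
  then have "laplacian (\<lambda>x. dd b u x * dd b u x) x = 2 * (\<Sum>c\<in>Basis. (dd c (dd b u) x)^2)" for b
    using laplacian_mult[OF smooth_on_dd[OF u] smooth_on_dd[OF u] x, of b b] by (simp add: power2_eq_square)
  moreover have "laplacian (grad_sq u) x = (\<Sum>b\<in>Basis. laplacian (\<lambda>x. dd b u x * dd b u x) x)"
    unfolding grad_sq_def[abs_def] by (intro laplacian_sum[where U=U] smooth_on_mult smooth_on_dd u op x)
  ultimately show ?thesis by (simp add: hess_sq_def sum_distrib_left)
qed

text \<open>By Euler's relation the Hessian maps \<open>x\<close> to \<open>\<beta> - 1\<close>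
  times the gradient, and Cauchy-Schwarz in each row gives the first bound. In degree 0 the gradient
  is orthogonal to \<open>x\<close>, so the radial row and the radial column contribute separately.
  The doubled bound is essential in dimension 3, where the first one would leave a zero coefficient
  in the gradient estimate.\<close>

lemma hess_sq_bounds:
  assumes u: "smooth_on_open (- {0}) u" and h: "homog \<beta> u" and x: "norm (x::'a::euclidean_space) = 1"
  shows hess_sq_radial_bound: "(\<beta> - 1)^2 * grad_sq u x \<le> hess_sq u x"
    and hess_sq_degree_0_bound: "\<beta> = 0 \<Longrightarrow> 2 * grad_sq u x \<le> hess_sq u x"
proof -
  have x0: "x \<noteq> 0" and xU: "x \<in> - {0}" using x by auto
  have xx: "x \<bullet> x = 1" using x by (simp add: norm_eq_1)
  \<comment> \<open>\<open>G\<close> is the gradient and \<open>g b\<close> the row of the Hessian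
    belonging to \<open>b\<close>.\<close>
  define G where "G = (\<Sum>b\<in>Basis. dd b u x *\<^sub>R b)"
  define g where "g b = (\<Sum>c\<in>Basis. dd c (dd b u) x *\<^sub>R c)" for b
  have G: "G \<bullet> v = dd v u x" for v
    using linear_eq_sum_Basis[OF smooth_on_linear_dd[OF u xU], of v]
    by (simp add: G_def inner_sum_left mult.commute inner_commute[of v])
  have gv: "g b \<bullet> v = dd v (dd b u) x" for b v
    using linear_eq_sum_Basis[OF dd_dd_linear_left[OF u xU], of b v]
    by (simp add: g_def inner_sum_left mult.commute inner_commute[of v])
  have gx: "g b \<bullet> x = (\<beta> - 1) * dd b u x" for b
    unfolding gv using homog_euler[OF smooth_on_dd[OF u] homog_dd[OF u h] x0, of b] by simp
  have Q: "hess_sq u x = (\<Sum>b\<in>Basis. (norm (g b))^2)"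
  proof -
    have "(norm (g b))^2 = (\<Sum>c\<in>Basis. (dd c (dd b u) x)^2)" for b
    proof -
      have "(norm (g b))^2 = (\<Sum>c\<in>Basis. (g b \<bullet> c) * (g b \<bullet> c))"
        unfolding power2_norm_eq_inner by (rule euclidean_inner)
      then show ?thesis by (simp add: gv power2_eq_square)
    qed
    then show ?thesis by (simp add: hess_sq_def)
  qed
  have E: "grad_sq u x = G \<bullet> G"
    unfolding grad_sq_def euclidean_inner[of G G] by (simp add: G)
  have "(\<beta> - 1)^2 * (dd b u x * dd b u x) \<le> (norm (g b))^2" for b
  proof -
    have "\<bar>g b \<bullet> x\<bar> \<le> norm (g b)" using Cauchy_Schwarz_ineq2[of "g b" x] x by simp
    then have "(g b \<bullet> x)^2 \<le> (norm (g b))^2" by (metis abs_ge_zero power2_abs power_mono)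
    then show ?thesis by (simp add: gx power_mult_distrib power2_eq_square[of "dd b u x"])
  qed
  then show "(\<beta> - 1)^2 * grad_sq u x \<le> hess_sq u x"
    unfolding Q grad_sq_def sum_distrib_left by (intro sum_mono)
  assume \<beta>: "\<beta> = 0"
  have xG: "G \<bullet> x = 0" unfolding G using homog_euler[OF u h x0] \<beta> by simp
  have "(\<Sum>b\<in>Basis. (x \<bullet> b) * (g b \<bullet> G)) = dd x (dd G u) x"
    using linear_eq_sum_Basis[OF dd_dd_linear_left[OF u xU], of G x]
    by (simp add: gv dd_commute[OF u xU, of G])
  also have "\<dots> = - (G \<bullet> G)"
    using homog_euler[OF smooth_on_dd[OF u] homog_dd[OF u h] x0, of G] \<beta> by (simp add: G)
  finally have cross: "(\<Sum>b\<in>Basis. (x \<bullet> b) * (g b \<bullet> G)) = - (G \<bullet> G)" .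
  \<comment> \<open>These are the rows of the Hessian after cancelling its mixed radial part, which
    is minus the symmetrised product of \<open>x\<close> and \<open>G\<close>.\<close>
  have "(norm (g b + dd b u x *\<^sub>R x + (x \<bullet> b) *\<^sub>R G))^2
     = (norm (g b))^2 - dd b u x * dd b u x + (x \<bullet> b) * (x \<bullet> b) * (G \<bullet> G) + 2 * ((x \<bullet> b) * (g b \<bullet> G))" for b
    using gx[of b] xG \<beta> xx
    by (simp add: power2_norm_eq_inner inner_add_left inner_add_right inner_commute[of x "g b"] inner_commute[of x G]
        inner_commute[of G "g b"] algebra_simps)
  then have "(\<Sum>b\<in>Basis. (norm (g b + dd b u x *\<^sub>R x + (x \<bullet> b) *\<^sub>R G))^2)
     = hess_sq u x - grad_sq u x + (\<Sum>b\<in>Basis. (x \<bullet> b) * (x \<bullet> b)) * (G \<bullet> G)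
        + 2 * (\<Sum>b\<in>Basis. (x \<bullet> b) * (g b \<bullet> G))"
    by (simp add: Q grad_sq_def sum.distrib sum_subtractf sum_distrib_left sum_distrib_right)
  moreover have "(\<Sum>b\<in>Basis. (norm (g b + dd b u x *\<^sub>R x + (x \<bullet> b) *\<^sub>R G))^2) \<ge> 0" by (intro sum_nonneg) simp
  moreover have "(\<Sum>b\<in>Basis. (x \<bullet> b) * (x \<bullet> b)) = 1" using xx euclidean_inner[of x x] by simp
  ultimately show "2 * grad_sq u x \<le> hess_sq u x" unfolding cross by (simp add: E)
qed

lemma homog_grad_sq:
  assumes u: "smooth_on_open (- {0}) u" and h: "homog \<beta> u"
  shows "homog (2 * \<beta> - 2) (grad_sq u)"
proof -
  have "dd b u (t *\<^sub>R x) = t powr (\<beta> - 1) * dd b u x" if "t > 0" "x \<noteq> 0" for b t x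
    using homogD[OF homog_dd[OF u h] that, of b] by simp
  moreover have "t powr (\<beta> - 1) * t powr (\<beta> - 1) = t powr (2 * \<beta> - 2)" for t :: real
    by (simp flip: powr_add) 
  ultimately show ?thesis
    by (simp add: homog_def grad_sq_def sum_distrib_left mult.assoc mult.left_commute[of "dd _ _ _" "_ powr _"]
        mult.assoc[symmetric, of "_ powr _" "_ powr _"])
qed

text \<open>The power of the norm makes \<open>w\<close> constant along rays, so its maximum over
  the sphere is an interior maximum over the punctured space and \<open>laplacian w\<close> is
  nonpositive there. Bochner's formula and the Hessian bounds turn this into a positive multiple of
  the squared gradient being nonpositive.\<close>

lemma homog_harmonic_gradient_zero:
  fixes u :: "'a::euclidean_space \<Rightarrow> real"
  assumes u: "smooth_on_open (- {0}) u" and h: "homog \<beta> u" and \<beta>: "0 \<le> \<beta>" "\<beta> < 1"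
    and harm: "\<And>y. y \<noteq> 0 \<Longrightarrow> laplacian u y = 0" and dim: "DIM('a) \<ge> 3" and x: "x \<noteq> 0"
  shows "dd v u x = 0"
proof -
  define \<gamma> where "\<gamma> = 2 - 2 * \<beta>"
  have \<gamma>: "\<gamma> > 0" using \<beta> by (simp add: \<gamma>_def)
  define w where "w y = norm y powr \<gamma> * grad_sq u y" for y
  note smE = smooth_on_grad_sq[OF u]
  have sw: "smooth_on_open (- {0}) w"
    unfolding w_def[abs_def] by (intro smooth_on_mult smooth_on_norm_powr smE)
  note hE = homog_grad_sq[OF u h]
  have w_sgn: "w y = w (sgn y)" if y: "y \<noteq> 0" for y
  proof -
    have "grad_sq u y = norm y powr (2 * \<beta> - 2) * grad_sq u (sgn y)" using homog_sgn[OF hE y] by simp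
    then have "w y = (norm y powr \<gamma> * norm y powr (2 * \<beta> - 2)) * grad_sq u (sgn y)" by (simp add: w_def)
    also have "norm y powr \<gamma> * norm y powr (2 * \<beta> - 2) = 1" using y by (simp add: \<gamma>_def flip: powr_add)
    finally show ?thesis using y by (simp add: w_def norm_sgn)
  qed
  have ne: "sphere 0 1 \<noteq> ({} :: 'a set)" by simp
  have "continuous_on (sphere 0 1) w"
    by (rule continuous_on_subset[OF smooth_on_continuous[OF sw]]) auto
  then obtain z where z: "norm z = 1" "\<And>y. norm y = 1 \<Longrightarrow> w y \<le> w z"
    using continuous_attains_sup[OF compact_sphere ne] by (metis mem_sphere_0)
  have zU: "z \<in> - {0}" and z0: "z \<noteq> 0" using z(1) by auto
  have max: "w y \<le> w z" if "y \<in> - {0}" for y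
    using w_sgn[of y] z(2)[of "sgn y"] that by (simp add: norm_sgn)
  define D where "D = real DIM('a)"
  have D: "D \<ge> 3" using dim by (simp add: D_def)
  define E where "E = grad_sq u z"
  have E0: "E \<ge> 0" unfolding E_def grad_sq_def by (intro sum_nonneg) simp
  have "laplacian w z \<le> 0"
    unfolding laplacian_def using second_derivative_at_max[OF sw zU max] by (intro sum_nonpos)
  moreover have "laplacian w z = 2 * hess_sq u z + 2 * \<gamma> * dd z (grad_sq u) z + \<gamma> * (\<gamma> + D - 2) * E"
  proof -
    have "(\<Sum>b\<in>Basis. dd b (\<lambda>x. norm x powr \<gamma>) z * dd b (grad_sq u) z) = \<gamma> * dd z (grad_sq u) z"
      using z(1) linear_eq_sum_Basis[OF smooth_on_linear_dd[OF smE zU], of z]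
      by (simp add: dd_norm_powr[OF z0] sum_distrib_left mult.assoc)
    then show ?thesis
      unfolding w_def[abs_def] laplacian_mult[OF smooth_on_norm_powr smE zU]
      using laplacian_grad_sq[OF u _ zU] harm z(1) laplacian_norm_powr[OF z0, of \<gamma>]
      by (simp add: D_def E_def)
  qed
  moreover have "dd z (grad_sq u) z = - \<gamma> * E"
    using homog_euler[OF smE hE z0] by (simp add: E_def \<gamma>_def)
  ultimately have le: "2 * hess_sq u z + \<gamma> * (D - 2 - \<gamma>) * E \<le> 0" by (simp add: algebra_simps)
  have "E = 0"
  proof (cases "\<beta> = 0")
    case True
    then have "2 * E \<le> hess_sq u z" using hess_sq_degree_0_bound[OF u h z(1)] by (simp add: E_def)
    then have "4 * E + 2 * (D - 4) * E \<le> 0" using le True by (simp add: \<gamma>_def)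
    then have "(2 * D - 4) * E \<le> 0" by (simp add: algebra_simps)
    moreover have "2 * D - 4 > 0" using D by simp
    ultimately show ?thesis using E0 by (simp add: mult_le_0_iff)
  next
    case False
    \<comment> \<open>Here \<gamma> is twice \<open>1 - \<beta>\<close>, so the Hessian bound adds
      \<open>\<gamma> * (1 - \<beta>) * E\<close>, and the total coefficient is
      \<open>\<gamma> * (D - 3 + \<beta>)\<close>, positive because \<beta> is.\<close>
    have "(\<beta> - 1)^2 * E \<le> hess_sq u z" using hess_sq_radial_bound[OF u h z(1)] by (simp add: E_def)
    then have "2 * (\<beta> - 1)^2 * E + \<gamma> * (D - 2 - \<gamma>) * E \<le> 0" using le by simp
    moreover have "2 * (\<beta> - 1)^2 * E + \<gamma> * (D - 2 - \<gamma>) * E = \<gamma> * (D - 3 + \<beta>) * E"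
      by (simp add: \<gamma>_def power2_eq_square algebra_simps)
    ultimately have "\<gamma> * (D - 3 + \<beta>) * E \<le> 0" by simp
    moreover have "\<gamma> * (D - 3 + \<beta>) > 0" using \<gamma> D \<beta> False by simp
    ultimately show ?thesis using E0 by (metis less_eq_real_def mult_pos_pos not_less)
  qed
  then have "w z = 0" by (simp add: w_def E_def)
  have "norm x powr \<gamma> * grad_sq u x \<le> 0"
    using max[of x] x unfolding \<open>w z = 0\<close> by (simp add: w_def)
  moreover have "norm x powr \<gamma> > 0" using x by simp
  ultimately have "grad_sq u x \<le> 0" by (metis mult_pos_pos not_less)
  then have "(\<Sum>b\<in>Basis. dd b u x * dd b u x) = 0"
    unfolding grad_sq_def by (intro antisym sum_nonneg) auto
  then have "\<forall>b\<in>Basis. dd b u x * dd b u x = 0"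
    by (subst (asm) sum_nonneg_eq_0_iff) auto
  then show ?thesis
    using linear_eq_sum_Basis[OF smooth_on_linear_dd[OF u], of x v] x by simp
qed

lemma constant_of_dd_zero:
  fixes u :: "'a::euclidean_space \<Rightarrow> 'b::euclidean_space"
  assumes u: "smooth_on_open (- {0}) u" and dim: "DIM('a) \<ge> 2"
    and z: "\<And>x v. x \<noteq> 0 \<Longrightarrow> dd v u x = 0"
  obtains c where "\<And>x. x \<noteq> 0 \<Longrightarrow> u x = c"
proof -
  have "connected (- {0 :: 'a})" using connected_punctured_universe[OF dim] .
  moreover have "(u has_derivative (\<lambda>v. 0)) (at x within - {0})" if "x \<in> - {0}" for x
  proof -
    have "frechet_derivative u (at x) = (\<lambda>v. 0)" using z that by auto
    with smooth_on_has_derivative[OF u that] show ?thesis by (simp add: has_derivative_at_withinI)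
  qed
  ultimately have "u constant_on - {0}"
    using open_nonzero smooth_on_continuous[OF u]
    by (intro has_derivative_zero_connected_constant_on[of _ "{}"]) auto
  then show ?thesis using that unfolding constant_on_def by auto
qed

text \<open>The first alternative cannot be absorbed: the zero function is homogeneous of every real
  degree and says nothing about \<alpha>. The induction runs on a bound \<open>N\<close> of the
  degree, which each differentiation lowers by 1.\<close>

lemma homog_harmonic_imp_polynomial:
  fixes u :: "'a::euclidean_space \<Rightarrow> real"
  assumes "smooth_on_open (- {0}) u" "homog \<alpha> u" "0 \<le> \<alpha>"
    and "\<And>y. y \<noteq> 0 \<Longrightarrow> laplacian u y = 0" and dim: "DIM('a) \<ge> 3"
  shows "(\<forall>x. x \<noteq> 0 \<longrightarrow> u x = 0) \<or>
    (\<exists>k P. \<alpha> = real k \<and> real_polynomial_function P \<and> (\<forall>t x. P (t *\<^sub>R x) = t ^ k * P x) \<and> (\<forall>x. x \<noteq> 0 \<longrightarrow> P x = u x))"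
proof -
  obtain N :: nat where "\<alpha> < real N" using reals_Archimedean2 by blast
  then show ?thesis using assms(1-4)
  proof (induction N arbitrary: u \<alpha>)
    case 0
    then show ?case by simp
  next
    case (Suc N)
    note u = Suc.prems(2) and h = Suc.prems(3) and harm = Suc.prems(5)
    have euler: "dd x u x = \<alpha> * u x" if "x \<noteq> 0" for x using homog_euler[OF u h that] by simp
    show ?case
    proof (cases "\<alpha> < 1")
      case True
      have z: "dd v u x = 0" if "x \<noteq> 0" for x v
        by (rule homog_harmonic_gradient_zero[OF u h Suc.prems(4) True harm dim that])
      have "DIM('a) \<ge> 2" using dim by simp
      then obtain c where c: "\<And>x. x \<noteq> 0 \<Longrightarrow> u x = c" using constant_of_dd_zero[OF u _ z] by blast
      show ?thesis
      proof (cases "\<alpha> = 0")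
        case True
        have "real_polynomial_function (\<lambda>x::'a. c)" by (rule real_polynomial_function.intros(2))
        then show ?thesis using True c
          by (intro disjI2 exI[of _ 0] exI[of _ "\<lambda>x. c"]) auto
      next
        case False
        \<comment> \<open>For positive degree a vanishing gradient gives \<open>u = 0\<close> by
          Euler's relation.\<close>
        then show ?thesis using euler z by auto
      qed
    next
      case False
      have IH: "(\<forall>x. x \<noteq> 0 \<longrightarrow> dd b u x = 0) \<or>
        (\<exists>k P. \<alpha> - 1 = real k \<and> real_polynomial_function P \<and> (\<forall>t x. P (t *\<^sub>R x) = t ^ k * P x) \<and> (\<forall>x. x \<noteq> 0 \<longrightarrow> P x = dd b u x))" for b
      proof (rule Suc.IH)
        show "laplacian (dd b u) y = 0" if "y \<noteq> 0" for y
        proof -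
          have yU: "y \<in> - {0}" using that by simp
          have "frechet_derivative (laplacian u) (at y) = frechet_derivative (\<lambda>_. 0) (at y)"
            by (rule frechet_derivative_cong_open[OF open_nonzero yU]) (use harm in auto)
          then have "dd b (laplacian u) y = dd b (\<lambda>_. 0) y" by (rule fun_cong)
          then show ?thesis by (simp add: laplacian_dd[OF u yU])
        qed
      qed (use False Suc.prems(1) smooth_on_dd[OF u] homog_dd[OF u h] in auto)
      have eq: "u x = (\<Sum>b\<in>Basis. (x \<bullet> b) * dd b u x) / \<alpha>" if "x \<noteq> 0" for x
        using euler[OF that] linear_eq_sum_Basis[OF smooth_on_linear_dd[OF u], of x x] that False by simp
      show ?thesis
      proof (cases "\<forall>b. \<forall>x. x \<noteq> 0 \<longrightarrow> dd b u x = 0")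
        case True
        then show ?thesis using eq by auto
      next
        case nz: False
        then obtain k where k: "\<alpha> - 1 = real k" using IH by blast
        \<comment> \<open>All nonzero partial derivatives share the exponent \<open>k\<close>, since
          \<alpha> fixes it; the zero ones are assigned the zero polynomial with that same
          exponent.\<close>
        have "\<exists>P. real_polynomial_function P \<and> (\<forall>t x. P (t *\<^sub>R x) = t ^ k * P x) \<and> (\<forall>x. x \<noteq> 0 \<longrightarrow> P x = dd b u x)" for b
        proof (cases "\<forall>x. x \<noteq> 0 \<longrightarrow> dd b u x = 0")
          case True
          then show ?thesis by (intro exI[of _ "\<lambda>x. 0"]) (simp add: real_polynomial_function.intros(2))
        next
          case False
          then obtain k' P where "\<alpha> - 1 = real k'" "real_polynomial_function P" "\<forall>t x. P (t *\<^sub>R x) = t ^ k' * P x"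
            "\<forall>x. x \<noteq> 0 \<longrightarrow> P x = dd b u x" using IH[of b] by blast
          moreover from this have "k' = k" using k by simp
          ultimately show ?thesis by blast
        qed
        then obtain P where P: "\<And>b. real_polynomial_function (P b)" "\<And>b t x. P b (t *\<^sub>R x) = t ^ k * P b x"
          "\<And>b x. x \<noteq> 0 \<Longrightarrow> P b x = dd b u x" by metis
        define Q where "Q x = (\<Sum>b\<in>Basis. ((x \<bullet> b) * P b x) * (1 / \<alpha>))" for x
        have "real_polynomial_function Q"
          unfolding Q_def[abs_def]
          by (intro real_polynomial_function_sum real_polynomial_function.intros(4) real_polynomial_function.intros(2)
              real_polynomial_function.intros(1) bounded_linear_inner_left P) simp
        moreover have "Q (t *\<^sub>R x) = t ^ Suc k * Q x" for t x
          by (simp add: Q_def P(2) sum_distrib_left mult_ac)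
        moreover have "Q x = u x" if "x \<noteq> 0" for x
          unfolding eq[OF that] Q_def by (simp add: P(3)[OF that] sum_divide_distrib)
        moreover have "\<alpha> = real (Suc k)" using k by simp
        ultimately show ?thesis by blast
      qed
    qed
  qed
qed

lemma smooth_on_real_polynomial_function:
  "real_polynomial_function P \<Longrightarrow> smooth_on_open UNIV (P :: 'a::euclidean_space \<Rightarrow> real)"
proof (induction rule: real_polynomial_function.induct)
  case (linear f)
  then show ?case by (simp add: smooth_on_bounded_linear)
qed (auto intro: smooth_on_const smooth_on_add smooth_on_mult)

text \<open>The origin is reached by continuity, as its complement is dense.\<close>

lemma laplacian_polynomial_extension:
  fixes P u :: "'a::euclidean_space \<Rightarrow> real"
  assumes P: "real_polynomial_function P" and eq: "\<And>x. x \<noteq> 0 \<Longrightarrow> P x = u x"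
    and harm: "\<And>y. y \<noteq> 0 \<Longrightarrow> laplacian u y = 0"
  shows "laplacian P x = 0"
proof -
  have 1: "laplacian P y = 0" if "y \<in> - {0}" for y
    using laplacian_cong[OF open_nonzero that, of P u] eq harm that by auto
  have "continuous_on UNIV (laplacian P)"
    by (rule smooth_on_continuous[OF smooth_on_laplacian[OF smooth_on_real_polynomial_function[OF P]]])
  moreover have "closure (- {0}) = (UNIV :: 'a set)"
    by (simp add: closure_complement)
  ultimately show ?thesis
    using continuous_constant_on_closure[of "- {0}" "laplacian P" 0 x] 1 by simp
qed

section \<open>Harmonic extension of the components\<close>

context spherical_map
begin

lemma homog_component: "homog \<alpha> (\<lambda>x. norm x powr \<alpha> * (F x \<bullet> c))"
  using homogD[OF hom] by (simp add: homog_def powr_mult)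

lemma smooth_component: "smooth_on_open (- {0}) (\<lambda>x. norm x powr \<alpha> * (F x \<bullet> c))"
  by (intro smooth_on_mult smooth_on_norm_powr smooth_on_inner smooth smooth_on_const open_nonzero)

text \<open>In the Laplacian of the product the mixed term is a radial derivative of
  \<open>F\<close> and vanishes. The remaining terms are \<alpha> times
  \<open>\<alpha> + DIM('a) - 2\<close>, from the power of the norm, against the eigenvalue
  \<mu>.\<close>

lemma harmonic_component:
  assumes eig: "\<And>x. norm x = 1 \<Longrightarrow> (\<Sum>b\<in>Basis. D2 x b b) = - \<mu> *\<^sub>R F x"
    and \<mu>: "\<mu> = \<alpha> * (\<alpha> + real DIM('a) - 2)" and x: "x \<noteq> 0"
  shows "laplacian (\<lambda>x. norm x powr \<alpha> * (F x \<bullet> c)) x = 0"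
proof -
  have xU: "x \<in> - {0}" using x by simp
  have sg: "smooth_on_open (- {0}) (\<lambda>x. F x \<bullet> c)"
    by (intro smooth_on_inner smooth smooth_on_const open_nonzero)
  have r: "norm x powr \<alpha> * norm x powr - 2 = norm x powr (\<alpha> - 2)" by (simp flip: powr_add)
  have "laplacian (\<lambda>x. F x \<bullet> c) x = (\<Sum>b\<in>Basis. D2 x b b) \<bullet> c"
    by (simp add: laplacian_def dd_dd_inner_right[OF smooth xU] inner_sum_left)
  also have "(\<Sum>b\<in>Basis. D2 x b b) = norm x powr - 2 *\<^sub>R (\<Sum>b\<in>Basis. D2 (sgn x) b b)"
  proof -
    have "D2 x b b = norm x powr - 2 *\<^sub>R D2 (sgn x) b b" for b
      using homog_sgn[OF homog_dd[OF smooth_on_dd[OF smooth] homog_dd[OF smooth hom]] x, of b b] by simp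
    then show ?thesis by (simp add: scaleR_sum_right)
  qed
  also have "(\<Sum>b\<in>Basis. D2 (sgn x) b b) = - \<mu> *\<^sub>R F x"
    using eig[of "sgn x"] homog_sgn[OF hom x] x by (simp add: norm_sgn)
  finally have lap: "laplacian (\<lambda>x. F x \<bullet> c) x = - \<mu> * norm x powr - 2 * (F x \<bullet> c)" by simp
  have "(\<Sum>b\<in>Basis. dd b (\<lambda>x. norm x powr \<alpha>) x * dd b (\<lambda>x. F x \<bullet> c) x)
      = \<alpha> * norm x powr (\<alpha> - 2) * (\<Sum>b\<in>Basis. (x \<bullet> b) * dd b (\<lambda>x. F x \<bullet> c) x)"
    by (simp add: dd_norm_powr[OF x] sum_distrib_left mult.assoc)
  also have "(\<Sum>b\<in>Basis. (x \<bullet> b) * dd b (\<lambda>x. F x \<bullet> c) x) = dd x (\<lambda>x. F x \<bullet> c) x"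
    using linear_eq_sum_Basis[OF smooth_on_linear_dd[OF sg xU], of x] by simp
  also have "\<dots> = 0" using dd_inner_right[OF smooth xU] dF_radial[OF x] by simp
  finally have "(\<Sum>b\<in>Basis. dd b (\<lambda>x. norm x powr \<alpha>) x * dd b (\<lambda>x. F x \<bullet> c) x) = 0" by simp
  then have "laplacian (\<lambda>x. norm x powr \<alpha> * (F x \<bullet> c)) x
     = - \<mu> * (norm x powr \<alpha> * norm x powr - 2) * (F x \<bullet> c) + \<mu> * norm x powr (\<alpha> - 2) * (F x \<bullet> c)"
    unfolding laplacian_mult[OF smooth_on_norm_powr sg xU] lap laplacian_norm_powr[OF x] \<mu>
    by simp
  then show ?thesis unfolding r by simp
qed

lemma spherical_harmonic_components:
  assumes eig: "\<And>x. norm x = 1 \<Longrightarrow> (\<Sum>b\<in>Basis. D2 x b b) = - \<mu> *\<^sub>R F x"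
    and \<mu>: "\<mu> = \<alpha> * (\<alpha> + real DIM('a) - 2)" and \<alpha>: "\<alpha> \<ge> 0" and dim: "DIM('a) \<ge> 3"
  obtains k where "\<alpha> = real k" "\<And>c. spherical_harmonic k (\<lambda>x. F x \<bullet> c)"
proof -
  define u where "u c x = norm x powr \<alpha> * (F x \<bullet> c)" for c x
  have harm: "laplacian (u c) x = 0" if "x \<noteq> 0" for c x
    unfolding u_def[abs_def] by (rule harmonic_component[OF eig \<mu> that])
  have alt: "(\<forall>x. x \<noteq> 0 \<longrightarrow> u c x = 0) \<or>
    (\<exists>k P. \<alpha> = real k \<and> real_polynomial_function P \<and> (\<forall>t x. P (t *\<^sub>R x) = t ^ k * P x) \<and> (\<forall>x. x \<noteq> 0 \<longrightarrow> P x = u c x))" for c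
    by (rule homog_harmonic_imp_polynomial[OF _ _ \<alpha> harm dim])
      (simp_all add: u_def[abs_def] smooth_component homog_component)
  obtain x :: 'a where x: "norm x = 1" using vector_choose_size[of 1] by auto
  then have x0: "x \<noteq> 0" by auto
  \<comment> \<open>In the direction of the value \<open>F x\<close> the component at
    \<open>x\<close> is 1.\<close>
  have "u (F x) x \<noteq> 0" using unit[OF x0] x x0 by (simp add: u_def norm_eq_1)
  then obtain k where k: "\<alpha> = real k" using alt[of "F x"] x0 by blast
  have "spherical_harmonic k (\<lambda>x. F x \<bullet> c)" for c
  proof (cases "\<forall>x. x \<noteq> 0 \<longrightarrow> u c x = 0")
    case True
    have "F x \<bullet> c = 0" if "x \<in> sphere 0 1" for x
    proof -
      have "x \<noteq> 0" using that by auto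
      then show ?thesis using True that by (auto simp: u_def)
    qed
    \<comment> \<open>An identically zero component counts as a spherical harmonic of the common
      degree \<open>k\<close>.\<close>
    moreover have "homogeneous_harmonic_polynomial k (\<lambda>x::'a. 0)"
      by (simp add: homogeneous_harmonic_polynomial_def laplacian_def real_polynomial_function.intros(2))
    ultimately show ?thesis unfolding spherical_harmonic_def by (intro exI[of _ "\<lambda>x. 0"]) simp
  next
    case False
    then obtain k' P where P: "\<alpha> = real k'" "real_polynomial_function P" "\<forall>t x. P (t *\<^sub>R x) = t ^ k' * P x"
      "\<forall>x. x \<noteq> 0 \<longrightarrow> P x = u c x" using alt[of c] by blast
    have "laplacian P x = 0" for x
      by (rule laplacian_polynomial_extension[OF P(2) _ harm]) (use P(4) in auto)
    then have "homogeneous_harmonic_polynomial k P"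
      using P k by (simp add: homogeneous_harmonic_polynomial_def)
    moreover have "F x \<bullet> c = P x" if "x \<in> sphere 0 1" for x
    proof -
      have "x \<noteq> 0" using that by auto
      then show ?thesis using P(4) that by (simp add: u_def)
    qed
    ultimately show ?thesis unfolding spherical_harmonic_def by blast
  qed
  then show ?thesis using that k by blast
qed

text \<open>Bochner's argument: the gradients of the harmonic components of \<open>norm x *\<^sub>R F x\<close> have constant
  total square norm, so all second derivatives vanish.\<close>

lemma linear_of_isometric:
  assumes eig: "\<And>x. norm x = 1 \<Longrightarrow> (\<Sum>b\<in>Basis. D2 x b b) = - (real DIM('a) - 1) *\<^sub>R F x"
    and en: "\<And>x. norm x = 1 \<Longrightarrow> energy x = e" and dim: "DIM('a) \<ge> 2"
  obtains L where "linear L" "\<And>x. x \<noteq> 0 \<Longrightarrow> norm x *\<^sub>R F x = L x"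
proof -
  define u where "u c x = norm x powr 1 * (F x \<bullet> c)" for c x
  have su: "smooth_on_open (- {0}) (u c)" and hu: "homog 1 (u c)" for c
    unfolding u_def[abs_def] by (rule smooth_component homog_component)+
  have harm: "laplacian (u c) x = 0" if "x \<noteq> 0" for c x
    unfolding u_def[abs_def] by (rule harmonic_component[OF eig _ that]) simp_all
  define S where "S x = (\<Sum>c\<in>Basis. grad_sq (u c) x)" for x
  \<comment> \<open>The radial derivative of \<open>norm x *\<^sub>R F x\<close> has length 1, the
    tangential ones contribute the energy, and the two parts are orthogonal.\<close>
  have S1: "S x = 1 + e" if x: "norm x = 1" for x
  proof -
    have x0: "x \<noteq> 0" and xU: "x \<in> - {0}" using x by auto
    have FF: "F x \<bullet> F x = 1" using unit[OF x0] by (simp add: norm_eq_1)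
    have "dd b (u c) x = ((x \<bullet> b) *\<^sub>R F x + dd b F x) \<bullet> c" for b c
    proof -
      have sg: "smooth_on_open (- {0}) (\<lambda>x. F x \<bullet> c)"
        by (intro smooth_on_inner smooth smooth_on_const open_nonzero)
      show ?thesis unfolding u_def[abs_def] dd_mult[OF smooth_on_norm_powr sg xU] dd_norm_powr[OF x0]
          dd_inner_right[OF smooth xU] using x by (simp add: inner_add_left)
    qed
    then have "S x = (\<Sum>b\<in>Basis. \<Sum>c\<in>Basis. (((x \<bullet> b) *\<^sub>R F x + dd b F x) \<bullet> c) * (((x \<bullet> b) *\<^sub>R F x + dd b F x) \<bullet> c))"
      unfolding S_def grad_sq_def by (subst sum.swap) simp
    also have "\<dots> = (\<Sum>b\<in>Basis. ((x \<bullet> b) *\<^sub>R F x + dd b F x) \<bullet> ((x \<bullet> b) *\<^sub>R F x + dd b F x))"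
      by (intro sum.cong refl euclidean_inner[symmetric])
    also have "\<dots> = (\<Sum>b\<in>Basis. (x \<bullet> b) * (x \<bullet> b) + dd b F x \<bullet> dd b F x)"
    proof (rule sum.cong[OF refl])
      fix b
      have "dd b F x \<bullet> F x = 0" "F x \<bullet> dd b F x = 0" using dF_orthogonal[OF x0, of b] by (simp_all add: inner_commute)
      then show "((x \<bullet> b) *\<^sub>R F x + dd b F x) \<bullet> ((x \<bullet> b) *\<^sub>R F x + dd b F x) = (x \<bullet> b) * (x \<bullet> b) + dd b F x \<bullet> dd b F x"
        using FF by (simp add: inner_add_left inner_add_right)
    qed
    also have "\<dots> = (\<Sum>b\<in>Basis. (x \<bullet> b) * (x \<bullet> b)) + energy x"
      by (simp add: energy_def sum.distrib)
    also have "(\<Sum>b\<in>Basis. (x \<bullet> b) * (x \<bullet> b)) = 1" using x unfolding euclidean_inner[of x x, symmetric] by (simp add: norm_eq_1)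
    finally show ?thesis using en[OF x] by simp
  qed
  have S: "S x = 1 + e" if x: "x \<noteq> 0" for x
  proof -
    have "grad_sq (u c) x = grad_sq (u c) (sgn x)" for c
      using homog_sgn[OF homog_grad_sq[OF su hu] x, of c] x by simp
    then show ?thesis using S1[of "sgn x"] x by (simp add: S_def norm_sgn)
  qed
  \<comment> \<open>\<open>S\<close> is constant, so the sum of the nonnegative Hessian norms from
    Bochner's formula is 0 and each of them vanishes.\<close>
  have hess: "hess_sq (u c) x = 0" if x: "x \<noteq> 0" and c: "c \<in> Basis" for c x
  proof -
    have xU: "x \<in> - {0}" using x by simp
    have "laplacian S x = laplacian (\<lambda>_. 1 + e) x"
      by (rule laplacian_cong[OF open_nonzero xU]) (use S in auto)
    also have "\<dots> = 0" by (simp add: laplacian_def)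
    finally have "laplacian S x = 0" .
    moreover have "laplacian S x = (\<Sum>c\<in>Basis. laplacian (grad_sq (u c)) x)"
      unfolding S_def[abs_def]
      by (rule laplacian_sum[OF smooth_on_grad_sq[OF su] open_nonzero xU])
    ultimately have "(\<Sum>c\<in>Basis. hess_sq (u c) x) = 0"
      using laplacian_grad_sq[OF su _ xU] harm by (simp flip: sum_distrib_left)
    then have "\<forall>c\<in>Basis. hess_sq (u c) x = 0"
      by (subst (asm) sum_nonneg_eq_0_iff) (auto simp: hess_sq_def intro!: sum_nonneg)
    then show ?thesis using c by blast
  qed
  have d2: "dd v (dd b (u c)) x = 0" if x: "x \<noteq> 0" and c: "c \<in> Basis" and b: "b \<in> Basis" for b c v x
  proof -
    have xU: "x \<in> - {0}" using x by simp
    have "(\<Sum>b\<in>Basis. \<Sum>d\<in>Basis. (dd d (dd b (u c)) x)^2) = 0" using hess[OF x c] by (simp add: hess_sq_def)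
    then have "(\<Sum>d\<in>Basis. (dd d (dd b (u c)) x)^2) = 0"
      using b by (subst (asm) sum_nonneg_eq_0_iff) (auto intro: sum_nonneg)
    then have "\<forall>d\<in>Basis. dd d (dd b (u c)) x = 0"
      by (subst (asm) sum_nonneg_eq_0_iff) auto
    then show ?thesis
      using linear_eq_sum_Basis[OF smooth_on_linear_dd[OF smooth_on_dd[OF su] xU], of c b v] by simp
  qed
  have "\<exists>a. \<forall>x. x \<noteq> 0 \<longrightarrow> dd b (u c) x = a" if "b \<in> Basis" "c \<in> Basis" for b c
    using constant_of_dd_zero[OF smooth_on_dd[OF su] dim d2[OF _ that(2,1)]] by metis
  then obtain a where a: "\<And>b c x. b \<in> Basis \<Longrightarrow> c \<in> Basis \<Longrightarrow> x \<noteq> 0 \<Longrightarrow> dd b (u c) x = a b c" by metis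
  define L where "L x = (\<Sum>c\<in>Basis. (\<Sum>b\<in>Basis. (x \<bullet> b) * a b c) *\<^sub>R c)" for x
  have "linear L" unfolding L_def
    by (intro linearI) (simp_all add: inner_add_left distrib_right sum.distrib scaleR_left.add
        scaleR_sum_right sum_distrib_left mult.assoc)
  moreover have "norm x *\<^sub>R F x = L x" if x: "x \<noteq> 0" for x
  proof -
    have xU: "x \<in> - {0}" using x by simp
    have "(norm x *\<^sub>R F x) \<bullet> c = (\<Sum>b\<in>Basis. (x \<bullet> b) * a b c)" if c: "c \<in> Basis" for c
    proof -
      have "(norm x *\<^sub>R F x) \<bullet> c = u c x" using x by (simp add: u_def)
      also have "\<dots> = dd x (u c) x" using homog_euler[OF su hu x, of c] by simp
      also have "\<dots> = (\<Sum>b\<in>Basis. (x \<bullet> b) * dd b (u c) x)"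
        using linear_eq_sum_Basis[OF smooth_on_linear_dd[OF su xU], of c x] by simp
      finally show ?thesis using a[OF _ c x] by simp
    qed
    then have "(\<Sum>c\<in>Basis. ((norm x *\<^sub>R F x) \<bullet> c) *\<^sub>R c) = L x"
      unfolding L_def by (intro sum.cong refl) (simp only:)
    then show ?thesis by (simp only: euclidean_representation)
  qed
  ultimately show ?thesis using that by blast
qed

end

section \<open>Lawson-Osserman maps\<close>

text \<open>Near \<open>x\<close> the composite with \<open>sgn\<close> can be computed from any
  local smooth extension of \<open>f\<close>, since \<open>sgn\<close> takes values on the
  sphere.\<close>

lemma smooth_on_sphere_extension:
  fixes f :: "'a::euclidean_space \<Rightarrow> 'b::euclidean_space"
  assumes f: "smooth_map_on (sphere 0 1) f"
  shows "smooth_on_open (- {0}) (\<lambda>x. f (sgn x))"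
proof (rule smooth_on_local[OF open_nonzero])
  fix x :: 'a assume x: "x \<in> - {0}"
  then have "sgn x \<in> sphere 0 1" by (simp add: norm_sgn)
  then obtain U G where U: "sgn x \<in> U" "smooth_on_open U G" "\<forall>y\<in>sphere 0 1 \<inter> U. G y = f y"
    using f unfolding smooth_map_on_def by blast
  define V where "V = (- {0 :: 'a}) \<inter> sgn -` U"
  have V: "open V"
    unfolding V_def
    using continuous_open_preimage[OF smooth_on_continuous[OF smooth_on_sgn] open_nonzero smooth_on_open_open[OF U(2)]] .
  have "smooth_on_open V (\<lambda>y. G (sgn y))"
    by (rule smooth_on_compose[OF U(2) smooth_on_subset[OF smooth_on_sgn V]]) (auto simp: V_def)
  then have "smooth_on_open V (\<lambda>y. f (sgn y))"
    by (rule smooth_on_cong) (use U(3) in \<open>auto simp: V_def norm_sgn\<close>)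
  moreover have "x \<in> V" using x U(1) by (simp add: V_def)
  ultimately show "\<exists>V. x \<in> V \<and> smooth_on_open V (\<lambda>y. f (sgn y))" by blast
qed

lemma spherical_map_extension:
  fixes f :: "'a::euclidean_space \<Rightarrow> 'b::euclidean_space"
  assumes f: "smooth_map_on (sphere 0 1) f" and im: "f ` sphere 0 1 \<subseteq> sphere 0 1"
  shows "spherical_map (\<lambda>x. f (sgn x))"
proof (rule spherical_map.intro)
  show "smooth_on_open (- {0}) (\<lambda>x. f (sgn x))" by (rule smooth_on_sphere_extension[OF f])
  show "homog 0 (\<lambda>x. f (sgn x))" by (auto simp: homog_def sgn_scaleR)
  show "norm (f (sgn x)) = 1" if "x \<noteq> 0" for x
  proof -
    have "sgn x \<in> sphere 0 1" using that by (simp add: norm_sgn)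
    then have "f (sgn x) \<in> sphere 0 1" using im by blast
    then show ?thesis by simp
  qed
qed

lemma sgn_unit: "norm x = 1 \<Longrightarrow> sgn x = (x :: 'a::real_normed_vector)"
  by (simp add: sgn_div_norm)

text \<open>Both sides are the velocity of the image of the tangent line through \<open>x\<close>,
  which \<open>sgn\<close> bends onto the sphere.\<close>

lemma differential_sphere:
  fixes f :: "'a::euclidean_space \<Rightarrow> 'b::euclidean_space"
  assumes f: "smooth_map_on (sphere 0 1) f" and x: "norm x = 1" and a: "x \<bullet> a = 0"
  shows "differential (sphere 0 1) f x a = dd a (\<lambda>x. f (sgn x)) x"
proof -
  have x0: "x + 0 *\<^sub>R a \<in> - {0}" using x by auto
  have "((\<lambda>t. f (sgn (x + t *\<^sub>R a))) has_derivative (\<lambda>t. dd (t *\<^sub>R a) (\<lambda>x. f (sgn x)) x)) (at 0)"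
    using has_derivative_compose[OF line_has_derivative smooth_on_has_derivative[OF smooth_on_sphere_extension[OF f] x0]] by simp
  from fun_cong[OF has_derivative_unique[OF this id_embedding.differential_curve[OF f x a]], of 1]
  show ?thesis by (simp add: sgn_unit[OF x] dd_sgn_unit[OF x] a)
qed

lemma singular_space_cong:
  "(\<And>v. v \<in> V \<Longrightarrow> A v = B v) \<Longrightarrow> singular_space V A \<sigma> = singular_space V B \<sigma>"
  by (auto simp: singular_space_def)

section \<open>Frames and singular values\<close>

context spherical_map
begin

text \<open>Every member of an adapted basis is a singular vector whose singular value is the length
  of its image, so the hypothesis forces all nonzero lengths to agree. \<open>H\<close> and
  \<open>K\<close> separate nonzero from zero images.\<close>

lemma frame_exists:
  assumes x: "norm x = 1"
    and eq: "\<And>\<sigma> \<tau>. singular_value {v. x \<bullet> v = 0} (frechet_derivative F (at x)) \<sigma> \<Longrightarrow> \<sigma> \<noteq> 0 \<Longrightarrow>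
      singular_value {v. x \<bullet> v = 0} (frechet_derivative F (at x)) \<tau> \<Longrightarrow> \<tau> \<noteq> 0 \<Longrightarrow> \<sigma> = \<tau>"
  shows "\<exists>lam H K. lam \<ge> 0 \<and> frame lam x H K"
proof -
  have x0: "x \<noteq> 0" using x by auto
  let ?V = "{v. x \<bullet> v = 0}" and ?A = "frechet_derivative F (at x)"
  note A = linear_dF[OF x0]
  obtain E where E: "orthonormal_basis_of ?V E" "\<And>e e'. e \<in> E \<Longrightarrow> e' \<in> E \<Longrightarrow> e \<noteq> e' \<Longrightarrow> ?A e \<bullet> ?A e' = 0"
    using adapted_orthonormal_basis[OF A subspace_hyperplane] by blast
  note fin = orthonormal_basis_of_finite_card(1)[OF E(1)]
  have sv: "?A e \<bullet> ?A w = (norm (?A e))^2 * (e \<bullet> w)" if e: "e \<in> E" and w: "w \<in> ?V" for e w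
  proof -
    have "?A w = ?A (\<Sum>e'\<in>E. (w \<bullet> e') *\<^sub>R e')" using orthonormal_basis_of_expand[OF E(1) w] by simp
    also have "\<dots> = (\<Sum>e'\<in>E. (w \<bullet> e') *\<^sub>R ?A e')" by (simp only: linear_sum[OF A] linear_cmul[OF A])
    finally have "?A e \<bullet> ?A w = (\<Sum>e'\<in>E. (w \<bullet> e') * (?A e \<bullet> ?A e'))" by (simp add: inner_sum_right)
    also have "\<dots> = (\<Sum>e'\<in>E. if e' = e then (w \<bullet> e) * (norm (?A e))^2 else 0)"
      using E(2)[OF e] by (intro sum.cong refl) (auto simp: power2_norm_eq_inner)
    finally show ?thesis using e fin by (simp add: inner_commute)
  qed
  have val: "singular_value ?V ?A (norm (?A e))" if e: "e \<in> E" for e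
  proof -
    have "e \<in> ?V" "e \<noteq> 0" using E(1) e by (auto simp: orthonormal_basis_of_def)
    then show ?thesis using sv[OF e] by (auto simp: singular_value_def singular_space_def)
  qed
  define H where "H = {e \<in> E. ?A e \<noteq> 0}"
  define K where "K = {e \<in> E. ?A e = 0}"
  obtain lam where lam: "lam \<ge> 0" "\<And>e. e \<in> H \<Longrightarrow> norm (?A e) = lam"
  proof (cases "H = {}")
    case True
    \<comment> \<open>If the differential vanishes at \<open>x\<close>, any value would do for
      \<open>lam\<close>; this case is ruled out later, when minimality forces a positive
      energy.\<close>
    then show ?thesis using that[of 0] by auto
  next
    case False
    then obtain e0 where e0: "e0 \<in> H" by blast
    have "norm (?A e) = norm (?A e0)" if "e \<in> H" for e
      by (rule eq) (use that e0 val in \<open>auto simp: H_def\<close>)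
    then show ?thesis using that[of "norm (?A e0)"] by simp
  qed
  have "?A e \<bullet> ?A v = lam^2 * (e \<bullet> v)" if e: "e \<in> H" for e v
  proof -
    have eE: "e \<in> E" using e by (simp add: H_def)
    then have ex: "e \<bullet> x = 0" using E(1) by (auto simp: orthonormal_basis_of_def inner_commute)
    have w: "v - (x \<bullet> v) *\<^sub>R x \<in> ?V" using x by (simp add: inner_diff_right norm_eq_1)
    have "?A (v - (x \<bullet> v) *\<^sub>R x) = ?A v" by (simp add: linear_diff[OF A] linear_cmul[OF A] dF_radial[OF x0])
    then show ?thesis using sv[OF eE w] lam(2)[OF e] by (simp add: inner_diff_right ex)
  qed
  moreover have "H \<union> K = E" "H \<inter> K = {}" by (auto simp: H_def K_def)
  ultimately have "frame lam x H K" using E(1) by (simp add: frame_def K_def)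
  then show ?thesis using lam by blast
qed

text \<open>A singular vector with nonzero singular value is orthogonal to the kernel, hence has
  components along \<open>H\<close> only; testing it against one on which it is nonzero compares
  \<sigma> with \<open>lam\<close>.\<close>

lemma frame_singular_space:
  assumes x: "norm x = 1" and fr: "frame lam x H K" and \<sigma>: "\<sigma> \<noteq> 0" and lam: "lam > 0"
    and v: "v \<in> singular_space {v. x \<bullet> v = 0} (frechet_derivative F (at x)) \<sigma>"
  shows "v \<in> span H" "v \<noteq> 0 \<Longrightarrow> \<sigma>^2 = lam^2"
proof -
  have onb: "orthonormal_basis_of {v. x \<bullet> v = 0} (H \<union> K)" and disj: "H \<inter> K = {}"
    and K: "\<forall>e\<in>K. dd e F x = 0" and H: "\<forall>e\<in>H. \<forall>v. dd e F x \<bullet> dd v F x = lam^2 * (e \<bullet> v)"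
    using fr by (auto simp: frame_def)
  note fin = frame_finite[OF fr x]
  have vV: "x \<bullet> v = 0" and s: "\<And>w. x \<bullet> w = 0 \<Longrightarrow> dd v F x \<bullet> dd w F x = \<sigma>^2 * (v \<bullet> w)"
    using v by (auto simp: singular_space_def)
  have "v \<bullet> e = 0" if "e \<in> K" for e
    using s[of e] frame_perp[OF fr x, of e] K that \<sigma> by simp
  then have "v = (\<Sum>e\<in>H. (v \<bullet> e) *\<^sub>R e)"
    using orthonormal_basis_of_expand[OF onb, of v] vV by (simp add: sum.union_disjoint[OF fin disj])
  moreover have "(\<Sum>e\<in>H. (v \<bullet> e) *\<^sub>R e) \<in> span H"
    by (intro span_sum span_mul span_base)
  ultimately show "v \<in> span H" by simp
  assume v0: "v \<noteq> 0"
  have "\<exists>e\<in>H. v \<bullet> e \<noteq> 0"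
  proof (rule ccontr)
    assume "\<not> ?thesis"
    then have "(\<Sum>e\<in>H. (v \<bullet> e) *\<^sub>R e) = 0" by (intro sum.neutral) auto
    then show False using \<open>v = _\<close> v0 by simp
  qed
  then obtain e where e: "e \<in> H" "v \<bullet> e \<noteq> 0" by blast
  have "dd e F x \<bullet> dd v F x = \<sigma>^2 * (v \<bullet> e)"
    using s[of e] frame_perp[OF fr x, of e] e by (simp add: inner_commute)
  then show "\<sigma>^2 = lam^2" using H e by (simp add: inner_commute)
qed

text \<open>Connects the multiplicity in the theorem with the number of horizontal frame vectors:
  the singular space and \<open>H\<close> have the same span.\<close>

lemma frame_singular_multiplicity:
  assumes x: "norm x = 1" and fr: "frame lam x H K" and lam: "lam > 0"
  shows "singular_multiplicity {v. x \<bullet> v = 0} (frechet_derivative F (at x)) lam = card H"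
proof -
  have x0: "x \<noteq> 0" using x by auto
  have onb: "orthonormal_basis_of {v. x \<bullet> v = 0} (H \<union> K)"
    and H: "\<forall>e\<in>H. \<forall>v. dd e F x \<bullet> dd v F x = lam^2 * (e \<bullet> v)"
    using fr by (auto simp: frame_def)
  let ?S = "singular_space {v. x \<bullet> v = 0} (frechet_derivative F (at x)) lam"
  have "lam \<noteq> 0" using lam by simp
  have "?S \<subseteq> span H" by (rule subsetI) (rule frame_singular_space(1)[OF x fr \<open>lam \<noteq> 0\<close> lam])
  moreover have "H \<subseteq> ?S"
    using frame_perp[OF fr x] H by (auto simp: singular_space_def)
  ultimately have "span ?S = span H"
    by (metis span_eq span_mono span_superset subset_trans)
  then have "dim ?S = dim H" by (metis dim_span)
  also have "\<dots> = card H"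
  proof -
    have "orthonormal_basis_of (span H) H"
      using onb frame_unit[OF fr x] unfolding orthonormal_basis_of_def
      by (auto intro: span_base pairwise_subset)
    from orthonormal_basis_of_finite_card(2)[OF this] show ?thesis by simp
  qed
  finally show ?thesis by (simp add: singular_multiplicity_def)
qed

end

text \<open>The adjoint is a linear left inverse, so the image is an instance of
  \<open>sphere_embedding\<close>. Second derivatives of \<open>L\<close> composed with
  \<open>sgn\<close> are multiples of the position vector, which is orthogonal to the target
  sphere.\<close>

lemma linear_isometry_totally_geodesic:
  fixes f :: "'a::euclidean_space \<Rightarrow> 'b::euclidean_space"
  assumes L: "linear L" and iso: "\<And>x. norm (L x) = norm x" and f: "\<And>x. norm x = 1 \<Longrightarrow> f x = L x"
  shows "totally_geodesic_isometric_embedding (sphere 0 1) (sphere 0 1) f"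
proof -
  have bL: "bounded_linear L" using L linear_conv_bounded_linear by blast
  have ip: "L u \<bullet> L v = u \<bullet> v" for u v
  proof -
    have "(norm (L (u + v)))^2 = (norm (u + v))^2" "(norm (L u))^2 = (norm u)^2" "(norm (L v))^2 = (norm v)^2"
      by (simp_all only: iso)
    then show ?thesis
      by (simp add: linear_add[OF L] power2_norm_eq_inner inner_add_left inner_add_right inner_commute)
  qed
  define \<Phi> where "\<Phi> x = L (sgn x)" for x
  define R where "R = adjoint L"
  have adj: "x \<bullet> R y = L x \<bullet> y" for x y unfolding R_def using adjoint_works[OF L] by simp
  have RL: "R (L x) = x" for x
    by (rule vector_eq_ldot[THEN iffD1]) (simp add: adj ip)
  have R: "bounded_linear R"
    unfolding R_def using adjoint_linear[OF L] linear_conv_bounded_linear by blast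
  interpret em: sphere_embedding \<Phi> R
  proof (rule sphere_embedding.intro)
    show "smooth_on_open (- {0}) \<Phi>"
      unfolding \<Phi>_def[abs_def] by (rule smooth_on_linear_compose[OF bL smooth_on_sgn])
    show "homog 0 \<Phi>" by (auto simp: homog_def \<Phi>_def sgn_scaleR)
    show "R (\<Phi> x) = sgn x" if "x \<noteq> 0" for x by (simp add: \<Phi>_def RL)
  qed (rule R)
  have \<Phi>_unit: "\<Phi> x = L x" if "norm x = 1" for x by (simp add: \<Phi>_def sgn_unit[OF that])
  have M: "em.M = f ` sphere 0 1" unfolding em.M_def by (intro image_cong) (auto simp: \<Phi>_unit f)
  have sm: "smooth_map_on (sphere 0 1) f"
    by (rule smooth_map_onI[OF smooth_on_bounded_linear[OF bL open_UNIV]]) (auto simp: f)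
  have d\<Phi>: "dd a \<Phi> y = L (dd a sgn y)" if "y \<noteq> 0" for a y
    using dd_eqI[OF bounded_linear.has_derivative[OF bL smooth_on_has_derivative[OF smooth_on_sgn]], of y a] that
    by (simp add: \<Phi>_def[abs_def])
  have nz: "x \<in> - {0}" if "norm x = 1" for x :: 'a using that by auto
  have f\<Phi>: "frechet_derivative (\<lambda>x. f (sgn x)) (at x) = frechet_derivative \<Phi> (at x)" if "norm x = 1" for x
    by (rule frechet_derivative_cong_open[OF open_nonzero nz[OF that]]) (auto simp: \<Phi>_def f norm_sgn)
  have df: "differential (sphere 0 1) f x a = L a" if x: "norm x = 1" and a: "x \<bullet> a = 0" for x a
    using differential_sphere[OF sm x a] d\<Phi>[of x a] nz[OF x] by (simp add: f\<Phi>[OF x] dd_sgn_unit[OF x] a)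
  have "isometric_embedding (sphere 0 1) (sphere 0 1) f"
    unfolding isometric_embedding_def
  proof (intro conjI ballI)
    show "f ` sphere 0 1 \<subseteq> sphere 0 1" by (auto simp: f iso)
    show "\<exists>g. homeomorphism (sphere 0 1) (f ` sphere 0 1) f g"
    proof (intro exI[of _ R] homeomorphismI)
      show "continuous_on (sphere 0 1) f"
        using continuous_on_eq[OF linear_continuous_on[OF bL, of "sphere 0 1"], of f] by (simp add: f)
      show "continuous_on (f ` sphere 0 1) R" by (rule linear_continuous_on[OF R])
    qed (auto simp: f RL)
    fix x u v :: 'a assume "x \<in> sphere 0 1" and uv: "u \<in> tangent_space (sphere 0 1) x" "v \<in> tangent_space (sphere 0 1) x"
    then have x: "norm x = 1" by simp
    show "differential (sphere 0 1) f x u \<bullet> differential (sphere 0 1) f x v = u \<bullet> v"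
      using uv by (simp add: tangent_space_sphere[OF x] df[OF x] ip)
  qed (rule sm)
  moreover have "totally_geodesic (sphere 0 1) (f ` sphere 0 1)"
    unfolding totally_geodesic_def M[symmetric]
  proof (intro ballI)
    fix p u v assume p: "p \<in> em.M" and u: "u \<in> tangent_space em.M p" and v: "v \<in> tangent_space em.M p"
    define x where "x = R p"
    have x: "norm x = 1" and p: "p = \<Phi> x" using em.R_mem[OF p] by (auto simp: x_def)
    obtain a b where a: "u = dd a \<Phi> x" "x \<bullet> a = 0" and b: "v = dd b \<Phi> x" "x \<bullet> b = 0"
      using u v unfolding p em.tangent_space_M[OF x] by blast
    have n: "norm (\<Phi> x) = 1" by (simp add: \<Phi>_unit[OF x] iso x)
    have N: "tangent_space (sphere 0 1) (\<Phi> x) = {v. \<Phi> x \<bullet> v = 0}" by (rule tangent_space_sphere[OF n])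
    have subN: "subspace (tangent_space (sphere 0 1) (\<Phi> x))" unfolding N by (rule subspace_hyperplane)
    have "frechet_derivative (dd b \<Phi>) (at x) = frechet_derivative (\<lambda>y. L (dd b sgn y)) (at x)"
      by (rule frechet_derivative_cong_open[OF open_nonzero nz[OF x]]) (simp add: d\<Phi>)
    then have "dd a (dd b \<Phi>) x = dd a (\<lambda>y. L (dd b sgn y)) x" by (rule fun_cong)
    also have "\<dots> = L (dd a (dd b sgn) x)"
      by (rule dd_eqI[OF bounded_linear.has_derivative[OF bL smooth_on_has_derivative[OF smooth_on_dd[OF smooth_on_sgn] nz[OF x]]]])
    also have "\<dots> = - (a \<bullet> b) *\<^sub>R \<Phi> x"
      unfolding dd_dd_sgn_unit[OF x a(2) b(2)] by (simp only: linear_cmul[OF L] \<Phi>_unit[OF x])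
    finally have "dd a (dd b \<Phi>) x = - (a \<bullet> b) *\<^sub>R \<Phi> x" .
    moreover have "orth_proj (normal_space (sphere 0 1) em.M (\<Phi> x)) (- (a \<bullet> b) *\<^sub>R \<Phi> x) = 0"
      unfolding orth_proj_eq_0_iff[OF em.subspace_normal_space[OF subN]] by (auto simp: normal_space_def N)
    ultimately show "second_fundamental_form (sphere 0 1) em.M p u v = 0"
      unfolding p a(1) b(1) em.second_fundamental_form_eq[OF subN x a(2) b(2)] by simp
  qed
  ultimately show ?thesis by (simp add: totally_geodesic_isometric_embedding_def)
qed

lemma arccos_iff:
  assumes t: "\<theta> \<in> {0<..<pi/2}" and Z: "0 \<le> Z" "Z \<le> 1"
  shows "\<theta> = arccos (sqrt Z) \<longleftrightarrow> (cos \<theta>)^2 = Z"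
proof
  assume "\<theta> = arccos (sqrt Z)"
  then have "cos \<theta> = sqrt Z" using Z by (simp add: cos_arccos order_trans[OF _ real_sqrt_ge_zero])
  then show "(cos \<theta>)^2 = Z" using Z by simp
next
  assume "(cos \<theta>)^2 = Z"
  moreover have "cos \<theta> \<ge> 0" using t by (intro cos_ge_zero) auto
  ultimately have "sqrt Z = cos \<theta>" by (metis real_sqrt_unique)
  then show "\<theta> = arccos (sqrt Z)" using t by (simp add: arccos_cos)
qed

theorem theorem2p8:
  fixes f :: "real ^ 'a \<Rightarrow> real ^ 'b"
    and n m p :: nat and lam :: real and x0 :: "real ^ 'a"
  assumes dim_dom: "CARD('a) = n + 1"
    and dim_cod: "CARD('b) = m + 1"
    and lomse: "LOMSE f"
    and x0: "x0 \<in> sphere 0 1"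
    and lam_nz: "lam \<noteq> 0"
    and lam: "singular_value (tangent_space (sphere 0 1) x0) (differential (sphere 0 1) f x0) lam"
    and mult: "singular_multiplicity (tangent_space (sphere 0 1) x0) (differential (sphere 0 1) f x0) lam = p"
  shows "\<exists>k::nat. k \<ge> 2 \<and>
    (\<forall>i. spherical_harmonic k (\<lambda>x. f x $ i)) \<and>
    lam = sqrt (real k * (real k + real n - 1) / real p) \<and>
    (\<forall>\<theta>\<in>{0<..<pi/2}. LO_sphere f \<theta> \<longleftrightarrow>
       \<theta> = arccos (sqrt ((1 - real p / real n) /
                         (1 - real p / (real k * (real k + real n - 1))))))"
proof -
  have sm: "smooth_map_on (sphere 0 1) f" and im: "f ` sphere 0 1 \<subseteq> sphere 0 1"
    and ntg: "\<not> totally_geodesic_isometric_embedding (sphere 0 1) (sphere 0 1) f"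
    using lomse by (auto simp: LOMSE_def LOM_def)
  obtain \<theta>' where t0: "\<theta>' \<in> {0<..<pi/2}" and LO0: "LO_sphere f \<theta>'"
    using lomse by (auto simp: LOMSE_def LOM_def)
  define F where "F x = f (sgn x)" for x
  interpret spherical_map F
    unfolding F_def[abs_def] by (rule spherical_map_extension[OF sm im])
  have Ff: "F x = f x" if "norm x = 1" for x by (simp add: F_def sgn_unit[OF that])
  have LO_F: "LO_sphere F \<theta> \<longleftrightarrow> LO_sphere f \<theta>" for \<theta>
  proof -
    have "LO_set F \<theta> = LO_set f \<theta>" unfolding LO_set_def by (intro image_cong) (auto simp: Ff)
    then show ?thesis by (simp add: LO_sphere_def)
  qed
  have D: "DIM(real ^ 'a) = n + 1" by (simp add: dim_dom)
  have T: "tangent_space (sphere 0 1) x = {v. x \<bullet> v = 0}" if "norm x = 1" for x :: "real ^ 'a"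
    by (rule tangent_space_sphere[OF that])
  have ss: "singular_space (tangent_space (sphere 0 1) x) (differential (sphere 0 1) f x) \<sigma>
      = singular_space {v. x \<bullet> v = 0} (frechet_derivative F (at x)) \<sigma>" if x: "norm x = 1" for x \<sigma>
    unfolding T[OF x] F_def[abs_def] by (rule singular_space_cong) (simp add: differential_sphere[OF sm x])
  have sv: "singular_value (tangent_space (sphere 0 1) x) (differential (sphere 0 1) f x) \<sigma>
      \<longleftrightarrow> singular_value {v. x \<bullet> v = 0} (frechet_derivative F (at x)) \<sigma>" if x: "norm x = 1" for x \<sigma>
    unfolding singular_value_def ss[OF x] ..
  have same: "\<And>x \<sigma> \<tau>. x \<in> sphere 0 1 \<Longrightarrow>
      singular_value (tangent_space (sphere 0 1) x) (differential (sphere 0 1) f x) \<sigma> \<Longrightarrow> \<sigma> \<noteq> 0 \<Longrightarrow>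
      singular_value (tangent_space (sphere 0 1) x) (differential (sphere 0 1) f x) \<tau> \<Longrightarrow> \<tau> \<noteq> 0 \<Longrightarrow> \<sigma> = \<tau>"
    using lomse unfolding LOMSE_def by blast
  have frames: "\<exists>l H K. l \<ge> 0 \<and> frame l x H K" if x: "norm x = 1" for x
  proof (rule frame_exists[OF x])
    fix \<sigma> \<tau>
    assume "singular_value {v. x \<bullet> v = 0} (frechet_derivative F (at x)) \<sigma>" "\<sigma> \<noteq> 0"
      "singular_value {v. x \<bullet> v = 0} (frechet_derivative F (at x)) \<tau>" "\<tau> \<noteq> 0"
    then show "\<sigma> = \<tau>"
      unfolding sv[OF x, symmetric] using same[of x \<sigma> \<tau>] x by simp
  qed
  have nx0: "norm x0 = 1" using x0 by simp
  obtain v where v: "v \<in> singular_space {v. x0 \<bullet> v = 0} (frechet_derivative F (at x0)) lam" "v \<noteq> 0"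
    and lam0: "lam \<ge> 0"
    using lam unfolding singular_value_def ss[OF nx0] by blast
  \<comment> \<open>The singular vector \<open>v\<close> is a nonzero tangent vector, so the tangent
    space has positive dimension.\<close>
  have n1: "n \<ge> 1"
  proof (rule ccontr)
    assume "\<not> n \<ge> 1"
    moreover have "x0 \<noteq> 0" using nx0 by auto
    then have "dim {v. x0 \<bullet> v = 0} = n" using dim_hyperplane[of x0] D by simp
    ultimately have "dim {v. x0 \<bullet> v = 0} = 0" by simp
    then have "{v. x0 \<bullet> v = 0} \<subseteq> {0}" by (simp only: dim_eq_0)
    then show False using v by (auto simp: singular_space_def)
  qed
  have dim2: "DIM(real ^ 'a) \<ge> 2" using D n1 by simp
  obtain l q where l: "l > 0" "q > 0"
    "real q * l^2 = real (DIM(real ^ 'a) - 1) * ((cos \<theta>')^2 + (sin \<theta>')^2 * l^2)"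
    and fr: "\<And>x. norm x = 1 \<Longrightarrow> \<exists>H K. frame l x H K \<and> card H = q"
    using constant_frame[OF t0 LO0[folded LO_F] dim2 frames] by blast
  obtain H0 K0 where f0: "frame l x0 H0 K0" "card H0 = q" using fr[OF nx0] by blast
  have "lam^2 = l^2" by (rule frame_singular_space(2)[OF nx0 f0(1) lam_nz l(1) v])
  then have lam_l: "lam = l" using lam0 l(1) by simp
  have pq: "p = q"
    using mult frame_singular_multiplicity[OF nx0 f0(1) l(1)] f0(2)
    unfolding singular_multiplicity_def ss[OF nx0] lam_l by simp
  have lam_pos: "lam > 0" and p0: "p > 0" using l lam_l pq by auto
  define c s where "c = (cos \<theta>')^2" and "s = (sin \<theta>')^2"
  have cs: "c + s = 1" by (simp add: c_def s_def)
  have c0: "c > 0" using t0 cos_gt_zero_pi[of \<theta>'] by (simp add: c_def)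
  have s0: "s > 0" using t0 sin_gt_zero2[of \<theta>'] by (simp add: s_def)
  have rel: "real p * lam^2 = real n * (c + s * lam^2)"
    using l(3) D by (simp add: lam_l pq c_def s_def)
  have fr': "\<exists>H K. frame lam x H K \<and> card H = p" if "norm x = 1" for x
    using fr[OF that] lam_l pq by blast
  have eig: "(\<Sum>b\<in>Basis. D2 x b b) = - (real p * lam^2) *\<^sub>R F x" if "norm x = 1" for x
    by (rule laplacian_eigen_unit[OF fr' lam_pos t0 LO0[folded LO_F] that])
  have "p \<le> n" using frame_card[OF f0(1) nx0] f0(2) D pq by simp
  moreover have "p \<noteq> n"
  proof
    assume pn: "p = n"
    have "lam^2 = c + s * lam^2" using rel n1 by (simp add: pn)
    moreover have "s = 1 - c" using cs by simp
    ultimately have "c * lam^2 = c" by (simp add: algebra_simps)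
    then have l1: "lam^2 = 1" using c0 by simp
    have en: "energy x = real n" if x: "norm x = 1" for x
      using fr'[OF x] energy_eq[OF x] l1 pn by fastforce
    have eig': "(\<Sum>b\<in>Basis. D2 x b b) = - (real DIM(real ^ 'a) - 1) *\<^sub>R F x" if "norm x = 1" for x
      using eig[OF that] l1 pn D by simp
    obtain L where L: "linear L" "\<And>x. x \<noteq> 0 \<Longrightarrow> norm x *\<^sub>R F x = L x"
      using linear_of_isometric[OF eig' en dim2] by blast
    have "norm (L x) = norm x" for x
      using L(2)[of x] unit[of x] linear_0[OF L(1)] by (cases "x = 0") (auto simp flip: L(2))
    moreover have "f x = L x" if "norm x = 1" for x
    proof -
      have "x \<noteq> 0" using that by auto
      then show ?thesis using L(2)[of x] Ff[OF that] that by simp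
    qed
    ultimately show False using linear_isometry_totally_geodesic[OF L(1)] ntg by blast
  qed
  ultimately have pn: "p < n" by simp
  \<comment> \<open>From \<open>0 < p < n\<close> follows \<open>n \<ge> 2\<close>; the gradient
    estimate for harmonic functions requires an ambient dimension of at least 3.\<close>
  then have dim3: "DIM(real ^ 'a) \<ge> 3" using D p0 by simp
  define \<mu> where "\<mu> = real p * lam^2"
  \<comment> \<open>For \<open>lam^2 \<le> 1\<close> the average \<open>c + s * lam^2\<close> would
    be at least \<open>lam^2\<close>, and the relation would give \<open>n \<le> p\<close>.\<close>
  have lam1: "lam^2 > 1"
  proof (rule ccontr)
    assume "\<not> lam^2 > 1"
    then have "c * lam^2 \<le> c" using c0 by (simp add: mult_left_le)
    then have "lam^2 \<le> c + s * lam^2" using cs by (metis add_right_mono distrib_right mult_1)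
    then have "real n * lam^2 \<le> real p * lam^2" unfolding rel by (intro mult_left_mono) auto
    then show False using pn lam_pos by simp
  qed
  have "\<mu> > real n"
  proof -
    have "s * 1 < s * lam^2" using s0 lam1 by (intro mult_strict_left_mono)
    then have "1 < c + s * lam^2" using cs by simp
    then show ?thesis unfolding \<mu>_def rel using n1 by simp
  qed
  define N where "N = real n - 1"
  \<comment> \<open>The nonnegative root of
    \<open>\<alpha> * (\<alpha> + N) = \<mu>\<close>.\<close>
  define \<alpha> where "\<alpha> = (sqrt (N^2 + 4 * \<mu>) - N) / 2"
  have N: "N \<ge> 0" using n1 by (simp add: N_def)
  have \<mu>0: "\<mu> > 0" using \<open>\<mu> > real n\<close> by linarith
  have \<alpha>: "\<alpha> \<ge> 0" using N \<mu>0 by (simp add: \<alpha>_def real_le_rsqrt)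
  have "\<mu> = \<alpha> * (\<alpha> + N)"
  proof -
    have "\<alpha> * (\<alpha> + N) = ((sqrt (N^2 + 4 * \<mu>))^2 - N^2) / 4"
      by (simp add: \<alpha>_def power2_eq_square field_simps)
    then show ?thesis using N \<mu>0 by simp
  qed
  then have \<alpha>\<mu>: "\<mu> = \<alpha> * (\<alpha> + real DIM(real ^ 'a) - 2)" using D by (simp add: N_def algebra_simps)
  obtain k where k: "\<alpha> = real k" and sh: "\<And>c. spherical_harmonic k (\<lambda>x. F x \<bullet> c)"
    using spherical_harmonic_components[OF eig[folded \<mu>_def] \<alpha>\<mu> \<alpha> dim3] by blast
  have \<mu>k: "real k * (real k + real n - 1) = \<mu>" using \<alpha>\<mu> D by (simp add: k)
  \<comment> \<open>Degrees 0 and 1 have the eigenvalues 0 and \<open>n\<close>, both excluded by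
    \<open>\<mu> > n\<close>.\<close>
  have "k \<ge> 2"
  proof (rule ccontr)
    assume "\<not> k \<ge> 2"
    then have "k = 0 \<or> k = 1" by auto
    then show False using \<mu>k \<open>\<mu> > real n\<close> by auto
  qed
  moreover have "spherical_harmonic k (\<lambda>x. f x $ i)" for i
    using sh[of "axis i 1"] Ff unfolding spherical_harmonic_def by (simp add: cart_eq_inner_axis)
  moreover have "lam = sqrt (real k * (real k + real n - 1) / real p)"
    unfolding \<mu>k using lam_pos p0 by (simp add: \<mu>_def)
  moreover have "\<forall>\<theta>\<in>{0<..<pi/2}. LO_sphere f \<theta> \<longleftrightarrow>
       \<theta> = arccos (sqrt ((1 - real p / real n) / (1 - real p / (real k * (real k + real n - 1)))))"
  proof
    fix \<theta> :: real assume t: "\<theta> \<in> {0<..<pi/2}"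
    define Z where "Z = (1 - real p / real n) / (1 - real p / \<mu>)"
    \<comment> \<open>Since \<open>\<mu> = p * lam^2\<close>, the quotient \<open>p / \<mu>\<close>
      is the reciprocal of \<open>lam^2\<close>. The relation can be solved for the squared cosine
      because \<open>lam^2\<close> differs from 1.\<close>
    have iff: "real p * lam^2 = real n * ((cos t)^2 + (sin t)^2 * lam^2) \<longleftrightarrow> (cos t)^2 = Z" for t
    proof -
      have "Z = (real n - real p) * lam^2 / (real n * (lam^2 - 1))"
      proof -
        have "1 - real p / \<mu> = (lam^2 - 1) / lam^2" using p0 lam_pos by (simp add: \<mu>_def diff_divide_distrib)
        moreover have "1 - real p / real n = (real n - real p) / real n" using n1 by (simp add: diff_divide_distrib)
        ultimately show ?thesis by (simp add: Z_def)
      qed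
      moreover have "real n * (lam^2 - 1) \<noteq> 0" using n1 lam1 by simp
      ultimately have "(cos t)^2 = Z \<longleftrightarrow> (cos t)^2 * (real n * (lam^2 - 1)) = (real n - real p) * lam^2"
        by (metis nonzero_eq_divide_eq)
      then show ?thesis by (auto simp: sin_squared_eq algebra_simps)
    qed
    \<comment> \<open>The angle that exists by assumption realises \<open>Z\<close> as a squared
      cosine, which yields the bounds needed for \<open>arccos\<close> and
      \<open>sqrt\<close>.\<close>
    have "(cos \<theta>')^2 = Z" using rel unfolding c_def s_def iff .
    then have Z: "0 \<le> Z" "Z \<le> 1" using cs c0 s0 unfolding c_def[symmetric] by linarith+
    have "LO_sphere f \<theta> \<longleftrightarrow> real p * lam^2 = real n * ((cos \<theta>)^2 + (sin \<theta>)^2 * lam^2)"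
      using LO_sphere_iff_relation[OF fr' lam_pos t0 LO0[folded LO_F] t] D by (simp add: LO_F)
    also have "\<dots> \<longleftrightarrow> \<theta> = arccos (sqrt Z)" unfolding iff arccos_iff[OF t Z] ..
    finally show "LO_sphere f \<theta> \<longleftrightarrow>
       \<theta> = arccos (sqrt ((1 - real p / real n) / (1 - real p / (real k * (real k + real n - 1)))))"
      unfolding Z_def \<mu>k .
  qed
  ultimately show ?thesis by blast
qed

end
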